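(* Let $E$ be a separable reflexive Banach space, $I\subset\mathbb{R}$ a bounded interval and $R>0$. Then the closed ball $\overline{B_{W^{1,\infty}(I,E)}(R)}=\{u\in W^{1,\infty}(I,E):\|u\|_{W^{1,\infty}}\le R\}$, endowed with the T-topology, is a compact space.
   Context: For each integer $n\ge 2$ let $\mathcal{T}^n:=\{\rho\colon W^{1,\infty}(I,E)\to\mathbb{R}_+ : \rho=|f|\text{ and } f\in[W^{1,n}(I,E)]^*\}$, a family of seminorms on $W^{1,\infty}(I,E)$ (via the inclusion $W^{1,\infty}(I,E)\subset W^{1,n}(I,E)$). The T-topology on $W^{1,\infty}(I,E)$ is the locally convex topology generated by $\bigcup_{n\ge2}\mathcal{T}^n$. Here $\|u\|_{W^{1,p}}=\|u\|_{L^p}+\|\partial_t u\|_{L^p}$. *)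

theory Defs
  imports "HOL-Analysis.Analysis" "HOL-Probability.Essential_Supremum"
begin

text \<open>
  Separability of the Banach space is expressed by the type class
  \<^class>\<open>second_countable_topology\<close> (equivalent to separability for metric spaces), which is also
  what the Bochner integral of the library requires.
\<close>

definition bidual_embedding ::
    "'e::real_normed_vector \<Rightarrow> ('e \<Rightarrow>\<^sub>L real) \<Rightarrow>\<^sub>L real" where
  "bidual_embedding x = Blinfun (\<lambda>\<xi>. blinfun_apply \<xi> x)"

definition reflexive_space :: "'e::real_normed_vector itself \<Rightarrow> bool" where
  "reflexive_space _ \<longleftrightarrow> surj (bidual_embedding :: 'e \<Rightarrow> _)"


section \<open>Lebesgue--Bochner spaces\<close>

text \<open>
  The norms are defined on functions; the points of the spaces below are the classes
  \<open>ae_class M u\<close> of measurable functions modulo equality almost everywhere.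
  The exponent \<open>p\<close> ranges over \<open>[1, \<infinity>]\<close>.
\<close>

definition Lp_fun ::
    "'a measure \<Rightarrow> ennreal \<Rightarrow> ('a \<Rightarrow> 'e::{banach, second_countable_topology}) set" where
  "Lp_fun M p = {u \<in> borel_measurable M.
     if p = \<infinity> then esssup M (\<lambda>t. ennreal (norm (u t))) < \<infinity>
     else integrable M (\<lambda>t. norm (u t) powr enn2real p)}"

definition Lp_norm ::
    "'a measure \<Rightarrow> ennreal \<Rightarrow> ('a \<Rightarrow> 'e::{banach, second_countable_topology}) \<Rightarrow> real" where
  "Lp_norm M p u =
     (if p = \<infinity> then enn2real (esssup M (\<lambda>t. ennreal (norm (u t))))
      else (\<integral>t. norm (u t) powr enn2real p \<partial>M) powr (1 / enn2real p))"

definition ae_class :: "'a measure \<Rightarrow> ('a \<Rightarrow> 'e::topological_space) \<Rightarrow> ('a \<Rightarrow> 'e) set" where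
  "ae_class M u = {v \<in> borel_measurable M. AE t in M. v t = u t}"


section \<open>Sobolev spaces on an interval\<close>

definition test_fun :: "real set \<Rightarrow> (real \<Rightarrow> real) set" where
  "test_fun I = {\<phi>. (\<forall>k t. (deriv ^^ k) \<phi> differentiable at t) \<and>
     compact (closure {t. \<phi> t \<noteq> 0}) \<and> closure {t. \<phi> t \<noteq> 0} \<subseteq> interior I}"

definition locally_integrable ::
    "real set \<Rightarrow> (real \<Rightarrow> 'e::{banach, second_countable_topology}) \<Rightarrow> bool" where
  "locally_integrable I u \<longleftrightarrow>
     (\<forall>K. compact K \<and> K \<subseteq> interior I \<longrightarrow> set_integrable lebesgue K u)"

definition has_weak_deriv ::
    "real set \<Rightarrow> (real \<Rightarrow> 'e::{banach, second_countable_topology}) \<Rightarrow> (real \<Rightarrow> 'e) \<Rightarrow> bool" where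
  "has_weak_deriv I u v \<longleftrightarrow> locally_integrable I u \<and> locally_integrable I v \<and>
     (\<forall>\<phi> \<in> test_fun I.
        (\<integral>t. deriv \<phi> t *\<^sub>R u t \<partial>lebesgue_on I) = - (\<integral>t. \<phi> t *\<^sub>R v t \<partial>lebesgue_on I))"

text \<open>Weak derivatives are unique almost everywhere on \<open>I\<close>, so the choice below does not affect
  norms.\<close>

definition weak_deriv ::
    "real set \<Rightarrow> (real \<Rightarrow> 'e::{banach, second_countable_topology}) \<Rightarrow> real \<Rightarrow> 'e" where
  "weak_deriv I u = (SOME v. has_weak_deriv I u v)"

definition W1_fun ::
    "real set \<Rightarrow> ennreal \<Rightarrow> (real \<Rightarrow> 'e::{banach, second_countable_topology}) set" where
  "W1_fun I p = {u \<in> Lp_fun (lebesgue_on I) p.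
     \<exists>v \<in> Lp_fun (lebesgue_on I) p. has_weak_deriv I u v}"

definition W1_norm ::
    "real set \<Rightarrow> ennreal \<Rightarrow> (real \<Rightarrow> 'e::{banach, second_countable_topology}) \<Rightarrow> real" where
  "W1_norm I p u = Lp_norm (lebesgue_on I) p u + Lp_norm (lebesgue_on I) p (weak_deriv I u)"

definition W1 ::
    "real set \<Rightarrow> ennreal \<Rightarrow> (real \<Rightarrow> 'e::{banach, second_countable_topology}) set set" where
  "W1 I p = ae_class (lebesgue_on I) ` W1_fun I p"

definition W1_cball ::
    "real set \<Rightarrow> ennreal \<Rightarrow> real \<Rightarrow> (real \<Rightarrow> 'e::{banach, second_countable_topology}) set set" where
  "W1_cball I p R = ae_class (lebesgue_on I) ` {u \<in> W1_fun I p. W1_norm I p u \<le> R}"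

text \<open>Bounded linear functionals on \<open>W1 I p\<close>; the vector space operations on classes are those
  of representatives. Values of \<open>f\<close> outside \<open>W1 I p\<close> are irrelevant.\<close>

definition W1_dual ::
    "real set \<Rightarrow> ennreal \<Rightarrow>
      ((real \<Rightarrow> 'e::{banach, second_countable_topology}) set \<Rightarrow> real) set" where
  "W1_dual I p = {f.
     (\<forall>u \<in> W1_fun I p. \<forall>v \<in> W1_fun I p.
        f (ae_class (lebesgue_on I) (\<lambda>t. u t + v t)) =
        f (ae_class (lebesgue_on I) u) + f (ae_class (lebesgue_on I) v)) \<and>
     (\<forall>c. \<forall>u \<in> W1_fun I p.
        f (ae_class (lebesgue_on I) (\<lambda>t. c *\<^sub>R u t)) = c * f (ae_class (lebesgue_on I) u)) \<and>
     (\<exists>C. \<forall>u \<in> W1_fun I p. \<bar>f (ae_class (lebesgue_on I) u)\<bar> \<le> C * W1_norm I p u)}"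


section \<open>The T-topology\<close>

text \<open>For bounded \<open>I\<close> the inclusion of \<open>W1 I \<infinity>\<close> into \<open>W1 I p\<close> is an inclusion of sets of
  classes, so composing a functional with it is restriction.\<close>

definition T_seminorms ::
    "real set \<Rightarrow> nat \<Rightarrow> ((real \<Rightarrow> 'e::{banach, second_countable_topology}) set \<Rightarrow> real) set" where
  "T_seminorms I n = {\<rho>. \<exists>f \<in> W1_dual I (of_nat n). \<rho> = (\<lambda>U \<in> W1 I \<infinity>. \<bar>f U\<bar>)}"

text \<open>The locally convex topology on \<open>W1 I \<infinity>\<close> generated by a family \<open>P\<close> of seminorms has the open
  \<open>\<rho>\<close>-balls, for \<open>\<rho>\<close> in \<open>P\<close>, as a subbasis.\<close>

definition W1_seminorm_topology ::
    "real set \<Rightarrow> ((real \<Rightarrow> 'e::{banach, second_countable_topology}) set \<Rightarrow> real) set \<Rightarrow>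
      (real \<Rightarrow> 'e) set topology" where
  "W1_seminorm_topology I P = topology_generated_by
     {ae_class (lebesgue_on I) `
        {v \<in> W1_fun I \<infinity>. \<rho> (ae_class (lebesgue_on I) (\<lambda>t. v t - u t)) < \<epsilon>}
      | \<rho> u \<epsilon>. \<rho> \<in> P \<and> u \<in> W1_fun I \<infinity> \<and> \<epsilon> > 0}"

definition T_topology ::
    "real set \<Rightarrow> (real \<Rightarrow> 'e::{banach, second_countable_topology}) set topology" where
  "T_topology I = W1_seminorm_topology I (\<Union>n\<in>{2..}. T_seminorms I n)"

end

theory Submission
  imports Defs
begin

text \<open>
  A function in \<open>W1 I \<infinity>\<close> is \<open>x + \<integral>\<^sub>a\<^sup>t w\<close> with \<open>x \<in> E\<close> and \<open>w\<close> bounded. A functional in the dual of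
  \<open>W1 I n\<close> therefore splits into a functional \<open>\<xi>\<close> of \<open>x\<close> and a functional \<open>F w = f (\<integral> w)\<close> that is
  continuous for bounded almost everywhere convergence. Since \<open>E\<close> and its dual are separable,
  Radon--Nikodym applied to the scalar set functions \<open>A \<mapsto> F (1\<^sub>A x)\<close> yields \<open>F w = \<integral> h(t)(w(t)) dt\<close> with
  \<open>h\<close> integrable and dual valued. On a ball, \<open>f\<close> is thus a uniform limit of finite combinations of the
  numbers \<open>\<xi> x\<close> and \<open>\<integral>\<^sub>A \<xi>(w)\<close>. The families of numbers that arise from the ball form a closed subset of
  a product of compact intervals: by reflexivity and Radon--Nikodym again, every family satisfying
  the evident linear relations and bounds comes from some \<open>(x, w)\<close>. The ball is the continuous image
  of this compact set.
\<close>

section \<open>The Hahn--Banach theorem and separable duals\<close>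

text \<open>The seminorms come from duals with a finite exponent, while the ball is measured with
  exponent \<infinity>. The proof lives on this gap: along uniformly bounded sequences, almost
  everywhere convergence makes every norm with finite exponent converge, by dominated convergence.
  This forces the set functions built from F to be countably additive; a functional continuous only
  for the sup norm could be a purely finitely additive measure. The density h is merely integrable,
  which is enough to pair it with the bounded functions w of the ball. The norm is a sum of two
  suprema. Rather than a joint condition on pairs of coordinates, the two bounds are made
  coordinates themselves: each controls its own family of numbers, and they are linked only by
  \<open>\<rho> + \<sigma> \<le> R\<close>. Different data may then name the same class, which is
  harmless for a continuous image. All measurable sets A serve as coordinates, not only intervals,
  so that a point of the product contains a set function to which Radon--Nikodym applies.
  Reflexivity acts twice: it makes the dual separable, and it turns bounded functionals on the dual
  back into vectors of E.\<close>

definition sublinear_functional :: "('a::real_vector \<Rightarrow> real) \<Rightarrow> bool" where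
  "sublinear_functional q \<longleftrightarrow>
     (\<forall>x y. q (x + y) \<le> q x + q y) \<and> (\<forall>c x. 0 \<le> c \<longrightarrow> q (c *\<^sub>R x) = c * q x)"

text \<open>One inequality for positive scalars suffices: applied with \<open>1 / c\<close> at the
  point \<open>c *\<^sub>R x\<close> it yields the reverse one.\<close>

lemma sublinear_functionalI:
  assumes "\<And>x y. q (x + y) \<le> q x + q y" and "q 0 = 0"
    and "\<And>c x. 0 < c \<Longrightarrow> q (c *\<^sub>R x) \<le> c * q x"
  shows "sublinear_functional q"
proof -
  have "q (c *\<^sub>R x) = c * q x" if "0 < c" for c x
  proof (rule antisym)
    have "q ((1 / c) *\<^sub>R (c *\<^sub>R x)) \<le> (1 / c) * q (c *\<^sub>R x)"
      using that by (intro assms(3)) auto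
    then show "c * q x \<le> q (c *\<^sub>R x)" using that by (simp add: field_simps)
  qed (rule assms(3)[OF that])
  then have "q (c *\<^sub>R x) = c * q x" if "0 \<le> c" for c x
    using that assms(2) by (cases "c = 0") auto
  then show ?thesis using assms(1) by (auto simp: sublinear_functional_def)
qed

lemma sublinear_functional_zero: "sublinear_functional q \<Longrightarrow> q 0 = 0"
  unfolding sublinear_functional_def by (metis mult_zero_left order_refl scaleR_zero_left)

lemma sublinear_functional_minus: "sublinear_functional q \<Longrightarrow> - q (- x) \<le> q x"
proof -
  assume q: "sublinear_functional q"
  then have "q (x + - x) \<le> q x + q (- x)" unfolding sublinear_functional_def by blast
  then show ?thesis using sublinear_functional_zero[OF q] by simp
qed

text \<open>The functional \<open>q'\<close> is the infimum over t \<ge> 0 of q(x + t z) - t q(z).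
  The value t = 0 gives the first bound and t = 1 the second. At x = - z the second bound reads q'(-
  z) \<le> - q(z), so every linear functional below \<open>q'\<close> is at least q(z) at z.\<close>

lemma sublinear_functional_shrink:
  fixes q :: "'a::real_vector \<Rightarrow> real"
  assumes q: "sublinear_functional q"
  obtains q' where "sublinear_functional q'" "\<And>x. q' x \<le> q x" "\<And>x. q' x \<le> q (x + z) - q z"
proof -
  define h where "h x t = q (x + t *\<^sub>R z) - t * q z" for x and t :: real
  define q' where "q' x = (INF t\<in>{0..}. h x t)" for x
  have sub: "q (x + y) \<le> q x + q y" for x y
    using q by (auto simp: sublinear_functional_def)
  have hom: "0 \<le> c \<Longrightarrow> q (c *\<^sub>R x) = c * q x" for c x
    using q by (auto simp: sublinear_functional_def)
  \<comment> \<open>This keeps the infimum finite: t q(z) = q(t z) \<le> q(x + t z) + q(-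
    x).\<close>
  have bound: "- q (- x) \<le> h x t" if "0 \<le> t" for x t
    using sub[of "x + t *\<^sub>R z" "- x"] hom[OF that, of z] by (auto simp: h_def)
  have bdd: "bdd_below (h x ` {0..})" for x
    using bound by (auto intro!: bdd_belowI2)
  have q'_le: "q' x \<le> h x t" if "0 \<le> t" for x t
    unfolding q'_def using that bdd by (intro cINF_lower) auto
  have q'_ge: "c \<le> q' x" if "\<And>t. 0 \<le> t \<Longrightarrow> c \<le> h x t" for c x
    unfolding q'_def using that by (intro cINF_greatest) auto
  have "sublinear_functional q'"
  proof (rule sublinear_functionalI)
    fix x y
    have "q' (x + y) \<le> h x s + h y t" if "0 \<le> s" "0 \<le> t" for s t
    proof -
      have "q' (x + y) \<le> h (x + y) (s + t)" using that by (intro q'_le) auto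
      also have "\<dots> \<le> h x s + h y t"
        using sub[of "x + s *\<^sub>R z" "y + t *\<^sub>R z"] by (simp add: h_def algebra_simps)
      finally show ?thesis .
    qed
    then have "q' (x + y) - h x s \<le> q' y" if "0 \<le> s" for s
      using that by (intro q'_ge) (simp add: algebra_simps)
    then have "q' (x + y) - q' y \<le> q' x" by (intro q'_ge) (simp add: algebra_simps)
    then show "q' (x + y) \<le> q' x + q' y" by simp
  next
    have "q' 0 \<le> h 0 0" by (rule q'_le) simp
    moreover have "0 \<le> q' 0"
      by (rule q'_ge) (simp add: h_def hom)
    ultimately show "q' 0 = 0" by (simp add: h_def sublinear_functional_zero[OF q])
  next
    fix c :: real and x assume c: "0 < c"
    have "q' (c *\<^sub>R x) / c \<le> q' x"
    proof (rule q'_ge)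
      fix t :: real assume t: "0 \<le> t"
      have "q' (c *\<^sub>R x) \<le> h (c *\<^sub>R x) (c * t)" using t c by (intro q'_le) auto
      also have "\<dots> = c * h x t"
        using hom[of c "x + t *\<^sub>R z"] c by (simp add: h_def algebra_simps)
      finally show "q' (c *\<^sub>R x) / c \<le> h x t" using c by (simp add: field_simps)
    qed
    then show "q' (c *\<^sub>R x) \<le> c * q' x" using c by (simp add: field_simps)
  qed
  moreover have "q' x \<le> q x" for x using q'_le[of 0 x] by (simp add: h_def)
  moreover have "q' x \<le> q (x + z) - q z" for x using q'_le[of 1 x] by (simp add: h_def)
  ultimately show ?thesis using that by blast
qed

text \<open>The lower bound is the pointwise infimum, finite because c(x) \<ge> - c(- x) \<ge> - p(-
  x) for all members. Subadditivity is where the chain matters: for two members, the smaller one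
  estimates both summands.\<close>

lemma sublinear_functional_chain:
  assumes "C \<noteq> {}" and "\<And>c. c \<in> C \<Longrightarrow> sublinear_functional c"
    and p: "\<And>c. c \<in> C \<Longrightarrow> c \<le> p" and chain: "\<And>c d. c \<in> C \<Longrightarrow> d \<in> C \<Longrightarrow> c \<le> d \<or> d \<le> c"
  obtains q where "sublinear_functional q" "\<And>c. c \<in> C \<Longrightarrow> q \<le> c"
proof -
  define q where "q x = (INF c\<in>C. c x)" for x
  have sub: "c (x + y) \<le> c x + c y" if "c \<in> C" for c x y
    using assms(2)[OF that] by (auto simp: sublinear_functional_def)
  have hom: "0 \<le> t \<Longrightarrow> c (t *\<^sub>R x) = t * c x" if "c \<in> C" for c t x
    using assms(2)[OF that] by (auto simp: sublinear_functional_def)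
  have "- p (- x) \<le> c x" if "c \<in> C" for c x
    using sublinear_functional_minus[OF assms(2)[OF that], of x] p[OF that, THEN le_funD, of "- x"] by simp
  then have bdd: "bdd_below ((\<lambda>c. c x) ` C)" for x by (intro bdd_belowI2)
  have q_le: "q x \<le> c x" if "c \<in> C" for c x
    unfolding q_def using that bdd by (intro cINF_lower) auto
  have q_ge: "u \<le> q x" if "\<And>c. c \<in> C \<Longrightarrow> u \<le> c x" for u x
    unfolding q_def using that assms(1) by (intro cINF_greatest) auto
  have "sublinear_functional q"
  proof (rule sublinear_functionalI)
    fix x y
    have le: "q (x + y) \<le> c x + d y" if "c \<in> C" "d \<in> C" for c d
    proof (cases "c \<le> d")
      case True
      then show ?thesis using q_le[OF that(1), of "x + y"] sub[OF that(1), of x y] le_funD[OF True, of y] by linarith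
    next
      case False
      then have "d \<le> c" using chain[OF that] by blast
      then show ?thesis using q_le[OF that(2), of "x + y"] sub[OF that(2), of x y] le_funD[of d c x] by linarith
    qed
    have "q (x + y) - c x \<le> q y" if "c \<in> C" for c
      by (rule q_ge) (use le[OF that] in \<open>simp add: algebra_simps\<close>)
    then have "q (x + y) - q y \<le> q x" by (intro q_ge) (simp add: algebra_simps)
    then show "q (x + y) \<le> q x + q y" by simp
  next
    obtain c where c: "c \<in> C" using assms(1) by auto
    then have "q 0 \<le> 0" using q_le[OF c, of 0] sublinear_functional_zero[OF assms(2)[OF c]] by simp
    moreover have "0 \<le> q 0" by (rule q_ge) (simp add: sublinear_functional_zero[OF assms(2)])
    ultimately show "q 0 = 0" by simp
  next
    fix t :: real and x assume t: "0 < t"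
    have "q (t *\<^sub>R x) / t \<le> q x"
    proof (rule q_ge)
      fix c assume c: "c \<in> C"
      show "q (t *\<^sub>R x) / t \<le> c x" using q_le[OF c, of "t *\<^sub>R x"] hom[OF c, of t x] t by (simp add: field_simps)
    qed
    then show "q (t *\<^sub>R x) \<le> t * q x" using t by (simp add: field_simps)
  qed
  then show ?thesis using that q_le by (simp add: le_fun_def)
qed

text \<open>A minimal sublinear functional is linear: shrinking it in the direction of any \<open>z\<close> changes
  nothing, which turns subadditivity into additivity.\<close>

lemma Hahn_Banach_sublinear:
  fixes p :: "'a::real_vector \<Rightarrow> real"
  assumes p: "sublinear_functional p"
  obtains f where "linear f" "\<And>x. f x \<le> p x"
proof -
  define A where "A = {q. sublinear_functional q \<and> q \<le> p}"
  have "\<exists>m\<in>A. \<forall>a\<in>A. m \<ge> a \<longrightarrow> a = m"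
  \<comment> \<open>The order is reversed, so that the maximal element delivered by Zorn's lemma is
    a minimal functional.\<close>
  proof (rule predicate_Zorn)
    show "partial_order_on A (relation_of (\<lambda>x y. y \<le> x) A)"
      by (auto simp: partial_order_on_def preorder_on_def refl_on_def trans_def antisym_def relation_of_def)
  next
    fix C assume "C \<in> Chains (relation_of (\<lambda>x y. y \<le> x) A)"
    then have C: "C \<subseteq> A" and chain: "\<And>c d. c \<in> C \<Longrightarrow> d \<in> C \<Longrightarrow> c \<le> d \<or> d \<le> c"
      by (auto simp: Chains_def relation_of_def)
    show "\<exists>u\<in>A. \<forall>a\<in>C. u \<le> a"
    proof (cases "C = {}")
      case True
      then show ?thesis using p by (auto simp: A_def intro: exI[of _ p])
    next
      case False
      obtain q where q: "sublinear_functional q" "\<And>c. c \<in> C \<Longrightarrow> q \<le> c"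
        by (rule sublinear_functional_chain[OF False, of p]) (use C chain in \<open>auto simp: A_def\<close>)
      obtain c where "c \<in> C" using False by auto
      then have "q \<le> p" using q(2) C by (force simp: A_def)
      then show ?thesis using q by (auto simp: A_def)
    qed
  qed
  then obtain f where f: "sublinear_functional f" "f \<le> p"
    and min: "\<And>q. sublinear_functional q \<Longrightarrow> q \<le> p \<Longrightarrow> q \<le> f \<Longrightarrow> q = f"
    by (auto simp: A_def)
  have add: "f (x + z) = f x + f z" for x z
  proof -
    obtain q where q: "sublinear_functional q" "\<And>x. q x \<le> f x" "\<And>x. q x \<le> f (x + z) - f z"
      using sublinear_functional_shrink[OF f(1), where z = z] by blast
    have "q \<le> f" using q(2) by (simp add: le_fun_def)
    then have "q = f" using min[OF q(1)] f(2) by simp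
    then have "f x + f z \<le> f (x + z)" using q(3)[of x] by simp
    then show ?thesis using f(1) by (auto simp: sublinear_functional_def intro: antisym)
  qed
  have neg: "f (- x) = - f x" for x
    using add[of x "- x"] sublinear_functional_zero[OF f(1)] by simp
  have "f (c *\<^sub>R x) = c * f x" for c x
  proof (cases "0 \<le> c")
    case True
    then show ?thesis using f(1) by (simp add: sublinear_functional_def)
  next
    case False
    then have "f ((- c) *\<^sub>R x) = (- c) * f x" using f(1) by (simp add: sublinear_functional_def del: scaleR_minus_left)
    then show ?thesis using neg[of "c *\<^sub>R x"] by simp
  qed
  then have "linear f" by (intro linearI) (auto simp: add)
  then show ?thesis using that f(2) by (auto simp: le_fun_def)
qed

text \<open>Instead of extending a functional from the line through \<open>x0\<close>, p is first
  shrunk in the direction \<open>x0\<close>; any linear f below the result satisfies - f(x0) \<le> -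
  p(x0), hence equality.\<close>

lemma Hahn_Banach_seminorm:
  fixes p :: "'a::real_vector \<Rightarrow> real"
  assumes add: "\<And>x y. p (x + y) \<le> p x + p y" and scale: "\<And>c x. p (c *\<^sub>R x) = \<bar>c\<bar> * p x"
  obtains f where "linear f" "\<And>x. \<bar>f x\<bar> \<le> p x" "f x0 = p x0"
proof -
  have p: "sublinear_functional p" using assms by (auto simp: sublinear_functional_def)
  have p0: "p 0 = 0" using scale[of 0 0] by simp
  obtain q where q: "sublinear_functional q" "\<And>x. q x \<le> p x" "\<And>x. q x \<le> p (x + x0) - p x0"
    using sublinear_functional_shrink[OF p, where z = x0] by blast
  obtain f where f: "linear f" "\<And>x. f x \<le> q x" using Hahn_Banach_sublinear[OF q(1)] by blast
  have neg: "f (- x) = - f x" for x using f(1) by (rule linear_neg)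
  have fp: "f x \<le> p x" for x using f(2)[of x] q(2)[of x] by simp
  have "- f x \<le> p x" for x using fp[of "- x"] scale[of "- 1" x] by (simp add: neg)
  then have "\<bar>f x\<bar> \<le> p x" for x using fp[of x] by (simp add: abs_le_iff)
  moreover have "f x0 = p x0"
    using f(2)[of "- x0"] q(3)[of "- x0"] fp[of x0] by (simp add: neg p0)
  ultimately show ?thesis using that f(1) by blast
qed

section \<open>Norming and separating functionals\<close>

lemma norming_functional:
  fixes x :: "'a::real_normed_vector"
  obtains \<xi> :: "'a \<Rightarrow>\<^sub>L real" where "norm \<xi> \<le> 1" "blinfun_apply \<xi> x = norm x"
proof -
  obtain f where f: "linear f" "\<And>y. \<bar>f y\<bar> \<le> norm y" "f x = norm x"
    using Hahn_Banach_seminorm[of norm x] by (auto simp: norm_triangle_ineq)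
  have bl: "bounded_linear f"
    using f(1,2) by (intro bounded_linear_intro[where K = 1]) (auto simp: linear_iff)
  then have "norm (Blinfun f) \<le> 1"
    using f(2) by (intro norm_blinfun_bound) (auto simp: bounded_linear_Blinfun_apply)
  moreover have "blinfun_apply (Blinfun f) x = norm x" using bl f(3) by (simp add: bounded_linear_Blinfun_apply)
  ultimately show ?thesis using that by blast
qed

lemma norm_le_by_functionals:
  fixes x :: "'a::real_normed_vector"
  assumes "\<And>\<xi> :: 'a \<Rightarrow>\<^sub>L real. blinfun_apply \<xi> x \<le> r * norm \<xi>" and "0 \<le> r"
  shows "norm x \<le> r"
proof -
  obtain \<xi> :: "'a \<Rightarrow>\<^sub>L real" where "norm \<xi> \<le> 1" "blinfun_apply \<xi> x = norm x"
    using norming_functional by blast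
  then show ?thesis using assms(1)[of \<xi>] mult_left_mono[OF \<open>norm \<xi> \<le> 1\<close> assms(2)] by simp
qed

lemma functionals_separate_points:
  fixes x :: "'a::real_normed_vector"
  assumes "\<And>\<xi> :: 'a \<Rightarrow>\<^sub>L real. blinfun_apply \<xi> x = blinfun_apply \<xi> y"
  shows "x = y"
  using norm_le_by_functionals[of "x - y" 0] assms by (simp add: blinfun.diff_right)

text \<open>The distance to S is a seminorm bounded by the norm that vanishes on S and is positive
  at x; a functional dominated by it and attaining it at x inherits all three properties.\<close>

lemma functional_vanishing_on_subspace:
  fixes S :: "'a::real_normed_vector set"
  assumes S: "subspace S" and x: "x \<notin> closure S"
  obtains \<xi> :: "'a \<Rightarrow>\<^sub>L real" where "\<And>y. y \<in> S \<Longrightarrow> blinfun_apply \<xi> y = 0" "blinfun_apply \<xi> x \<noteq> 0"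
proof -
  let ?p = "\<lambda>x. infdist x S"
  have ne: "S \<noteq> {}" using subspace_0[OF S] by auto
  have lb: "?p a \<le> dist a s" if "s \<in> S" for a s using that by (rule infdist_le)
  have ge: "c \<le> ?p a" if "\<And>s. s \<in> S \<Longrightarrow> c \<le> dist a s" for a c
    using that ne by (simp add: infdist_def cINF_greatest)
  have "?p (a + b) \<le> ?p a + ?p b" for a b
  proof -
    have "?p (a + b) - dist a s \<le> dist b t" if "s \<in> S" "t \<in> S" for s t
      using lb[OF subspace_add[OF S that], of "a + b"] norm_triangle_ineq[of "a - s" "b - t"]
      by (simp add: dist_norm algebra_simps)
    then have "?p (a + b) - dist a s \<le> ?p b" if "s \<in> S" for s using that by (intro ge) auto
    then have "?p (a + b) - ?p b \<le> ?p a" by (intro ge) (simp add: algebra_simps)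
    then show ?thesis by simp
  qed
  moreover have "?p (c *\<^sub>R a) = \<bar>c\<bar> * ?p a" for c a
  proof -
    have le: "?p (c *\<^sub>R a) \<le> \<bar>c\<bar> * ?p a" if "c \<noteq> 0" for c a
    proof -
      have "?p (c *\<^sub>R a) / \<bar>c\<bar> \<le> ?p a"
      proof (rule ge)
        fix s assume "s \<in> S"
        then have "?p (c *\<^sub>R a) \<le> dist (c *\<^sub>R a) (c *\<^sub>R s)" by (intro lb subspace_scale[OF S])
        also have "\<dots> = \<bar>c\<bar> * dist a s" by (simp add: dist_norm flip: scaleR_diff_right)
        finally show "?p (c *\<^sub>R a) / \<bar>c\<bar> \<le> dist a s" using that by (simp add: field_simps)
      qed
      then show ?thesis using that by (simp add: field_simps)
    qed
    show ?thesis
    proof (cases "c = 0")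
      case True
      then show ?thesis using subspace_0[OF S] by simp
    next
      case False
      have "?p ((1 / c) *\<^sub>R (c *\<^sub>R a)) \<le> \<bar>1 / c\<bar> * ?p (c *\<^sub>R a)" by (rule le) (use False in simp)
      then show ?thesis using le[OF False, of a] False by (simp add: field_simps)
    qed
  qed
  ultimately obtain f where f: "linear f" "\<And>y. \<bar>f y\<bar> \<le> ?p y" "f x = ?p x"
    using Hahn_Banach_seminorm[where p = ?p and ?x0.0 = x] by blast
  have "?p y \<le> norm y" for y using lb[OF subspace_0[OF S], of y] by simp
  then have "\<bar>f y\<bar> \<le> norm y" for y using f(2)[of y] by (meson order_trans)
  then have bl: "bounded_linear f"
    using f(1) by (intro bounded_linear_intro[where K = 1]) (auto simp: linear_iff)
  have "f y = 0" if "y \<in> S" for y using f(2)[of y] that by simp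
  moreover have "f x \<noteq> 0" using x in_closure_iff_infdist_zero[OF ne, of x] f(3) by simp
  ultimately show ?thesis using that[of "Blinfun f"] bl by (simp add: bounded_linear_Blinfun_apply)
qed

section \<open>Reflexivity, separability and weak measurability\<close>

lemma bounded_linear_blinfun_eval: "bounded_linear (\<lambda>\<xi>. blinfun_apply \<xi> x)"
  by (rule bounded_bilinear.bounded_linear_left[OF bounded_bilinear_blinfun_apply])

lemma reflexive_spaceD:
  fixes F :: "('e::real_normed_vector \<Rightarrow>\<^sub>L real) \<Rightarrow>\<^sub>L real"
  assumes "reflexive_space TYPE('e)"
  obtains x where "\<And>\<xi>. blinfun_apply F \<xi> = blinfun_apply \<xi> x"
proof -
  obtain x where "F = bidual_embedding x" using assms by (auto simp: reflexive_space_def surj_def)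
  then show ?thesis
    using that[of x] bounded_linear_blinfun_eval[of x] by (simp add: bidual_embedding_def bounded_linear_Blinfun_apply)
qed

lemma countable_dense_seq:
  obtains d :: "nat \<Rightarrow> 'e::{metric_space, second_countable_topology}"
  where "\<And>x e. 0 < e \<Longrightarrow> \<exists>n. dist (d n) x < e"
proof -
  obtain D :: "'e set" where D: "countable D" "\<And>U. open U \<Longrightarrow> U \<noteq> {} \<Longrightarrow> \<exists>y\<in>D. y \<in> U"
    using countable_dense_exists by blast
  have "D \<noteq> {}" using D(2)[of UNIV] by auto
  have "\<exists>n. dist (from_nat_into D n) x < e" if "0 < e" for x e
  proof -
    obtain y where "y \<in> D" "y \<in> ball x e" using D(2)[of "ball x e"] \<open>0 < e\<close> by auto
    moreover then obtain n where "from_nat_into D n = y"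
      using from_nat_into_surj[OF D(1)] by blast
    ultimately show ?thesis by (auto simp: dist_commute)
  qed
  then show ?thesis using that by blast
qed

lemma countable_dense_rational_span:
  fixes \<xi> :: "nat \<Rightarrow> 'a::real_normed_vector"
  obtains D where "countable D" "span (range \<xi>) \<subseteq> closure D"
proof -
  \<comment> \<open>A rational list codes a combination: its length says how many of the
    \<open>\<xi> i\<close> occur, its entries are the coefficients.\<close>
  define D where "D = (\<lambda>qs. \<Sum>i<length qs. of_rat (qs ! i) *\<^sub>R \<xi> i) ` (UNIV :: rat list set)"
  have "countable D" by (simp add: D_def)
  moreover have "span (range \<xi>) \<subseteq> closure D"
  proof
    fix x assume "x \<in> span (range \<xi>)"
    then obtain S r where S: "finite S" "S \<subseteq> range \<xi>" "x = (\<Sum>a\<in>S. r a *\<^sub>R a)"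
      by (auto simp: span_explicit)
    \<comment> \<open>The sum runs over a set of vectors; pulling it back to a set of indices allows
      padding with zero coefficients up to a common length.\<close>
    obtain J where J: "finite J" "inj_on \<xi> J" "S = \<xi> ` J"
      using subset_image_inj[of S \<xi> UNIV] S(1,2) by (metis finite_imageD)
    obtain N where N: "J \<subseteq> {..<N}" using J(1) by (meson finite_nat_bounded)
    define c where "c i = (if i \<in> J then r (\<xi> i) else 0)" for i
    have "x = (\<Sum>i\<in>J. r (\<xi> i) *\<^sub>R \<xi> i)" using S(3) J by (simp add: sum.reindex)
    also have "\<dots> = (\<Sum>i\<in>J. c i *\<^sub>R \<xi> i)" by (simp add: c_def)
    also have "\<dots> = (\<Sum>i<N. c i *\<^sub>R \<xi> i)"
      by (rule sum.mono_neutral_left) (use N in \<open>auto simp: c_def\<close>)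
    finally have x: "x = (\<Sum>i<N. c i *\<^sub>R \<xi> i)" .
    have "\<exists>q :: nat \<Rightarrow> rat. (\<lambda>n. of_rat (q n)) \<longlonglongrightarrow> c i" for i
    proof -
      have "c i \<in> closure \<rat>" using Rats_closure_real by simp
      then obtain f where f: "\<And>n. f n \<in> \<rat>" "f \<longlonglongrightarrow> c i" unfolding closure_sequential by auto
      have "\<exists>q. f n = of_rat q" for n using f(1)[of n] by (auto elim: Rats_cases)
      then obtain q where "\<And>n. f n = of_rat (q n)" by metis
      then have "f = (\<lambda>n. of_rat (q n))" by auto
      then show ?thesis using f(2) by auto
    qed
    then obtain q :: "nat \<Rightarrow> nat \<Rightarrow> rat" where q: "\<And>i. (\<lambda>n. of_rat (q i n)) \<longlonglongrightarrow> c i" by metis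
    define y where "y n = (\<Sum>i<N. of_rat (q i n) *\<^sub>R \<xi> i)" for n
    have "y \<longlonglongrightarrow> x" unfolding y_def x by (intro tendsto_intros q)
    moreover have "y n \<in> D" for n
      unfolding D_def y_def by (rule image_eqI[where x = "map (\<lambda>i. q i n) [0..<N]"]) auto
    ultimately show "x \<in> closure D" unfolding closure_sequential by blast
  qed
  ultimately show ?thesis using that by blast
qed

text \<open>Take one norming functional for each point of a dense sequence. Functionals of norm at
  most 1 are 1-Lipschitz, so passing from a nearby \<open>d n\<close> to x costs e/2 in the
  functional and e/2 in the norm.\<close>

lemma norming_sequence:
  obtains d :: "nat \<Rightarrow> 'e::{real_normed_vector, second_countable_topology}"
    and \<xi> :: "nat \<Rightarrow> 'e \<Rightarrow>\<^sub>L real"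
  where "\<And>x e. 0 < e \<Longrightarrow> \<exists>n. dist (d n) x < e"
    and "\<And>n. norm (\<xi> n) \<le> 1"
    and "\<And>x e. 0 < e \<Longrightarrow> \<exists>n. norm x - e < blinfun_apply (\<xi> n) x"
proof -
  obtain d :: "nat \<Rightarrow> 'e" where d: "\<And>x e. 0 < e \<Longrightarrow> \<exists>n. dist (d n) x < e"
    using countable_dense_seq by blast
  have "\<exists>\<xi> :: 'e \<Rightarrow>\<^sub>L real. norm \<xi> \<le> 1 \<and> blinfun_apply \<xi> (d n) = norm (d n)" for n
    using norming_functional by metis
  then obtain \<xi> :: "nat \<Rightarrow> 'e \<Rightarrow>\<^sub>L real"
    where \<xi>: "\<And>n. norm (\<xi> n) \<le> 1" "\<And>n. blinfun_apply (\<xi> n) (d n) = norm (d n)" by metis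
  have "\<exists>n. norm x - e < blinfun_apply (\<xi> n) x" if "0 < e" for x e
  proof -
    obtain n where n: "dist (d n) x < e / 2" using d[of "e / 2" x] \<open>0 < e\<close> by auto
    have "\<bar>blinfun_apply (\<xi> n) (d n - x)\<bar> \<le> norm (\<xi> n) * norm (d n - x)"
      using norm_blinfun[of "\<xi> n" "d n - x"] by simp
    also have "\<dots> \<le> norm (d n - x)" using \<xi>(1)[of n] by (simp add: mult_left_le_one_le)
    finally have "norm (d n) - blinfun_apply (\<xi> n) x < e / 2"
      using n by (simp add: blinfun.diff_right \<xi>(2) dist_norm)
    moreover have "norm x - norm (d n) < e / 2"
      using n norm_triangle_ineq2[of x "d n"] by (simp add: dist_norm norm_minus_commute)
    ultimately show ?thesis by (intro exI[of _ n]) simp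
  qed
  then show ?thesis using that[of d \<xi>] d \<xi>(1) by blast
qed

text \<open>The span of a norming sequence is dense: otherwise some F on the dual vanishes on it
  without being zero. By reflexivity F is evaluation at some x, and vanishing at all norming
  functionals forces x = 0.\<close>

lemma reflexive_separable_dual:
  assumes "reflexive_space TYPE('e::{real_normed_vector, second_countable_topology})"
  obtains D :: "('e::{real_normed_vector, second_countable_topology} \<Rightarrow>\<^sub>L real) set"
  where "countable D" "closure D = UNIV"
proof -
  obtain \<xi> :: "nat \<Rightarrow> 'e \<Rightarrow>\<^sub>L real"
    where \<xi>: "\<And>x e. 0 < e \<Longrightarrow> \<exists>n. norm x - e < blinfun_apply (\<xi> n) x"
    using norming_sequence by metis
  have "\<eta> \<in> closure (span (range \<xi>))" for \<eta>
  proof (rule ccontr)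
    assume "\<eta> \<notin> closure (span (range \<xi>))"
    then obtain F :: "('e \<Rightarrow>\<^sub>L real) \<Rightarrow>\<^sub>L real"
      where F: "\<And>y. y \<in> span (range \<xi>) \<Longrightarrow> blinfun_apply F y = 0" "blinfun_apply F \<eta> \<noteq> 0"
      using functional_vanishing_on_subspace[OF subspace_span] by metis
    obtain x where x: "\<And>\<xi>. blinfun_apply F \<xi> = blinfun_apply \<xi> x" using reflexive_spaceD[OF assms, of F] by blast
    have "blinfun_apply (\<xi> n) x = 0" for n using F(1)[of "\<xi> n"] by (simp add: x span_base)
    then have "norm x - e < 0" if "0 < e" for e using \<xi>[OF that, of x] by auto
    from this[of "norm x"] have "x = 0" by (cases "x = 0") auto
    then show False using F(2) by (simp add: x)
  qed
  moreover obtain D where D: "countable D" "span (range \<xi>) \<subseteq> closure D"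
    by (rule countable_dense_rational_span)
  ultimately have "closure D = UNIV" using closure_minimal[OF D(2)] by auto
  then show ?thesis using that D(1) by blast
qed

text \<open>This is Pettis' measurability theorem in the separable case. A norming sequence writes
  every closed ball as a countable intersection of half-spaces, and every open set is a countable
  union of closed balls.\<close>

lemma weakly_measurable_imp_measurable:
  fixes w :: "'a \<Rightarrow> 'e::{real_normed_vector, second_countable_topology}"
  assumes "\<And>\<xi> :: 'e \<Rightarrow>\<^sub>L real. (\<lambda>t. blinfun_apply \<xi> (w t)) \<in> borel_measurable M"
  shows "w \<in> borel_measurable M"
proof (rule borel_measurableI)
  fix U :: "'e set" assume U: "open U"
  obtain d :: "nat \<Rightarrow> 'e" and \<xi> :: "nat \<Rightarrow> 'e \<Rightarrow>\<^sub>L real"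
    where d: "\<And>x e. 0 < e \<Longrightarrow> \<exists>n. dist (d n) x < e" and \<xi>1: "\<And>n. norm (\<xi> n) \<le> 1"
      and \<xi>: "\<And>x e. 0 < e \<Longrightarrow> \<exists>n. norm x - e < blinfun_apply (\<xi> n) x"
    using norming_sequence by blast
  have norm_le: "norm x \<le> r \<longleftrightarrow> (\<forall>n. blinfun_apply (\<xi> n) x \<le> r)" for x r
  proof
    assume "norm x \<le> r"
    moreover have "blinfun_apply (\<xi> n) x \<le> norm x" for n
      using norm_blinfun[of "\<xi> n" x] mult_right_mono[OF \<xi>1[of n] norm_ge_zero[of x]] by simp
    ultimately show "\<forall>n. blinfun_apply (\<xi> n) x \<le> r" by (meson order_trans)
  next
    assume *: "\<forall>n. blinfun_apply (\<xi> n) x \<le> r"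
    show "norm x \<le> r"
    proof (rule field_le_epsilon)
      fix e :: real assume "0 < e"
      then show "norm x \<le> r + e" using \<xi>[of e x] * by (force simp: algebra_simps intro: less_imp_le less_le_trans)
    qed
  qed
  have dist_le: "dist y x \<le> r \<longleftrightarrow> (\<forall>n. blinfun_apply (\<xi> n) y - blinfun_apply (\<xi> n) x \<le> r)" for x y r
    by (simp add: dist_norm norm_le blinfun.diff_right)
  have cball: "w -` cball x r \<inter> space M \<in> sets M" for x r
  proof -
    have "w -` cball x r \<inter> space M = {t \<in> space M. \<forall>n. blinfun_apply (\<xi> n) (w t) - blinfun_apply (\<xi> n) x \<le> r}"
      by (auto simp: dist_commute[of x] dist_le)
    also have "\<dots> \<in> sets M" using assms by measurable
    finally show ?thesis .
  qed
  define B where "B = {(n, k :: nat). cball (d n) (1 / Suc k) \<subseteq> U}"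
  have "\<exists>(n, k)\<in>B. x \<in> cball (d n) (1 / Suc k)" if "x \<in> U" for x
  proof -
    obtain e where e: "0 < e" "ball x e \<subseteq> U" using U \<open>x \<in> U\<close> openE by blast
    \<comment> \<open>The radius must be below e/2 because a point of the ball is reached from x
      through the centre, using the radius twice.\<close>
    obtain k where k: "1 / Suc k < e / 2" using e(1) nat_approx_posE[of "e / 2"] by auto
    obtain n where n: "dist (d n) x < 1 / Suc k" using d[of "1 / Suc k" x] by auto
    have "cball (d n) (1 / Suc k) \<subseteq> ball x e"
    proof
      fix y assume "y \<in> cball (d n) (1 / Suc k)"
      then show "y \<in> ball x e" using n k dist_triangle[of x y "d n"] by (simp add: dist_commute)
    qed
    then have "(n, k) \<in> B" using e(2) unfolding B_def by blast
    moreover have "x \<in> cball (d n) (1 / Suc k)" using n by simp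
    ultimately show ?thesis by blast
  qed
  then have "w -` U \<inter> space M = (\<Union>(n, k)\<in>B. w -` cball (d n) (1 / Suc k) \<inter> space M)"
    by (fastforce simp: B_def)
  also have "\<dots> \<in> sets M" using cball by (intro sets.countable_UN'') auto
  finally show "w -` U \<inter> space M \<in> sets M" .
qed

section \<open>Radon--Nikodym densities\<close>

text \<open>Continuity along sequences decreasing to the empty set upgrades additivity to countable
  additivity, so m is a finite measure absolutely continuous with respect to M. The assumption
  \<open>cont\<close> speaks of sequences that eventually leave each point, not of decreasing ones,
  because in the signed case it is applied to near-maximizing subsets, which need not be
  nested.\<close>

lemma (in finite_measure) Radon_Nikodym_nonneg_set_function:
  fixes m :: "'a set \<Rightarrow> real"
  assumes add: "\<And>A B. A \<in> sets M \<Longrightarrow> B \<in> sets M \<Longrightarrow> A \<inter> B = {} \<Longrightarrow> m (A \<union> B) = m A + m B"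
    and null: "\<And>A. A \<in> null_sets M \<Longrightarrow> m A = 0"
    and cont: "\<And>A. range A \<subseteq> sets M \<Longrightarrow> (\<And>t. eventually (\<lambda>n. t \<notin> A n) sequentially) \<Longrightarrow>
      (\<lambda>n. m (A n)) \<longlonglongrightarrow> 0"
    and nonneg: "\<And>A. A \<in> sets M \<Longrightarrow> 0 \<le> m A"
  obtains g where "integrable M g" "\<And>A. A \<in> sets M \<Longrightarrow> (LINT t:A|M. g t) = m A"
proof -
  define N where "N = measure_of (space M) (sets M) (\<lambda>A. ennreal (m A))"
  have sets_N: "sets N = sets M" and space_N: "space N = space M"
    by (simp_all add: N_def)
  have "positive (sets M) (\<lambda>A. ennreal (m A))"
    using null[of "{}"] by (simp add: positive_def)
  moreover have "countably_additive (sets M) (\<lambda>A. ennreal (m A))"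
  proof (rule sets.empty_continuous_imp_countably_additive)
    show "positive (sets M) (\<lambda>A. ennreal (m A))" by fact
    show "additive (sets M) (\<lambda>A. ennreal (m A))"
      using add nonneg by (simp add: additive_def ennreal_plus)
    show "\<forall>A\<in>sets M. ennreal (m A) \<noteq> \<infinity>" by simp
    fix A :: "nat \<Rightarrow> 'a set" assume A: "range A \<subseteq> sets M" "decseq A" "(\<Inter>i. A i) = {}"
    have "eventually (\<lambda>n. t \<notin> A n) sequentially" for t
    proof -
      obtain k where "t \<notin> A k" using A(3) by auto
      then show ?thesis using A(2) unfolding eventually_sequentially decseq_def by blast
    qed
    from tendsto_ennrealI[OF cont[OF A(1) this]] show "(\<lambda>i. ennreal (m (A i))) \<longlonglongrightarrow> 0"
      by simp
  qed
  ultimately have em: "emeasure N A = ennreal (m A)" if "A \<in> sets M" for A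
    using that sets.space_closed by (intro emeasure_measure_of[OF N_def]) (auto simp: sets_N)
  have fin: "finite_measure N" by (rule finite_measureI) (simp add: em space_N)
  have ac: "absolutely_continuous M N"
    unfolding absolutely_continuous_def
  proof
    fix A assume A: "A \<in> null_sets M"
    then have "A \<in> sets M" by auto
    then show "A \<in> null_sets N" using null[OF A] em[of A] by (simp add: null_sets_def sets_N)
  qed
  obtain D where D[measurable]: "D \<in> borel_measurable M"
    and RN: "AE x in M. RN_deriv M N x = ennreal (D x)" and D0: "\<And>x. 0 \<le> D x"
    using real_RN_deriv[OF fin ac sets_N] by metis
  have *: "(\<integral>\<^sup>+t. ennreal (indicator A t * D t) \<partial>M) = ennreal (m A)" if A: "A \<in> sets M" for A
  proof -
    have "ennreal (m A) = emeasure (density M (RN_deriv M N)) A"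
      using density_RN_deriv[OF ac sets_N] em[OF A] by simp
    also have "\<dots> = (\<integral>\<^sup>+t. RN_deriv M N t * indicator A t \<partial>M)" using A by (simp add: emeasure_density)
    also have "\<dots> = (\<integral>\<^sup>+t. ennreal (indicator A t * D t) \<partial>M)"
      using RN by (intro nn_integral_cong_AE) (auto simp: indicator_def elim: AE_mp)
    finally show ?thesis by simp
  qed
  have "(\<integral>\<^sup>+t. ennreal (D t) \<partial>M) = (\<integral>\<^sup>+t. ennreal (indicator (space M) t * D t) \<partial>M)"
    by (rule nn_integral_cong) simp
  then have "integrable M D" using *[OF sets.top] D0 by (intro integrableI_nonneg) auto
  moreover have "(LINT t:A|M. D t) = m A" if A: "A \<in> sets M" for A
    using *[OF A] A D0 nonneg[OF A] unfolding set_lebesgue_integral_def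
    by (subst integral_eq_nn_integral) (auto simp: enn2real_ennreal)
  ultimately show ?thesis using that by blast
qed

text \<open>Jordan decomposition \<open>m = m\<^sup>+ - m\<^sup>-\<close> with \<open>m\<^sup>+ A = sup {m B | B \<subseteq> A}\<close>.\<close>

lemma (in finite_measure) Radon_Nikodym_signed_set_function:
  fixes m :: "'a set \<Rightarrow> real"
  assumes add: "\<And>A B. A \<in> sets M \<Longrightarrow> B \<in> sets M \<Longrightarrow> A \<inter> B = {} \<Longrightarrow> m (A \<union> B) = m A + m B"
    and null: "\<And>A. A \<in> null_sets M \<Longrightarrow> m A = 0"
    and cont: "\<And>A. range A \<subseteq> sets M \<Longrightarrow> (\<And>t. eventually (\<lambda>n. t \<notin> A n) sequentially) \<Longrightarrow>
      (\<lambda>n. m (A n)) \<longlonglongrightarrow> 0"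
    and bound: "\<And>A. A \<in> sets M \<Longrightarrow> \<bar>m A\<bar> \<le> C"
  obtains g where "integrable M g" "\<And>A. A \<in> sets M \<Longrightarrow> (LINT t:A|M. g t) = m A"
proof -
  define P where "P A = (SUP B\<in>{B\<in>sets M. B \<subseteq> A}. m B)" for A
  have bdd: "bdd_above (m ` {B\<in>sets M. B \<subseteq> A})" for A
    using bound by (intro bdd_aboveI2[where M = C]) (auto simp: abs_le_iff)
  have P_ge: "m B \<le> P A" if "B \<in> sets M" "B \<subseteq> A" for A B
    unfolding P_def using that bdd by (intro cSUP_upper) auto
  have P_le: "P A \<le> c" if "\<And>B. B \<in> sets M \<Longrightarrow> B \<subseteq> A \<Longrightarrow> m B \<le> c" for A c
    unfolding P_def using that by (intro cSUP_least) auto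
  have P_approx: "\<exists>B\<in>sets M. B \<subseteq> A \<and> P A - e < m B" if "0 < e" for A e
    using that less_cSUP_iff[OF _ bdd, of A "P A - e"] by (auto simp: P_def[symmetric])
  have m0: "m {} = 0" using null by simp
  have P0: "0 \<le> P A" for A using P_ge[of "{}" A] m0 by simp
  have P_add: "P (A \<union> B) = P A + P B" if AB: "A \<in> sets M" "B \<in> sets M" "A \<inter> B = {}" for A B
  proof (rule antisym)
    show "P (A \<union> B) \<le> P A + P B"
    proof (rule P_le)
      fix S assume S: "S \<in> sets M" "S \<subseteq> A \<union> B"
      then have eq: "S = (S \<inter> A) \<union> (S \<inter> B)" by auto
      have "m ((S \<inter> A) \<union> (S \<inter> B)) = m (S \<inter> A) + m (S \<inter> B)" using S AB by (intro add) auto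
      with eq have "m S = m (S \<inter> A) + m (S \<inter> B)" by simp
      then show "m S \<le> P A + P B" using P_ge[of "S \<inter> A" A] P_ge[of "S \<inter> B" B] S AB by auto
    qed
    have le: "m S + m T \<le> P (A \<union> B)" if "S \<in> sets M" "S \<subseteq> A" "T \<in> sets M" "T \<subseteq> B" for S T
    proof -
      have "S \<inter> T = {}" using that AB(3) by auto
      then have "m (S \<union> T) = m S + m T" using that by (intro add) auto
      then show ?thesis using P_ge[of "S \<union> T" "A \<union> B"] that by auto
    qed
    have "P A \<le> P (A \<union> B) - m T" if "T \<in> sets M" "T \<subseteq> B" for T
      by (rule P_le) (use le that in \<open>simp add: algebra_simps\<close>)
    then have "m T \<le> P (A \<union> B) - P A" if "T \<in> sets M" "T \<subseteq> B" for T
      using that by (simp add: algebra_simps)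
    then have "P B \<le> P (A \<union> B) - P A" by (rule P_le)
    then show "P A + P B \<le> P (A \<union> B)" by simp
  qed
  have P_null: "P A = 0" if "A \<in> null_sets M" for A
  proof (rule antisym[OF _ P0], rule P_le)
    fix B assume "B \<in> sets M" "B \<subseteq> A"
    then have "B \<in> null_sets M" using that by (metis null_sets_subset)
    then show "m B \<le> 0" using null by simp
  qed
  have P_cont: "(\<lambda>n. P (A n)) \<longlonglongrightarrow> 0"
    if A: "range A \<subseteq> sets M" "\<And>t. eventually (\<lambda>n. t \<notin> A n) sequentially" for A :: "nat \<Rightarrow> 'a set"
  proof -
    \<comment> \<open>Near-maximizers in \<open>A n\<close> with vanishing slack; they also
      eventually leave each point, so \<open>cont\<close> applies to them.\<close>
    have "\<exists>B\<in>sets M. B \<subseteq> A n \<and> P (A n) - 1 / Suc n < m B" for n by (rule P_approx) simp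
    then obtain B where B: "\<And>n. B n \<in> sets M" "\<And>n. B n \<subseteq> A n" "\<And>n. P (A n) - 1 / Suc n < m (B n)"
      by metis
    have "(\<lambda>n. m (B n)) \<longlonglongrightarrow> 0"
    proof (rule cont)
      show "range B \<subseteq> sets M" using B(1) by auto
      show "eventually (\<lambda>n. t \<notin> B n) sequentially" for t
        using A(2)[of t] by eventually_elim (use B(2) in auto)
    qed
    then have "(\<lambda>n. m (B n) + 1 / Suc n) \<longlonglongrightarrow> 0 + 0"
      by (intro tendsto_add LIMSEQ_Suc[OF lim_1_over_n])
    then have lim: "(\<lambda>n. m (B n) + 1 / Suc n) \<longlonglongrightarrow> 0" by simp
    show ?thesis
    proof (rule tendsto_sandwich[OF _ _ tendsto_const lim])
      show "\<forall>\<^sub>F n in sequentially. 0 \<le> P (A n)" using P0 by simp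
      show "\<forall>\<^sub>F n in sequentially. P (A n) \<le> m (B n) + 1 / Suc n"
        using B(3) by (intro always_eventually allI) (simp add: algebra_simps less_imp_le)
    qed
  qed
  obtain g1 where g1: "integrable M g1" "\<And>A. A \<in> sets M \<Longrightarrow> (LINT t:A|M. g1 t) = P A"
    by (rule Radon_Nikodym_nonneg_set_function[of P, OF P_add P_null P_cont P0]) (assumption | blast)+
  \<comment> \<open>The negative part is \<open>P A - m A\<close>, nonnegative because A itself
    competes in the supremum.\<close>
  obtain g2 where g2: "integrable M g2" "\<And>A. A \<in> sets M \<Longrightarrow> (LINT t:A|M. g2 t) = P A - m A"
  proof (rule Radon_Nikodym_nonneg_set_function[of "\<lambda>A. P A - m A"])
    show "P (A \<union> B) - m (A \<union> B) = P A - m A + (P B - m B)"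
      if "A \<in> sets M" "B \<in> sets M" "A \<inter> B = {}" for A B using P_add[OF that] add[OF that] by simp
    show "P A - m A = 0" if "A \<in> null_sets M" for A using P_null[OF that] null[OF that] by simp
    show "0 \<le> P A - m A" if "A \<in> sets M" for A using P_ge[OF that] by simp
    show "(\<lambda>n. P (A n) - m (A n)) \<longlonglongrightarrow> 0"
      if "range A \<subseteq> sets M" "\<And>t. eventually (\<lambda>n. t \<notin> A n) sequentially" for A
      using tendsto_diff[OF P_cont[OF that] cont[OF that]] by simp
  qed blast
  have si: "set_integrable M A g1" "set_integrable M A g2" if "A \<in> sets M" for A
    using integrable_mult_indicator[OF that g1(1)] integrable_mult_indicator[OF that g2(1)]
    by (simp_all add: set_integrable_def)
  show ?thesis
  proof (rule that)
    show "integrable M (\<lambda>t. g1 t - g2 t)" using g1(1) g2(1) by simp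
    show "(LINT t:A|M. g1 t - g2 t) = m A" if "A \<in> sets M" for A
      using set_integral_diff(2)[OF si[OF that]] g1(2)[OF that] g2(2)[OF that] by simp
  qed
qed

section \<open>Dual-valued densities\<close>

text \<open>Since D need not be a subspace, x + q y may lie outside it. The single inequality in the
  assumption compares F x + q F y with F z for z in D instead, and encodes additivity, rational
  homogeneity and the Lipschitz bound at once. It survives passage to the limit, where z can be
  taken equal to x + q y.\<close>

lemma functional_extension_from_dense:
  fixes F :: "'y::real_normed_vector \<Rightarrow> real"
  assumes D: "closure D = UNIV"
    and F: "\<And>x y z q. x \<in> D \<Longrightarrow> y \<in> D \<Longrightarrow> z \<in> D \<Longrightarrow> q \<in> \<rat> \<Longrightarrow>
      \<bar>F x + q * F y - F z\<bar> \<le> norm (x + q *\<^sub>R y - z) * c"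
    and "0 \<le> c"
  obtains h :: "'y \<Rightarrow>\<^sub>L real"
  where "norm h \<le> c" "\<And>s y. (\<And>n. s n \<in> D) \<Longrightarrow> s \<longlonglongrightarrow> y \<Longrightarrow> (\<lambda>n. F (s n)) \<longlonglongrightarrow> blinfun_apply h y"
proof -
  have "\<exists>s. (\<forall>n. s n \<in> D) \<and> s \<longlonglongrightarrow> y" for y
    using D closure_sequential[of y D] by auto
  then obtain z where z: "\<And>y n. z y n \<in> D" "\<And>y. z y \<longlonglongrightarrow> y" by metis
  have lip: "\<bar>F x - F y\<bar> \<le> norm (x - y) * c" if "x \<in> D" "y \<in> D" for x y
    using F[OF that(1) that(1) that(2), of 0] by simp
  have conv: "convergent (\<lambda>n. F (z y n))" for y
  proof (rule real_Cauchy_convergent, rule CauchyI)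
    fix e :: real assume e: "0 < e"
    have "Cauchy (z y)" using z(2) LIMSEQ_imp_Cauchy by blast
    \<comment> \<open>The denominator is \<open>c + 1\<close> because c may be zero.\<close>
    then obtain N where N: "\<And>m n. m \<ge> N \<Longrightarrow> n \<ge> N \<Longrightarrow> norm (z y m - z y n) < e / (c + 1)"
      using CauchyD[of "z y" "e / (c + 1)"] e \<open>0 \<le> c\<close> by auto
    have "\<bar>F (z y m) - F (z y n)\<bar> < e" if "m \<ge> N" "n \<ge> N" for m n
    proof -
      have "\<bar>F (z y m) - F (z y n)\<bar> \<le> norm (z y m - z y n) * c" by (rule lip[OF z(1) z(1)])
      also have "\<dots> \<le> e / (c + 1) * c"
        using N[OF that] \<open>0 \<le> c\<close> by (intro mult_right_mono) auto
      also have "\<dots> < e" using e \<open>0 \<le> c\<close> by (simp add: field_simps)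
      finally show ?thesis .
    qed
    then show "\<exists>N. \<forall>m\<ge>N. \<forall>n\<ge>N. norm (F (z y m) - F (z y n)) < e" by auto
  qed
  define h where "h y = lim (\<lambda>n. F (z y n))" for y
  have h: "(\<lambda>n. F (z y n)) \<longlonglongrightarrow> h y" for y
    using conv by (simp add: h_def convergent_LIMSEQ_iff)
  \<comment> \<open>With w = x + r y the right side is zero, which is linearity; with r = 0 and w =
    0 it is the norm bound.\<close>
  have key: "\<bar>h x + r * h y - h w\<bar> \<le> norm (x + r *\<^sub>R y - w) * c" for x y w r
  proof -
    have "r \<in> closure \<rat>" using Rats_closure_real by simp
    then obtain q where q: "\<And>n. q n \<in> \<rat>" "q \<longlonglongrightarrow> r" unfolding closure_sequential by auto
    have "(\<lambda>n. \<bar>F (z x n) + q n * F (z y n) - F (z w n)\<bar>) \<longlonglongrightarrow> \<bar>h x + r * h y - h w\<bar>"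
      by (intro tendsto_intros h q)
    moreover have "(\<lambda>n. norm (z x n + q n *\<^sub>R z y n - z w n) * c) \<longlonglongrightarrow> norm (x + r *\<^sub>R y - w) * c"
      by (intro tendsto_intros z q)
    ultimately show ?thesis
      by (rule LIMSEQ_le) (use F z(1) q(1) in auto)
  qed
  have lin: "h (x + r *\<^sub>R y) = h x + r * h y" for x y r using key[of x r y "x + r *\<^sub>R y"] by simp
  have h0: "h 0 = 0" using lin[of 0 1 0] by simp
  have bound: "\<bar>h x\<bar> \<le> norm x * c" for x using key[of x 0 x 0] h0 by simp
  have "bounded_linear h"
  proof (rule bounded_linear_intro)
    show "h (x + y) = h x + h y" for x y using lin[of x 1 y] by simp
    show "h (r *\<^sub>R x) = r *\<^sub>R h x" for r x using lin[of 0 r x] h0 by simp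
    show "norm (h x) \<le> norm x * c" for x using bound by simp
  qed
  then have [simp]: "blinfun_apply (Blinfun h) = h" by (rule bounded_linear_Blinfun_apply)
  show ?thesis
  proof (rule that[of "Blinfun h"])
    show "norm (Blinfun h) \<le> c"
      using bound \<open>0 \<le> c\<close> by (intro norm_blinfun_bound) (auto simp: mult.commute)
    fix s y assume s: "\<And>n. s n \<in> D" "s \<longlonglongrightarrow> y"
    have "(\<lambda>n. norm (s n - z y n) * c) \<longlonglongrightarrow> norm (y - y) * c" by (intro tendsto_intros s z)
    then have "(\<lambda>n. norm (s n - z y n) * c) \<longlonglongrightarrow> 0" by simp
    then have "(\<lambda>n. F (s n) - F (z y n)) \<longlonglongrightarrow> 0"
      by (rule Lim_null_comparison[rotated]) (use lip[OF s(1) z(1)] in auto)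
    then have "(\<lambda>n. F (s n) - F (z y n) + F (z y n)) \<longlonglongrightarrow> 0 + h y" by (intro tendsto_add h)
    then show "(\<lambda>n. F (s n)) \<longlonglongrightarrow> blinfun_apply (Blinfun h) y" by simp
  qed
qed

text \<open>Scalar densities \<open>g y\<close> depending linearly on \<open>y\<close> up to null sets assemble to a density with
  values in the dual: only countably many null sets matter, since the space is separable.\<close>

lemma dual_valued_density:
  fixes g :: "'y::real_normed_vector \<Rightarrow> 'a \<Rightarrow> real" and D :: "'y set"
  assumes D: "countable D" "closure D = UNIV"
    and meas: "\<And>y. g y \<in> borel_measurable M"
    and lin: "\<And>x y c. AE t in M. g (x + c *\<^sub>R y) t = g x t + c * g y t"
    and bound: "\<And>y. AE t in M. \<bar>g y t\<bar> \<le> norm y * G t"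
    and G: "\<And>t. 0 \<le> G t"
  obtains h :: "'a \<Rightarrow> 'y \<Rightarrow>\<^sub>L real"
  where "\<And>t. norm (h t) \<le> G t" "\<And>y. (\<lambda>t. blinfun_apply (h t) y) \<in> borel_measurable M"
    "\<And>y. AE t in M. g y t = blinfun_apply (h t) y"
proof -
  have key: "AE t in M. \<bar>g x t + q * g y t - g z t\<bar> \<le> norm (x + q *\<^sub>R y - z) * G t" for x y z q
    using lin[of x q y] lin[of "x + q *\<^sub>R y" "- 1" z] bound[of "x + q *\<^sub>R y - z"]
    by eventually_elim simp
  \<comment> \<open>Only countably many instances are collected, so one null set N serves for all of
    them.\<close>
  have "AE t in M. \<forall>x\<in>D. \<forall>y\<in>D. \<forall>z\<in>D. \<forall>q\<in>\<rat>.
      \<bar>g x t + q * g y t - g z t\<bar> \<le> norm (x + q *\<^sub>R y - z) * G t"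
    by (intro AE_ball_countable' D countable_rat key)
  then obtain N where N: "N \<in> null_sets M" and good: "\<And>t. t \<in> space M - N \<Longrightarrow> \<forall>x\<in>D. \<forall>y\<in>D. \<forall>z\<in>D. \<forall>q\<in>\<rat>.
      \<bar>g x t + q * g y t - g z t\<bar> \<le> norm (x + q *\<^sub>R y - z) * G t"
    using AE_E3 by (smt (verit, best))
  define \<Omega> where "\<Omega> = space M - N"
  have [measurable]: "\<Omega> \<in> sets M" using N by (auto simp: \<Omega>_def)
  \<comment> \<open>The indicator lets h = 0 satisfy the same limit statement on the exceptional
    set. The limit then exists at every t, and measurability of h at each y follows without a
    further modification.\<close>
  have "\<exists>h :: 'y \<Rightarrow>\<^sub>L real. norm h \<le> G t \<and>
      (\<forall>s y. (\<forall>n. s n \<in> D) \<longrightarrow> s \<longlonglongrightarrow> y \<longrightarrow> (\<lambda>n. indicator \<Omega> t * g (s n) t) \<longlonglongrightarrow> blinfun_apply h y)" for t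
  proof (cases "t \<in> \<Omega>")
    case True
    obtain h :: "'y \<Rightarrow>\<^sub>L real" where "norm h \<le> G t"
      "\<And>s y. (\<And>n. s n \<in> D) \<Longrightarrow> s \<longlonglongrightarrow> y \<Longrightarrow> (\<lambda>n. g (s n) t) \<longlonglongrightarrow> blinfun_apply h y"
      by (rule functional_extension_from_dense[OF D(2), of "\<lambda>y. g y t" "G t"])
        (use True good G in \<open>auto simp: \<Omega>_def\<close>)
    then show ?thesis using True by auto
  next
    case False
    then show ?thesis using G by (intro exI[of _ 0]) auto
  qed
  then obtain h :: "'a \<Rightarrow> 'y \<Rightarrow>\<^sub>L real" where h: "\<And>t. norm (h t) \<le> G t"
    "\<And>t s y. (\<And>n. s n \<in> D) \<Longrightarrow> s \<longlonglongrightarrow> y \<Longrightarrow> (\<lambda>n. indicator \<Omega> t * g (s n) t) \<longlonglongrightarrow> blinfun_apply (h t) y"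
    by metis
  have "\<exists>s. (\<forall>n. s n \<in> D) \<and> s \<longlonglongrightarrow> y" for y
    using D closure_sequential[of y D] by auto
  then obtain z where z: "\<And>y n. z y n \<in> D" "\<And>y. z y \<longlonglongrightarrow> y" by metis
  show ?thesis
  proof (rule that[OF h(1)])
    fix y
    show "(\<lambda>t. blinfun_apply (h t) y) \<in> borel_measurable M"
      using meas by (intro borel_measurable_LIMSEQ_real[OF h(2)[OF z]]) auto
    \<comment> \<open>The point y is outside D in general; its own null set and those of the
      approximants \<open>z y n\<close> are again countably many.\<close>
    have "AE t in M. \<forall>n. \<bar>g y t - g (z y n) t\<bar> \<le> norm (y - z y n) * G t"
      using key[of y 0 y] by (simp add: AE_all_countable)
    moreover have "AE t in M. t \<in> \<Omega>" using AE_not_in[OF N] AE_space by eventually_elim (simp add: \<Omega>_def)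
    ultimately show "AE t in M. g y t = blinfun_apply (h t) y"
    proof eventually_elim
      case (elim t)
      have "(\<lambda>n. norm (y - z y n) * G t) \<longlonglongrightarrow> norm (y - y) * G t" by (intro tendsto_intros z)
      then have "(\<lambda>n. norm (y - z y n) * G t) \<longlonglongrightarrow> 0" by simp
      then have "(\<lambda>n. g y t - g (z y n) t) \<longlonglongrightarrow> 0"
        by (rule Lim_null_comparison[rotated]) (use elim in auto)
      then have "(\<lambda>n. g y t - (g y t - g (z y n) t)) \<longlonglongrightarrow> g y t - 0" by (intro tendsto_intros)
      then have "(\<lambda>n. g (z y n) t) \<longlonglongrightarrow> g y t" by simp
      moreover have "(\<lambda>n. g (z y n) t) \<longlonglongrightarrow> blinfun_apply (h t) y" using h(2)[OF z, of t] elim by simp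
      ultimately show ?case by (rule LIMSEQ_unique)
    qed
  qed
qed

section \<open>Functionals continuous under bounded almost everywhere convergence\<close>

text \<open>These are functions, not classes, and the bound holds everywhere on the space; sums,
  cut-offs by indicators and primitives can then be formed pointwise.\<close>

definition bounded_measurable ::
    "'a measure \<Rightarrow> ('a \<Rightarrow> 'e::real_normed_vector) set" where
  "bounded_measurable M = {w \<in> borel_measurable M. \<exists>C. \<forall>t\<in>space M. norm (w t) \<le> C}"

lemma bounded_measurableI:
  "w \<in> borel_measurable M \<Longrightarrow> (\<And>t. t \<in> space M \<Longrightarrow> norm (w t) \<le> C) \<Longrightarrow> w \<in> bounded_measurable M"
  by (auto simp: bounded_measurable_def)

lemma bounded_measurable_borel: "w \<in> bounded_measurable M \<Longrightarrow> w \<in> borel_measurable M"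
  by (simp add: bounded_measurable_def)

lemma bounded_measurable_add:
  fixes w v :: "'a \<Rightarrow> 'e::{real_normed_vector, second_countable_topology}"
  assumes "w \<in> bounded_measurable M" "v \<in> bounded_measurable M"
  shows "(\<lambda>t. w t + v t) \<in> bounded_measurable M"
proof -
  obtain C D where "\<forall>t\<in>space M. norm (w t) \<le> C" "\<forall>t\<in>space M. norm (v t) \<le> D"
    using assms by (auto simp: bounded_measurable_def)
  then have "\<forall>t\<in>space M. norm (w t + v t) \<le> C + D"
    by (meson add_mono norm_triangle_ineq order_trans)
  then show ?thesis using assms by (auto simp: bounded_measurable_def)
qed

lemma bounded_measurable_indicator_scaleR:
  fixes w :: "'a \<Rightarrow> 'e::{real_normed_vector, second_countable_topology}"
  assumes "w \<in> bounded_measurable M" "A \<in> sets M"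
  shows "(\<lambda>t. indicat_real A t *\<^sub>R w t) \<in> bounded_measurable M"
proof -
  obtain C where C: "\<forall>t\<in>space M. norm (w t) \<le> C" and [measurable]: "w \<in> borel_measurable M"
    using assms by (auto simp: bounded_measurable_def)
  have "norm (indicat_real A t *\<^sub>R w t) \<le> norm (w t)" for t by (simp add: indicator_def)
  then show ?thesis using C assms(2) by (intro bounded_measurableI[where C = C]) (auto intro: order_trans)
qed

lemma bounded_measurable_const: "(\<lambda>t. x) \<in> bounded_measurable M"
  by (rule bounded_measurableI[where C = "norm x"]) auto

lemma bounded_measurable_indicator:
  fixes x :: "'e::{real_normed_vector, second_countable_topology}"
  shows "A \<in> sets M \<Longrightarrow> (\<lambda>t. indicat_real A t *\<^sub>R x) \<in> bounded_measurable M"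
  by (rule bounded_measurable_indicator_scaleR[OF bounded_measurable_const])

text \<open>The condition \<open>F_cont\<close> carries the analytic content: it makes F independent
  of null sets, bounded on sup norm balls, and countably additive on indicators times a vector.
  Together these lead to an integrable density.\<close>

locale boundedly_continuous_functional = finite_measure M
  for M :: "'a measure" and F :: "('a \<Rightarrow> 'e::{banach, second_countable_topology}) \<Rightarrow> real" +
  assumes F_add: "\<And>w v. w \<in> bounded_measurable M \<Longrightarrow> v \<in> bounded_measurable M \<Longrightarrow>
      F (\<lambda>t. w t + v t) = F w + F v"
    and F_scale: "\<And>c w. w \<in> bounded_measurable M \<Longrightarrow> F (\<lambda>t. c *\<^sub>R w t) = c * F w"
    and F_cont: "\<And>w C. (\<And>n. w n \<in> borel_measurable M) \<Longrightarrow>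
      (\<And>n t. t \<in> space M \<Longrightarrow> norm (w n t) \<le> C) \<Longrightarrow> (AE t in M. (\<lambda>n. w n t) \<longlonglongrightarrow> 0) \<Longrightarrow>
      (\<lambda>n. F (w n)) \<longlonglongrightarrow> 0"
begin

lemma F_diff:
  assumes "w \<in> bounded_measurable M" "v \<in> bounded_measurable M"
  shows "F (\<lambda>t. w t - v t) = F w - F v"
proof -
  have v: "(\<lambda>t. (- 1) *\<^sub>R v t) \<in> bounded_measurable M"
    using assms(2) by (auto simp: bounded_measurable_def)
  show ?thesis using F_add[OF assms(1) v] F_scale[OF assms(2), of "- 1"] by simp
qed

lemma F_lim:
  assumes w: "\<And>n. w n \<in> borel_measurable M" "\<And>n t. t \<in> space M \<Longrightarrow> norm (w n t) \<le> C"
    and v: "v \<in> bounded_measurable M" and lim: "AE t in M. (\<lambda>n. w n t) \<longlonglongrightarrow> v t"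
  shows "(\<lambda>n. F (w n)) \<longlonglongrightarrow> F v"
proof -
  obtain K where K: "\<And>t. t \<in> space M \<Longrightarrow> norm (v t) \<le> K" and [measurable]: "v \<in> borel_measurable M"
    using v by (auto simp: bounded_measurable_def)
  have "(\<lambda>n. F (\<lambda>t. w n t - v t)) \<longlonglongrightarrow> 0"
  proof (rule F_cont)
    show "(\<lambda>t. w n t - v t) \<in> borel_measurable M" for n using w(1) by simp
    show "norm (w n t - v t) \<le> C + K" if "t \<in> space M" for n t
      using w(2)[OF that, of n] K[OF that] norm_triangle_ineq4[of "w n t" "v t"] by linarith
    show "AE t in M. (\<lambda>n. w n t - v t) \<longlonglongrightarrow> 0" using lim by eventually_elim (rule LIM_zero)
  qed
  moreover have "F (\<lambda>t. w n t - v t) = F (w n) - F v" for n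
    using w by (intro F_diff v bounded_measurableI) auto
  ultimately show ?thesis by (simp add: LIM_zero_cancel)
qed

text \<open>The constant sequence w converges almost everywhere to v, so F w is its own limit and
  equals F v.\<close>

lemma F_cong_AE:
  assumes "w \<in> bounded_measurable M" "v \<in> bounded_measurable M" "AE t in M. w t = v t"
  shows "F w = F v"
proof -
  obtain C where "\<And>t. t \<in> space M \<Longrightarrow> norm (w t) \<le> C" and "w \<in> borel_measurable M"
    using assms(1) by (auto simp: bounded_measurable_def)
  then have "(\<lambda>n::nat. F w) \<longlonglongrightarrow> F v"
    using assms(2,3) by (intro F_lim[where w = "\<lambda>n. w" and C = C]) auto
  then show ?thesis by (simp add: LIMSEQ_const_iff)
qed

text \<open>If F were unbounded on the ball of radius K, pick w n with |F (w n)| > n + 1. Scaled by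
  1/(n + 1) these functions tend to zero uniformly, while the values of F stay above 1 in
  modulus.\<close>

lemma F_bounded:
  obtains C where "\<And>w. w \<in> borel_measurable M \<Longrightarrow> (\<And>t. t \<in> space M \<Longrightarrow> norm (w t) \<le> K) \<Longrightarrow> \<bar>F w\<bar> \<le> C"
proof -
  have "\<exists>C. \<forall>w. w \<in> borel_measurable M \<longrightarrow> (\<forall>t\<in>space M. norm (w t) \<le> K) \<longrightarrow> \<bar>F w\<bar> \<le> C"
  proof (rule ccontr)
    assume "\<not> ?thesis"
    then have "\<exists>w. w \<in> borel_measurable M \<and> (\<forall>t\<in>space M. norm (w t) \<le> K) \<and> \<bar>F w\<bar> > Suc n" for n
      by (meson not_le)
    then obtain w where w: "\<And>n. w n \<in> borel_measurable M" "\<And>n t. t \<in> space M \<Longrightarrow> norm (w n t) \<le> K"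
      "\<And>n. \<bar>F (w n)\<bar> > Suc n" by metis
    define v where "v n t = (1 / Suc n) *\<^sub>R w n t" for n t
    have norm_v: "norm (v n t) \<le> K * (1 / Suc n)" if "t \<in> space M" for n t
      using w(2)[OF that, of n] by (simp add: v_def divide_right_mono)
    have "(\<lambda>n. F (v n)) \<longlonglongrightarrow> 0"
    proof (rule F_cont)
      show "v n \<in> borel_measurable M" for n using w(1) unfolding v_def by simp
      show "norm (v n t) \<le> K" if "t \<in> space M" for n t
      proof -
        have "0 \<le> K" using w(2)[OF that, of 0] norm_ge_zero order_trans by blast
        then have "K * (1 / Suc n) \<le> K" by (simp add: field_simps)
        then show ?thesis using norm_v[OF that, of n] by linarith
      qed
      have "(\<lambda>n. K * (1 / Suc n)) \<longlonglongrightarrow> K * 0" by (intro tendsto_mult tendsto_const LIMSEQ_Suc[OF lim_1_over_n])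
      then have lim: "(\<lambda>n. K * (1 / Suc n)) \<longlonglongrightarrow> 0" by simp
      have "(\<lambda>n. v n t) \<longlonglongrightarrow> 0" if "t \<in> space M" for t
        by (rule Lim_null_comparison[OF _ lim]) (use norm_v[OF that] in auto)
      then show "AE t in M. (\<lambda>n. v n t) \<longlonglongrightarrow> 0" by (rule AE_I2)
    qed
    then obtain n where "\<bar>F (v n)\<bar> < 1"
      using LIMSEQ_D[of "\<lambda>n. F (v n)" 0 1] by (metis diff_zero order_refl real_norm_def zero_less_one)
    moreover have "F (v n) = 1 / Suc n * F (w n)"
      unfolding v_def using w(1,2) by (intro F_scale bounded_measurableI) auto
    ultimately show False using w(3)[of n] by (simp add: abs_mult field_simps)
  qed
  then show ?thesis using that by blast
qed

text \<open>The choice is made separately for every x, so linearity and bounds in x hold only up to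
  null sets depending on the vectors; \<open>dual_valued_density\<close> later removes this
  dependence.\<close>

definition scalar_density :: "'e \<Rightarrow> 'a \<Rightarrow> real" where
  "scalar_density x = (SOME g. integrable M g \<and>
     (\<forall>A\<in>sets M. (LINT t:A|M. g t) = F (\<lambda>t. indicat_real A t *\<^sub>R x)))"

lemma scalar_density:
  shows integrable_scalar_density: "integrable M (scalar_density x)"
    and set_integral_scalar_density:
      "\<And>A. A \<in> sets M \<Longrightarrow> (LINT t:A|M. scalar_density x t) = F (\<lambda>t. indicat_real A t *\<^sub>R x)"
proof -
  let ?m = "\<lambda>A. F (\<lambda>t. indicat_real A t *\<^sub>R x)"
  have bm: "(\<lambda>t. indicat_real A t *\<^sub>R x) \<in> bounded_measurable M" if "A \<in> sets M" for A
    using that by (rule bounded_measurable_indicator)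
  have norm_le: "norm (indicat_real A t *\<^sub>R x) \<le> norm x" for A and t :: 'a by (simp add: indicator_def)
  obtain C where C: "\<And>w. w \<in> borel_measurable M \<Longrightarrow> (\<And>t. t \<in> space M \<Longrightarrow> norm (w t) \<le> norm x) \<Longrightarrow> \<bar>F w\<bar> \<le> C"
    using F_bounded by blast
  obtain g where "integrable M g" "\<And>A. A \<in> sets M \<Longrightarrow> (LINT t:A|M. g t) = ?m A"
  proof (rule Radon_Nikodym_signed_set_function[of ?m C])
    show "?m (A \<union> B) = ?m A + ?m B" if "A \<in> sets M" "B \<in> sets M" "A \<inter> B = {}" for A B
    proof -
      have "indicat_real (A \<union> B) t *\<^sub>R x = indicat_real A t *\<^sub>R x + indicat_real B t *\<^sub>R x" for t
        using that(3) by (auto simp: indicator_def)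
      then show ?thesis using F_add[OF bm[OF that(1)] bm[OF that(2)]] by simp
    qed
    show "?m A = 0" if "A \<in> null_sets M" for A
    proof -
      have "AE t in M. indicat_real A t *\<^sub>R x = 0 *\<^sub>R x"
        using AE_not_in[OF that] by eventually_elim simp
      then have "?m A = F (\<lambda>t. 0 *\<^sub>R x)" using that by (intro F_cong_AE bm bounded_measurable_const) auto
      then show ?thesis using F_scale[OF bounded_measurable_const, of 0 x] by simp
    qed
    show "(\<lambda>n. ?m (A n)) \<longlonglongrightarrow> 0"
      if A: "range A \<subseteq> sets M" "\<And>t. eventually (\<lambda>n. t \<notin> A n) sequentially" for A :: "nat \<Rightarrow> 'a set"
    proof (rule F_cont)
      show "(\<lambda>t. indicat_real (A n) t *\<^sub>R x) \<in> borel_measurable M" for n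
        using A(1) by (intro bounded_measurable_borel bm) auto
      show "norm (indicat_real (A n) t *\<^sub>R x) \<le> norm x" for n t by (rule norm_le)
      have "(\<lambda>n. indicat_real (A n) t *\<^sub>R x) \<longlonglongrightarrow> 0" for t
        by (rule tendsto_eventually) (use A(2)[of t] in eventually_elim, simp)
      then show "AE t in M. (\<lambda>n. indicat_real (A n) t *\<^sub>R x) \<longlonglongrightarrow> 0" by simp
    qed
    show "\<bar>?m A\<bar> \<le> C" if "A \<in> sets M" for A
      using norm_le by (intro C bounded_measurable_borel bm that)
  qed blast
  then have "\<exists>g. integrable M g \<and> (\<forall>A\<in>sets M. (LINT t:A|M. g t) = ?m A)" by blast
  from someI_ex[OF this] show "integrable M (scalar_density x)"
    "\<And>A. A \<in> sets M \<Longrightarrow> (LINT t:A|M. scalar_density x t) = ?m A"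
    by (simp_all add: scalar_density_def)
qed

lemma set_integrable_scalar_density: "A \<in> sets M \<Longrightarrow> set_integrable M A (scalar_density x)"
  using integrable_mult_indicator[OF _ integrable_scalar_density] by (simp add: set_integrable_def)

text \<open>Both sides have the same integral over every measurable set, by additivity of F on
  indicator functions, hence agree almost everywhere.\<close>

lemma scalar_density_linear:
  "AE t in M. scalar_density (x + c *\<^sub>R y) t = scalar_density x t + c * scalar_density y t"
proof (rule density_unique_real)
  show "integrable M (scalar_density (x + c *\<^sub>R y))" by (rule integrable_scalar_density)
  show "integrable M (\<lambda>t. scalar_density x t + c * scalar_density y t)"
    by (intro Bochner_Integration.integrable_add integrable_mult_right integrable_scalar_density)
  fix A assume A: "A \<in> sets M"
  have bm: "(\<lambda>t. indicat_real A t *\<^sub>R x) \<in> bounded_measurable M" for x :: 'e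
    using A by (rule bounded_measurable_indicator)
  have "(LINT t:A|M. scalar_density x t + c * scalar_density y t) =
      (LINT t:A|M. scalar_density x t) + c * (LINT t:A|M. scalar_density y t)"
    using set_integrable_scalar_density[OF A]
    by (subst set_integral_add(2)) auto
  also have "\<dots> = F (\<lambda>t. indicat_real A t *\<^sub>R x) + F (\<lambda>t. c *\<^sub>R (indicat_real A t *\<^sub>R y))"
    using set_integral_scalar_density[OF A] F_scale[OF bm] by simp
  also have "\<dots> = F (\<lambda>t. indicat_real A t *\<^sub>R x + indicat_real A t *\<^sub>R (c *\<^sub>R y))"
    using F_add[OF bm bm, of x "c *\<^sub>R y"] by (simp add: mult.commute)
  also have "\<dots> = F (\<lambda>t. indicat_real A t *\<^sub>R (x + c *\<^sub>R y))"
    by (simp only: scaleR_add_right)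
  finally show "(LINT t:A|M. scalar_density (x + c *\<^sub>R y) t) =
      (LINT t:A|M. scalar_density x t + c * scalar_density y t)"
    using set_integral_scalar_density[OF A] by simp
qed

lemma scalar_density_zero: "AE t in M. scalar_density 0 t = 0"
  using scalar_density_linear[of 0 1 0] by simp

lemma scalar_density_scale: "AE t in M. scalar_density (c *\<^sub>R x) t = c * scalar_density x t"
  using scalar_density_linear[of 0 c x] scalar_density_zero by eventually_elim simp

text \<open>Finite maxima of \<open>\<bar>scalar_density (e i)\<bar>\<close> are the pairing with a measurable selection from the
  unit vectors \<open>\<plusminus> e i\<close>, so their integrals are values of \<open>F\<close> on the unit ball.\<close>

fun max_density :: "(nat \<Rightarrow> 'e) \<Rightarrow> nat \<Rightarrow> 'a \<Rightarrow> real" where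
  "max_density e 0 t = 0"
| "max_density e (Suc n) t = max (max_density e n t) \<bar>scalar_density (e n) t\<bar>"

lemma max_density_nonneg: "0 \<le> max_density e n t" by (induction n) auto

lemma incseq_max_density: "incseq (\<lambda>n. max_density e n t)" by (rule incseq_SucI) simp

lemma max_density_ge: "i < n \<Longrightarrow> \<bar>scalar_density (e i) t\<bar> \<le> max_density e n t"
  by (induction n) (auto simp: less_Suc_eq)

lemma integrable_max_density: "integrable M (max_density e n)"
proof (induction n)
  case (Suc n)
  then show ?case using integrable_scalar_density by (simp add: fun_eq_iff)
qed simp

lemma max_density_selection:
  assumes e: "\<And>i. norm (e i) \<le> 1"
  shows "\<exists>w\<in>borel_measurable M. (\<forall>t. norm (w t) \<le> 1) \<and>
     (\<forall>A\<in>sets M. (LINT t:A|M. max_density e n t) = F (\<lambda>t. indicat_real A t *\<^sub>R w t))"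
proof (induction n)
  case 0
  have "F (\<lambda>t. 0) = 0" using F_scale[OF bounded_measurable_const, of 0 0] by simp
  then show ?case by (intro bexI[of _ "\<lambda>t. 0"]) (auto simp: set_lebesgue_integral_def)
next
  case (Suc n)
  then obtain w where [measurable]: "w \<in> borel_measurable M" and w1: "\<And>t. norm (w t) \<le> 1"
    and w: "\<And>A. A \<in> sets M \<Longrightarrow> (LINT t:A|M. max_density e n t) = F (\<lambda>t. indicat_real A t *\<^sub>R w t)"
    by blast
  let ?g = "scalar_density (e n)"
  have [measurable]: "?g \<in> borel_measurable M" "max_density e n \<in> borel_measurable M"
    using integrable_scalar_density integrable_max_density by auto
  \<comment> \<open>On P the new maximum is attained by \<open>e n\<close>, on Q by
    \<open>- e n\<close>; elsewhere, ties included, the old selection w still attains it. The two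
    sets are disjoint because the old maximum is nonnegative.\<close>
  define P where "P = {t \<in> space M. max_density e n t < ?g t}"
  define Q where "Q = {t \<in> space M. max_density e n t < - ?g t}"
  have [measurable]: "P \<in> sets M" "Q \<in> sets M" by (auto simp: P_def Q_def)
  have disj: "P \<inter> Q = {}"
  proof -
    have "False" if "t \<in> P" "t \<in> Q" for t
      using that max_density_nonneg[of e n t] by (auto simp: P_def Q_def)
    then show ?thesis by blast
  qed
  define v where "v t = (if t \<in> P then e n else if t \<in> Q then - e n else w t)" for t
  have [measurable]: "v \<in> borel_measurable M" unfolding v_def by measurable
  have "(LINT t:A|M. max_density e (Suc n) t) = F (\<lambda>t. indicat_real A t *\<^sub>R v t)" if A[measurable]: "A \<in> sets M" for A
  proof -
    let ?B = "A - P - Q"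
    have bm: "(\<lambda>t. indicat_real S t *\<^sub>R x) \<in> bounded_measurable M" if "S \<in> sets M" for S and x :: 'e
      using that by (rule bounded_measurable_indicator)
    have si: "integrable M (\<lambda>t. indicat_real S t * ?g t)" "integrable M (\<lambda>t. indicat_real S t * max_density e n t)"
      if "S \<in> sets M" for S
      using integrable_mult_indicator[OF that integrable_scalar_density] integrable_mult_indicator[OF that integrable_max_density]
      by simp_all
    have "(LINT t:A|M. max_density e (Suc n) t) =
        (LINT t|M. indicat_real (A \<inter> P) t * ?g t - indicat_real (A \<inter> Q) t * ?g t
           + indicat_real ?B t * max_density e n t)"
      unfolding set_lebesgue_integral_def
    proof (rule Bochner_Integration.integral_cong[OF refl])
      fix t assume "t \<in> space M"
      then show "indicat_real A t *\<^sub>R max_density e (Suc n) t = indicat_real (A \<inter> P) t * ?g t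
          - indicat_real (A \<inter> Q) t * ?g t + indicat_real ?B t * max_density e n t"
        using max_density_nonneg[of e n t] disj by (auto simp: indicator_def P_def Q_def max_def)
    qed
    also have "\<dots> = (LINT t:A\<inter>P|M. ?g t) - (LINT t:A\<inter>Q|M. ?g t) + (LINT t:?B|M. max_density e n t)"
      using si by (simp add: set_lebesgue_integral_def)
    also have "\<dots> = F (\<lambda>t. indicat_real (A \<inter> P) t *\<^sub>R e n) - F (\<lambda>t. indicat_real (A \<inter> Q) t *\<^sub>R e n)
        + F (\<lambda>t. indicat_real ?B t *\<^sub>R w t)"
      by (simp add: set_integral_scalar_density w)
    also have "\<dots> = F (\<lambda>t. (indicat_real (A \<inter> P) t *\<^sub>R e n - indicat_real (A \<inter> Q) t *\<^sub>R e n)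
        + indicat_real ?B t *\<^sub>R w t)"
    proof -
      have wbm: "w \<in> bounded_measurable M" using w1 by (intro bounded_measurableI) auto
      have *: "(\<lambda>t. indicat_real (A \<inter> P) t *\<^sub>R e n - indicat_real (A \<inter> Q) t *\<^sub>R e n) \<in> bounded_measurable M"
        using bounded_measurable_add[OF bm[of "A \<inter> P" "e n"] bm[of "A \<inter> Q" "- e n"]] by simp
      show ?thesis
        using F_diff[OF bm[of "A \<inter> P" "e n"] bm[of "A \<inter> Q" "e n"]]
          F_add[OF * bounded_measurable_indicator_scaleR[OF wbm, of ?B]] by simp
    qed
    also have "(\<lambda>t. (indicat_real (A \<inter> P) t *\<^sub>R e n - indicat_real (A \<inter> Q) t *\<^sub>R e n)
        + indicat_real ?B t *\<^sub>R w t) = (\<lambda>t. indicat_real A t *\<^sub>R v t)"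
      using disj by (auto simp: fun_eq_iff indicator_def v_def)
    finally show ?thesis .
  qed
  moreover have "norm (v t) \<le> 1" for t using e w1 by (simp add: v_def)
  ultimately show ?case by (intro bexI[of _ v]) auto
qed

text \<open>The density G is the supremum of the maxima over a normalized dense sequence. Each
  maximum has integral a value of F on the unit ball, so monotone convergence keeps the integral of
  the supremum below the bound C of \<open>F_bounded\<close>. This is the finite variation of the
  vector measure represented by F, obtained by a measurable choice of directions.\<close>

lemma dominating_density:
  obtains G where "integrable M G" "\<And>t. 0 \<le> G t"
    "\<And>x. AE t in M. \<bar>scalar_density x t\<bar> \<le> norm x * G t"
proof -
  obtain d :: "nat \<Rightarrow> 'e" where d: "\<And>x e. 0 < e \<Longrightarrow> \<exists>n. dist (d n) x < e"
    using countable_dense_seq by blast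
  define e where "e i = sgn (d i)" for i
  have e1: "norm (e i) \<le> 1" for i by (simp add: e_def norm_sgn)
  let ?m = "\<lambda>n t. max_density e n t"
  have [measurable]: "?m n \<in> borel_measurable M" for n using integrable_max_density by auto
  obtain C where C: "\<And>w. w \<in> borel_measurable M \<Longrightarrow> (\<And>t. t \<in> space M \<Longrightarrow> norm (w t) \<le> 1) \<Longrightarrow> \<bar>F w\<bar> \<le> C"
    using F_bounded by blast
  have int_le: "(\<integral>\<^sup>+t. ennreal (?m n t) \<partial>M) \<le> ennreal C" for n
  proof -
    obtain w where w: "w \<in> borel_measurable M" "\<And>t. norm (w t) \<le> 1"
      "\<And>A. A \<in> sets M \<Longrightarrow> (LINT t:A|M. ?m n t) = F (\<lambda>t. indicat_real A t *\<^sub>R w t)"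
      using max_density_selection[where e = e and n = n, OF e1] by (elim bexE conjE) (rule that, assumption, blast+)
    have "(LINT t|M. ?m n t) = (LINT t:space M|M. ?m n t)"
      by (simp add: set_integral_space integrable_max_density)
    also have "\<dots> \<le> C"
    proof -
      have "norm (indicat_real (space M) t *\<^sub>R w t) \<le> 1" for t using w(2)[of t] by (simp add: indicator_def)
      moreover have "(\<lambda>t. indicat_real (space M) t *\<^sub>R w t) \<in> borel_measurable M" using w(1) by simp
      ultimately have "\<bar>F (\<lambda>t. indicat_real (space M) t *\<^sub>R w t)\<bar> \<le> C"
        by (rule C[rotated])
      then show ?thesis using w(3)[of "space M"] by (simp add: abs_le_iff)
    qed
    finally show ?thesis
      using nn_integral_eq_integral[OF integrable_max_density, of e n] max_density_nonneg
      by (simp add: ennreal_leI)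
  qed
  \<comment> \<open>The supremum is formed in the extended reals; it is finite almost everywhere
    because its integral is, and only then is it converted to the real function G.\<close>
  define S where "S t = (SUP n. ennreal (?m n t))" for t
  have [measurable]: "S \<in> borel_measurable M" unfolding S_def by measurable
  have "(\<integral>\<^sup>+t. S t \<partial>M) = (SUP n. \<integral>\<^sup>+t. ennreal (?m n t) \<partial>M)"
    unfolding S_def
  proof (rule nn_integral_monotone_convergence_SUP)
    show "incseq (\<lambda>n t. ennreal (?m n t))"
      using incseq_max_density by (auto simp: incseq_def le_fun_def intro!: ennreal_leI)
  qed simp
  also have "\<dots> \<le> ennreal C" using int_le by (rule SUP_least)
  finally have S_le: "(\<integral>\<^sup>+t. S t \<partial>M) \<le> ennreal C" .
  then have "AE t in M. S t \<noteq> \<infinity>" by (intro nn_integral_noteq_infinite) (auto simp: top_unique)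
  then have S_real: "AE t in M. ennreal (enn2real (S t)) = S t"
    by eventually_elim (simp add: less_top)
  define G where "G t = enn2real (S t)" for t
  have "(\<integral>\<^sup>+t. ennreal (G t) \<partial>M) = (\<integral>\<^sup>+t. S t \<partial>M)"
    unfolding G_def using S_real by (rule nn_integral_cong_AE)
  then have G: "integrable M G"
    using S_le by (intro integrableI_nonneg) (auto simp: G_def[abs_def] intro: le_less_trans)
  have G0: "0 \<le> G t" for t by (simp add: G_def)
  have e_le: "AE t in M. scalar_density (e i) t \<le> G t" for i
    using S_real
  proof eventually_elim
    case (elim t)
    have "ennreal (?m (Suc i) t) \<le> S t" unfolding S_def by (rule SUP_upper) simp
    then have "ennreal (?m (Suc i) t) \<le> ennreal (G t)" using elim by (simp add: G_def)
    then have "?m (Suc i) t \<le> G t" using G0 by (simp add: ennreal_le_iff)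
    then show ?case using max_density_ge[of i "Suc i" e t, OF lessI] by linarith
  qed
  have set_G: "set_integrable M A G" if "A \<in> sets M" for A
    using integrable_mult_indicator[OF that G] by (simp add: set_integrable_def)
  \<comment> \<open>Undoes the normalization: \<open>d i\<close> is its norm times
    \<open>e i\<close>, also when \<open>d i\<close> is zero.\<close>
  have d_le: "F (\<lambda>t. indicat_real A t *\<^sub>R d i) \<le> norm (d i) * (LINT t:A|M. G t)" if A: "A \<in> sets M" for A i
  proof -
    have "(\<lambda>t. indicat_real A t *\<^sub>R d i) = (\<lambda>t. norm (d i) *\<^sub>R (indicat_real A t *\<^sub>R e i))"
    proof
      fix t
      have eq: "norm (d i) *\<^sub>R e i = d i" by (cases "d i = 0") (simp_all add: e_def sgn_div_norm)
      show "indicat_real A t *\<^sub>R d i = norm (d i) *\<^sub>R (indicat_real A t *\<^sub>R e i)"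
        unfolding scaleR_left_commute[of "norm (d i)"] eq ..
    qed
    then have "F (\<lambda>t. indicat_real A t *\<^sub>R d i) = norm (d i) * (LINT t:A|M. scalar_density (e i) t)"
      using F_scale[OF bounded_measurable_indicator[OF A]]
        set_integral_scalar_density[OF A] by simp
    also have "(LINT t:A|M. scalar_density (e i) t) \<le> (LINT t:A|M. G t)"
      using e_le[of i] by (intro set_integral_mono_AE set_integrable_scalar_density set_G A) auto
    finally show ?thesis by (simp add: mult_left_mono)
  qed
  \<comment> \<open>The passage from the dense sequence to arbitrary x is made on set integrals,
    where \<open>F_lim\<close> applies; the densities themselves are unrelated choices for different
    vectors.\<close>
  have le: "F (\<lambda>t. indicat_real A t *\<^sub>R x) \<le> norm x * (LINT t:A|M. G t)" if A: "A \<in> sets M" for A x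
  proof -
    have "\<exists>k. dist (d k) x < 1 / Suc n" for n by (rule d) simp
    then obtain k where k: "\<And>n. dist (d (k n)) x < 1 / Suc n" by metis
    have lim: "(\<lambda>n. d (k n)) \<longlonglongrightarrow> x"
      by (rule tendsto_dist_iff[THEN iffD2], rule tendsto_sandwich[OF _ _ tendsto_const LIMSEQ_Suc[OF lim_1_over_n]])
        (use k in \<open>auto intro: always_eventually less_imp_le\<close>)
    then obtain K where K: "\<And>n. norm (d (k n)) \<le> K"
      using convergent_imp_Bseq[OF convergentI[OF lim]] by (meson BseqE)
    have K0: "0 \<le> K" using K[of 0] norm_ge_zero order_trans by blast
    have "(\<lambda>n. F (\<lambda>t. indicat_real A t *\<^sub>R d (k n))) \<longlonglongrightarrow> F (\<lambda>t. indicat_real A t *\<^sub>R x)"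
    proof (rule F_lim)
      show "(\<lambda>t. indicat_real A t *\<^sub>R d (k n)) \<in> borel_measurable M" for n using A by simp
      show "norm (indicat_real A t *\<^sub>R d (k n)) \<le> K" for n t using K[of n] K0 by (simp add: indicator_def)
      show "(\<lambda>t. indicat_real A t *\<^sub>R x) \<in> bounded_measurable M"
        using A by (rule bounded_measurable_indicator)
      show "AE t in M. (\<lambda>n. indicat_real A t *\<^sub>R d (k n)) \<longlonglongrightarrow> indicat_real A t *\<^sub>R x"
        by (intro AE_I2 tendsto_intros lim)
    qed
    moreover have "(\<lambda>n. norm (d (k n)) * (LINT t:A|M. G t)) \<longlonglongrightarrow> norm x * (LINT t:A|M. G t)"
      by (intro tendsto_intros lim)
    ultimately show ?thesis by (rule LIMSEQ_le) (use d_le[OF A] in blast)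
  qed
  \<comment> \<open>An inequality between the integrals over every measurable set returns to an
    inequality almost everywhere. The lower bound follows by applying it to
    \<open>- x\<close>.\<close>
  have upper: "AE t in M. scalar_density x t \<le> norm x * G t" for x
  proof -
    have "AE t in M. 0 \<le> norm x * G t - scalar_density x t"
    proof (rule density_nonneg)
      show "integrable M (\<lambda>t. norm x * G t - scalar_density x t)" using G integrable_scalar_density by simp
      fix A assume A: "A \<in> sets M"
      have "(LINT t:A|M. norm x * G t - scalar_density x t) =
          norm x * (LINT t:A|M. G t) - (LINT t:A|M. scalar_density x t)"
        using set_G[OF A] set_integrable_scalar_density[OF A] by (subst set_integral_diff(2)) auto
      then show "0 \<le> (LINT t:A|M. norm x * G t - scalar_density x t)"
        using le[OF A, of x] set_integral_scalar_density[OF A, of x] by simp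
    qed
    then show ?thesis by eventually_elim simp
  qed
  have "AE t in M. \<bar>scalar_density x t\<bar> \<le> norm x * G t" for x
    using upper[of x] upper[of "- x"] scalar_density_scale[of "- 1" x] by eventually_elim (simp add: abs_le_iff)
  then show ?thesis using that G G0 by blast
qed

text \<open>A simple function takes finitely many values, so the almost everywhere identities
  between \<open>scalar_density\<close> and h at these values hold simultaneously.\<close>

lemma F_simple:
  assumes s: "simple_function M s"
    and h: "\<And>x. AE t in M. scalar_density x t = blinfun_apply (h t) x"
    and meas: "\<And>x. (\<lambda>t. blinfun_apply (h t) x) \<in> borel_measurable M"
  shows "F s = (LINT t|M. blinfun_apply (h t) (s t))"
proof -
  define A where "A y = s -` {y} \<inter> space M" for y
  have fin: "finite (s ` space M)" and A: "A y \<in> sets M" for y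
    using simple_functionD[OF s] by (auto simp: A_def)
  have bm: "(\<lambda>t. indicat_real (A y) t *\<^sub>R x) \<in> bounded_measurable M" for y and x :: 'e
    using A by (rule bounded_measurable_indicator)
  have F_sum: "(\<lambda>t. \<Sum>y\<in>Y. indicat_real (A y) t *\<^sub>R y) \<in> bounded_measurable M \<and>
      F (\<lambda>t. \<Sum>y\<in>Y. indicat_real (A y) t *\<^sub>R y) = (\<Sum>y\<in>Y. F (\<lambda>t. indicat_real (A y) t *\<^sub>R y))"
    if "finite Y" for Y
    using that
  proof induction
    case empty
    then show ?case using bounded_measurable_const[of 0 M] F_scale[OF bounded_measurable_const, of 0 0] by simp
  next
    case (insert y Y)
    note IH = insert.IH[THEN conjunct1] insert.IH[THEN conjunct2]
    show ?case
      unfolding sum.insert[OF insert.hyps]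
      using bounded_measurable_add[OF bm[of y y] IH(1)] F_add[OF bm[of y y] IH(1)] IH(2) by (simp only: simp_thms)
  qed
  let ?s = "\<lambda>t. \<Sum>y\<in>s ` space M. indicat_real (A y) t *\<^sub>R y"
  have eq: "s t = ?s t" if "t \<in> space M" for t
    unfolding A_def by (rule simple_function_indicator_representation_banach[OF s that])
  obtain K where K: "\<forall>y\<in>s ` space M. norm y \<le> K"
    using finite_imp_bounded[OF fin] unfolding bounded_iff by blast
  have "s \<in> bounded_measurable M"
    by (rule bounded_measurableI[OF borel_measurable_simple_function[OF s], of K]) (use K in blast)
  then have "F s = F ?s"
    by (rule F_cong_AE[OF _ F_sum[OF fin, THEN conjunct1] AE_I2[OF eq]])
  also have "\<dots> = (\<Sum>y\<in>s ` space M. LINT t:A y|M. scalar_density y t)"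
    unfolding F_sum[OF fin, THEN conjunct2] by (rule sum.cong[OF refl]) (rule set_integral_scalar_density[OF A, symmetric])
  also have "\<dots> = (LINT t|M. (\<Sum>y\<in>s ` space M. indicat_real (A y) t * scalar_density y t))"
    using integrable_mult_indicator[OF A integrable_scalar_density]
    by (subst Bochner_Integration.integral_sum) (simp_all add: set_lebesgue_integral_def)
  also have "\<dots> = (LINT t|M. (\<Sum>y\<in>s ` space M. indicat_real (A y) t * blinfun_apply (h t) y))"
  proof (rule integral_cong_AE)
    show "(\<lambda>t. \<Sum>y\<in>s ` space M. indicat_real (A y) t * scalar_density y t) \<in> borel_measurable M"
      using A borel_measurable_integrable[OF integrable_scalar_density] by measurable
    show "(\<lambda>t. \<Sum>y\<in>s ` space M. indicat_real (A y) t * blinfun_apply (h t) y) \<in> borel_measurable M"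
      using A meas by measurable
    have "AE t in M. \<forall>y\<in>s ` space M. scalar_density y t = blinfun_apply (h t) y"
      using fin h by (intro AE_finite_allI) auto
    then show "AE t in M. (\<Sum>y\<in>s ` space M. indicat_real (A y) t * scalar_density y t) =
        (\<Sum>y\<in>s ` space M. indicat_real (A y) t * blinfun_apply (h t) y)"
      by eventually_elim (intro sum.cong refl, metis)
  qed
  also have "\<dots> = (LINT t|M. blinfun_apply (h t) (s t))"
  proof (rule Bochner_Integration.integral_cong[OF refl])
    fix t assume "t \<in> space M"
    from arg_cong[OF eq[OF this], of "blinfun_apply (h t)"]
    show "(\<Sum>y\<in>s ` space M. indicat_real (A y) t * blinfun_apply (h t) y) = blinfun_apply (h t) (s t)"
      by (simp only: blinfun.sum_right blinfun.scaleR_right real_scaleR_def)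
  qed
  finally show ?thesis .
qed

text \<open>Both sides are continuous along simple functions s i converging to w with norm at most
  twice that of w: the left by \<open>F_lim\<close>, the right by dominated convergence with
  majorant a multiple of G.\<close>

theorem dual_representation:
  obtains h :: "'a \<Rightarrow> 'e \<Rightarrow>\<^sub>L real" and G
  where "integrable M G" "\<And>t. 0 \<le> G t" "\<And>t. norm (h t) \<le> G t"
    "\<And>x. (\<lambda>t. blinfun_apply (h t) x) \<in> borel_measurable M"
    "\<And>w. w \<in> bounded_measurable M \<Longrightarrow> integrable M (\<lambda>t. blinfun_apply (h t) (w t))"
    "\<And>w. w \<in> bounded_measurable M \<Longrightarrow> F w = (LINT t|M. blinfun_apply (h t) (w t))"
proof -
  obtain G where G: "integrable M G" "\<And>t. 0 \<le> G t"
    "\<And>x. AE t in M. \<bar>scalar_density x t\<bar> \<le> norm x * G t"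
    using dominating_density by blast
  obtain d :: "nat \<Rightarrow> 'e" where d: "\<And>x e. 0 < e \<Longrightarrow> \<exists>n. dist (d n) x < e"
    using countable_dense_seq by blast
  have D: "countable (range d)" "closure (range d) = UNIV"
    using d by (auto simp: closure_approachable)
  obtain h :: "'a \<Rightarrow> 'e \<Rightarrow>\<^sub>L real" where h: "\<And>t. norm (h t) \<le> G t"
    "\<And>x. (\<lambda>t. blinfun_apply (h t) x) \<in> borel_measurable M"
    "\<And>x. AE t in M. scalar_density x t = blinfun_apply (h t) x"
    by (rule dual_valued_density[OF D borel_measurable_integrable[OF integrable_scalar_density]
        scalar_density_linear G(3,2)]) blast
  have *: "integrable M (\<lambda>t. blinfun_apply (h t) (w t)) \<and> F w = (LINT t|M. blinfun_apply (h t) (w t))"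
    if w: "w \<in> bounded_measurable M" for w
  proof -
    obtain C where C: "\<And>t. t \<in> space M \<Longrightarrow> norm (w t) \<le> C" and [measurable]: "w \<in> borel_measurable M"
      using w by (auto simp: bounded_measurable_def)
    obtain s where "\<forall>i. simple_function M (s i)" "\<forall>t\<in>space M. (\<lambda>i. s i t) \<longlonglongrightarrow> w t"
      "\<forall>i. \<forall>t\<in>space M. dist (s i t) 0 \<le> 2 * dist (w t) 0"
      using borel_measurable_implies_sequence_metric[of w M 0] \<open>w \<in> borel_measurable M\<close> by blast
    then have s: "\<And>i. simple_function M (s i)" "\<And>t. t \<in> space M \<Longrightarrow> (\<lambda>i. s i t) \<longlonglongrightarrow> w t"
      "\<And>i t. t \<in> space M \<Longrightarrow> norm (s i t) \<le> 2 * norm (w t)"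
      by simp_all
    have s_le: "norm (s i t) \<le> 2 * C" if "t \<in> space M" for i t
      using s(3)[OF that, of i] C[OF that] by linarith
    have lim: "(\<lambda>i. blinfun_apply (h t) (s i t)) \<longlonglongrightarrow> blinfun_apply (h t) (w t)" if "t \<in> space M" for t
      by (intro tendsto_intros s(2) that)
    \<comment> \<open>The function h is measurable only after evaluation at a fixed vector, so the
      pairing with \<open>s i\<close> is expanded over its finitely many values.\<close>
    have meas: "(\<lambda>t. blinfun_apply (h t) (s i t)) \<in> borel_measurable M" for i
    proof -
      let ?f = "\<lambda>t. \<Sum>y\<in>s i ` space M. indicat_real (s i -` {y} \<inter> space M) t * blinfun_apply (h t) y"
      have "?f \<in> borel_measurable M"
        using h(2) simple_functionD[OF s(1)] by measurable
      moreover have "?f t = blinfun_apply (h t) (s i t)" if "t \<in> space M" for t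
        using arg_cong[OF simple_function_indicator_representation_banach[OF s(1) that, of i], of "blinfun_apply (h t)"]
        by (simp only: blinfun.sum_right blinfun.scaleR_right real_scaleR_def)
      ultimately show ?thesis using measurable_cong[of M ?f] by simp
    qed
    have meas_w: "(\<lambda>t. blinfun_apply (h t) (w t)) \<in> borel_measurable M"
      by (rule borel_measurable_LIMSEQ_real[OF lim meas])
    have dom: "\<bar>blinfun_apply (h t) x\<bar> \<le> G t * norm x" for t x
      using norm_blinfun[of "h t" x] mult_right_mono[OF h(1)[of t] norm_ge_zero[of x]] by simp
    have dom_s: "norm (blinfun_apply (h t) (s i t)) \<le> G t * (2 * C)" if "t \<in> space M" for i t
      using dom[of t "s i t"] mult_left_mono[OF s_le[OF that, of i] G(2)[of t]] by simp
    have dom_w: "\<bar>blinfun_apply (h t) (w t)\<bar> \<le> G t * C" if "t \<in> space M" for t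
      using dom[of t "w t"] mult_left_mono[OF C[OF that] G(2)[of t]] by linarith
    have int: "integrable M (\<lambda>t. blinfun_apply (h t) (w t))"
    proof (rule Bochner_Integration.integrable_bound[OF _ meas_w])
      show "integrable M (\<lambda>t. G t * C)" using G(1) by simp
      show "AE t in M. norm (blinfun_apply (h t) (w t)) \<le> norm (G t * C)"
        by (rule AE_I2) (metis dom_w abs_ge_self order_trans real_norm_def)
    qed
    have "(\<lambda>i. LINT t|M. blinfun_apply (h t) (s i t)) \<longlonglongrightarrow> (LINT t|M. blinfun_apply (h t) (w t))"
      by (rule integral_dominated_convergence[where w = "\<lambda>t. G t * (2 * C)"])
        (use G(1) meas meas_w lim dom_s in auto)
    then have "(\<lambda>i. F (s i)) \<longlonglongrightarrow> (LINT t|M. blinfun_apply (h t) (w t))"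
      using F_simple[OF s(1) h(3,2)] by simp
    moreover have "(\<lambda>i. F (s i)) \<longlonglongrightarrow> F w"
      by (rule F_lim[OF _ s_le w]) (use s(2) borel_measurable_simple_function[OF s(1)] in auto)
    ultimately show ?thesis using int LIMSEQ_unique by blast
  qed
  show ?thesis
    by (rule that[OF G(1,2) h(1,2)]) (use * in auto)
qed

end

section \<open>Test functions\<close>

text \<open>Higher differentiability with the derivative as an existential witness. Closure under
  sums, products and composition is then a plain induction, with no formula for iterated
  derivatives; \<open>times_differentiable_iff\<close> translates to the form used in
  \<open>test_fun\<close>.\<close>

fun times_differentiable :: "nat \<Rightarrow> (real \<Rightarrow> real) \<Rightarrow> bool" where
  "times_differentiable 0 f = True"
| "times_differentiable (Suc n) f =
     (\<exists>f'. (\<forall>t. (f has_real_derivative f' t) (at t)) \<and> times_differentiable n f')"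

lemma times_differentiable_SucI:
  "(\<And>t. (f has_real_derivative f' t) (at t)) \<Longrightarrow> times_differentiable n f' \<Longrightarrow>
    times_differentiable (Suc n) f"
  by auto

lemma times_differentiable_SucE:
  assumes "times_differentiable (Suc n) f"
  obtains f' where "\<forall>t. (f has_real_derivative f' t) (at t)" "times_differentiable n f'"
  using assms by auto

lemma times_differentiable_Suc_imp: "times_differentiable (Suc n) f \<Longrightarrow> times_differentiable n f"
proof (induction n arbitrary: f)
  case (Suc n)
  obtain f' where f'0: "\<forall>t. (f has_real_derivative f' t) (at t)" "times_differentiable (Suc n) f'"
    by (rule times_differentiable_SucE[OF Suc.prems])
  note f' = f'0(1)[rule_format] f'0(2)
  show ?case by (rule times_differentiable_SucI[OF f'(1) Suc.IH[OF f'(2)]])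
qed simp

lemma times_differentiable_const: "times_differentiable n (\<lambda>t. c)"
proof (induction n arbitrary: c)
  case (Suc n)
  show ?case by (rule times_differentiable_SucI[OF DERIV_const Suc])
qed simp

lemma times_differentiable_add:
  "times_differentiable n f \<Longrightarrow> times_differentiable n g \<Longrightarrow> times_differentiable n (\<lambda>t. f t + g t)"
proof (induction n arbitrary: f g)
  case (Suc n)
  obtain f' where f'0: "\<forall>t. (f has_real_derivative f' t) (at t)" "times_differentiable n f'"
    by (rule times_differentiable_SucE[OF Suc.prems(1)])
  note f' = f'0(1)[rule_format] f'0(2)
  obtain g' where g'0: "\<forall>t. (g has_real_derivative g' t) (at t)" "times_differentiable n g'"
    by (rule times_differentiable_SucE[OF Suc.prems(2)])
  note g' = g'0(1)[rule_format] g'0(2)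
  show ?case by (rule times_differentiable_SucI[OF DERIV_add[OF f'(1) g'(1)] Suc.IH[OF f'(2) g'(2)]])
qed simp

lemma times_differentiable_mult:
  "times_differentiable n f \<Longrightarrow> times_differentiable n g \<Longrightarrow> times_differentiable n (\<lambda>t. f t * g t)"
proof (induction n arbitrary: f g)
  case (Suc n)
  obtain f' where f'0: "\<forall>t. (f has_real_derivative f' t) (at t)" "times_differentiable n f'"
    by (rule times_differentiable_SucE[OF Suc.prems(1)])
  note f' = f'0(1)[rule_format] f'0(2)
  obtain g' where g'0: "\<forall>t. (g has_real_derivative g' t) (at t)" "times_differentiable n g'"
    by (rule times_differentiable_SucE[OF Suc.prems(2)])
  note g' = g'0(1)[rule_format] g'0(2)
  have "times_differentiable n (\<lambda>t. f' t * g t + g' t * f t)"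
    by (rule times_differentiable_add[OF
          Suc.IH[OF f'(2) times_differentiable_Suc_imp[OF Suc.prems(2)]]
          Suc.IH[OF g'(2) times_differentiable_Suc_imp[OF Suc.prems(1)]]])
  then show ?case by (rule times_differentiable_SucI[OF DERIV_mult[OF f'(1) g'(1)]])
qed simp

lemma times_differentiable_affine:
  "times_differentiable n f \<Longrightarrow> times_differentiable n (\<lambda>t. f (a * t + b))"
proof (induction n arbitrary: f)
  case (Suc n)
  obtain f' where f'0: "\<forall>t. (f has_real_derivative f' t) (at t)" "times_differentiable n f'"
    by (rule times_differentiable_SucE[OF Suc.prems])
  note f' = f'0(1)[rule_format] f'0(2)
  have "((\<lambda>t. a * t + b) has_real_derivative a) (at t)" for t
    by (auto intro!: derivative_eq_intros)
  from DERIV_chain2[where f = f, OF f'(1) this]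
  have "((\<lambda>t. f (a * t + b)) has_real_derivative f' (a * t + b) * a) (at t)" for t .
  then show ?case
    by (rule times_differentiable_SucI)
      (rule times_differentiable_mult[OF Suc.IH[OF f'(2)] times_differentiable_const])
qed simp

lemma times_differentiable_exp:
  "times_differentiable n f \<Longrightarrow> times_differentiable n (\<lambda>t. exp (f t))"
proof (induction n arbitrary: f)
  case (Suc n)
  obtain f' where f'0: "\<forall>t. (f has_real_derivative f' t) (at t)" "times_differentiable n f'"
    by (rule times_differentiable_SucE[OF Suc.prems])
  note f' = f'0(1)[rule_format] f'0(2)
  have "times_differentiable n (\<lambda>t. exp (f t) * f' t)"
    by (rule times_differentiable_mult[OF Suc.IH[OF times_differentiable_Suc_imp[OF Suc.prems]] f'(2)])
  then show ?case
    by (rule times_differentiable_SucI[OF DERIV_chain2[where f = exp, OF DERIV_exp f'(1)]])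
qed simp

lemma times_differentiable_iff:
  "(\<forall>n. times_differentiable n f) \<longleftrightarrow> (\<forall>k t. (deriv ^^ k) f differentiable at t)"
proof
  have "(deriv ^^ k) f differentiable at t" if "times_differentiable (Suc k) f" for k f t
    using that
  proof (induction k arbitrary: f)
    case 0
    then show ?case using real_differentiable_def by auto
  next
    case (Suc k)
    obtain f' where f'0: "\<forall>t. (f has_real_derivative f' t) (at t)" "times_differentiable (Suc k) f'"
      by (rule times_differentiable_SucE[OF Suc.prems])
  note f' = f'0(1)[rule_format] f'0(2)
    have "deriv f = f'" using DERIV_imp_deriv[OF f'(1)] by (rule ext)
    then show ?case using Suc.IH[OF f'(2)] by (simp add: funpow_swap1 del: times_differentiable.simps)
  qed
  then show "\<forall>n. times_differentiable n f \<Longrightarrow> \<forall>k t. (deriv ^^ k) f differentiable at t" by blast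
next
  assume *: "\<forall>k t. (deriv ^^ k) f differentiable at t"
  have "times_differentiable n ((deriv ^^ k) f)" for n k
  proof (induction n arbitrary: k)
    case (Suc n)
    have "((deriv ^^ k) f has_real_derivative (deriv ^^ Suc k) f t) (at t)" for t
      using * DERIV_deriv_iff_real_differentiable by auto
    then show ?case by (rule times_differentiable_SucI[OF _ Suc])
  qed simp
  from this[of _ 0] show "\<forall>n. times_differentiable n f" by simp
qed

section \<open>Smooth bump functions\<close>

text \<open>The functions p(1/t) exp(-1/t), extended by zero to t \<le> 0, form a class closed under
  differentiation. Allowing all polynomials p makes smoothness of exp(-1/t) a one-line
  induction.\<close>

definition poly_exp :: "real poly \<Rightarrow> real \<Rightarrow> real" where
  "poly_exp p t = (if 0 < t then poly p (1 / t) * exp (- (1 / t)) else 0)"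

lemma poly_times_exp_minus_tendsto_0: "((\<lambda>s. poly p s * exp (- s)) \<longlongrightarrow> (0::real)) at_top"
proof -
  have "((\<lambda>s. \<Sum>i\<le>degree p. coeff p i * (s ^ i / exp s)) \<longlongrightarrow> (\<Sum>i\<le>degree p. coeff p i * 0)) at_top"
    by (intro tendsto_sum tendsto_mult tendsto_const tendsto_power_div_exp_0)
  then show ?thesis
    by (simp add: poly_altdef exp_minus sum_distrib_right divide_inverse mult.assoc)
qed

text \<open>With s = 1/t one has ds/dt = - s^2, so p(s) exp(-s) has derivative s^2 (p - p')(s)
  exp(-s); the polynomial \<open>[:0, 0, 1:]\<close> is s^2.\<close>

lemma poly_exp_has_derivative:
  "(poly_exp p has_real_derivative poly_exp ([:0, 0, 1:] * (p - pderiv p)) t) (at t)"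
proof -
  consider "t > 0" | "t < 0" | "t = 0" by linarith
  then show ?thesis
  proof cases
    case 1
    have "((\<lambda>t. poly p (1 / t) * exp (- (1 / t))) has_real_derivative
        poly_exp ([:0, 0, 1:] * (p - pderiv p)) t) (at t)"
      using 1 by (auto intro!: derivative_eq_intros DERIV_chain2[OF poly_DERIV]
          simp: poly_exp_def field_simps power2_eq_square)
    then show ?thesis
      by (rule has_field_derivative_transform_within_open[of _ _ _ "{0<..}"]) (use 1 in \<open>auto simp: poly_exp_def\<close>)
  next
    case 2
    have "((\<lambda>t. 0) has_real_derivative 0) (at t)" by simp
    then have "(poly_exp p has_real_derivative 0) (at t)"
      by (rule has_field_derivative_transform_within_open[of _ _ _ "{..<0}"]) (use 2 in \<open>auto simp: poly_exp_def\<close>)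
    then show ?thesis using 2 by (simp add: poly_exp_def)
  next
    case 3
    have "((\<lambda>h. poly_exp p h / h) \<longlongrightarrow> 0) (at_right 0)"
    proof -
      have "filterlim (\<lambda>h. 1 / h) at_top (at_right (0::real))"
        using filterlim_inverse_at_top_right by (simp add: inverse_eq_divide)
      \<comment> \<open>The difference quotient at 0 is s p(s) exp(-s), and \<open>pCons 0 p\<close>
        is the polynomial s p(s).\<close>
      from filterlim_compose[OF poly_times_exp_minus_tendsto_0[of "pCons 0 p"] this]
      have "((\<lambda>h. poly (pCons 0 p) (1 / h) * exp (- (1 / h))) \<longlongrightarrow> 0) (at_right 0)" .
      then show ?thesis
        by (rule Lim_transform_eventually)
          (auto simp: poly_exp_def eventually_at_right_less intro!: eventually_mono[OF eventually_at_right_less[of 0]])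
    qed
    moreover have "((\<lambda>h. poly_exp p h / h) \<longlongrightarrow> 0) (at_left 0)"
      by (rule tendsto_eventually) (auto simp: eventually_at_left_field poly_exp_def intro!: exI[of _ "-1"])
    ultimately have "((\<lambda>h. poly_exp p h / h) \<longlongrightarrow> 0) (at 0)"
      by (simp add: filterlim_split_at)
    then show ?thesis using 3 by (simp add: DERIV_def poly_exp_def)
  qed
qed

lemma times_differentiable_poly_exp: "times_differentiable n (poly_exp p)"
proof (induction n arbitrary: p)
  case (Suc n)
  show ?case by (rule times_differentiable_SucI[OF poly_exp_has_derivative Suc])
qed simp

lemma bump_function:
  fixes c d :: real
  obtains \<beta> where "\<And>n. times_differentiable n \<beta>" "\<And>t. 0 \<le> \<beta> t" "\<And>t. 0 < \<beta> t \<longleftrightarrow> c < t \<and> t < d"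
proof -
  \<comment> \<open>The product of exp(-1/(t - c)) and exp(-1/(d - t)), with arguments written in
    the shape of \<open>times_differentiable_affine\<close>.\<close>
  define \<beta> where "\<beta> t = poly_exp 1 (1 * t + (- c)) * poly_exp 1 ((- 1) * t + d)" for t
  have nonneg: "0 \<le> poly_exp 1 t" for t by (simp add: poly_exp_def)
  have pos: "0 < poly_exp 1 t \<longleftrightarrow> 0 < t" for t by (simp add: poly_exp_def)
  show ?thesis
  proof (rule that[of \<beta>])
    show "times_differentiable n \<beta>" for n
      unfolding \<beta>_def by (intro times_differentiable_mult times_differentiable_affine times_differentiable_poly_exp)
    show "0 \<le> \<beta> t" for t using nonneg by (simp add: \<beta>_def)
    show "0 < \<beta> t \<longleftrightarrow> c < t \<and> t < d" for t
      using nonneg[of "1 * t + (- c)"] nonneg[of "(- 1) * t + d"] pos[of "1 * t + (- c)"] pos[of "(- 1) * t + d"]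
      by (auto simp: \<beta>_def zero_less_mult_iff)
  qed
qed

lemma test_funI:
  assumes "\<And>n. times_differentiable n \<phi>" "\<And>t. t \<notin> {c..d} \<Longrightarrow> \<phi> t = 0" "{c..d} \<subseteq> interior I"
  shows "\<phi> \<in> test_fun I"
proof -
  have "closure {t. \<phi> t \<noteq> 0} \<subseteq> {c..d}" using assms(2) by (intro closure_minimal subsetI) (blast, simp)
  moreover then have "compact (closure {t. \<phi> t \<noteq> 0})"
    by (metis bounded_closed_interval bounded_subset closed_closure compact_eq_bounded_closed)
  ultimately show ?thesis using assms(1,3) times_differentiable_iff[of \<phi>] by (auto simp: test_fun_def)
qed

text \<open>For a bump \<beta> that is positive exactly on the open interval, the functions 1 -
  exp(-k \<beta>) are smooth, lie between 0 and 1, vanish where \<beta> does, and increase to 1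
  where \<beta> is positive.\<close>

lemma indicator_test_fun_approximation:
  fixes c d :: real
  assumes "{c..d} \<subseteq> interior I"
  obtains \<phi> :: "nat \<Rightarrow> real \<Rightarrow> real" where "\<And>k. \<phi> k \<in> test_fun I" "\<And>k t. \<bar>\<phi> k t\<bar> \<le> indicator {c..d} t"
    "\<And>t. (\<lambda>k. \<phi> k t) \<longlonglongrightarrow> indicator {c<..<d} t"
proof -
  obtain \<beta> where \<beta>: "\<And>n. times_differentiable n \<beta>" "\<And>t. 0 \<le> \<beta> t" "\<And>t. 0 < \<beta> t \<longleftrightarrow> c < t \<and> t < d"
    using bump_function by blast
  have \<beta>0: "\<beta> t = 0" if "\<not> (c < t \<and> t < d)" for t using \<beta>(2)[of t] \<beta>(3)[of t] that by linarith
  define \<phi> where "\<phi> k t = 1 + (- 1) * exp ((- real k) * \<beta> t)" for k t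
  show ?thesis
  proof (rule that[of \<phi>])
    show "\<phi> k \<in> test_fun I" for k
    proof (rule test_funI[OF _ _ assms])
      show "times_differentiable n (\<phi> k)" for n
        unfolding \<phi>_def
        by (intro times_differentiable_add times_differentiable_mult times_differentiable_exp
            times_differentiable_const \<beta>(1))
      show "\<phi> k t = 0" if "t \<notin> {c..d}" for t using that \<beta>0[of t] by (auto simp: \<phi>_def)
    qed
    show "\<bar>\<phi> k t\<bar> \<le> indicator {c..d} t" for k t
    proof (cases "t \<in> {c..d}")
      case True
      have "exp ((- real k) * \<beta> t) \<le> 1" using \<beta>(2)[of t] by simp
      moreover have "0 < exp ((- real k) * \<beta> t)" by simp
      ultimately show ?thesis unfolding \<phi>_def using True by (simp add: abs_le_iff)
    next
      case False
      then show ?thesis using \<beta>0[of t] by (auto simp: \<phi>_def)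
    qed
    show "(\<lambda>k. \<phi> k t) \<longlonglongrightarrow> indicator {c<..<d} t" for t
    proof (cases "c < t \<and> t < d")
      case True
      then have "0 < \<beta> t" using \<beta>(3) by simp
      have "(\<lambda>k. exp (- \<beta> t) ^ k) \<longlonglongrightarrow> 0"
        by (rule LIMSEQ_realpow_zero) (use \<open>0 < \<beta> t\<close> in \<open>simp_all only: exp_ge_zero exp_less_one_iff neg_less_0_iff_less\<close>)
      then have "(\<lambda>k. 1 + (- 1) * exp (- \<beta> t) ^ k) \<longlonglongrightarrow> 1 + (- 1) * 0"
        by (intro tendsto_add tendsto_mult tendsto_const)
      moreover have "\<phi> k t = 1 + (- 1) * exp (- \<beta> t) ^ k" for k
        using exp_of_nat_mult[of k "- \<beta> t"] by (simp add: \<phi>_def)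
      ultimately show ?thesis using True by simp
    next
      case False
      then show ?thesis using \<beta>0[of t] by (auto simp: \<phi>_def)
    qed
  qed
qed

section \<open>Elementary properties of test functions\<close>

lemma test_fun_times_differentiable: "\<phi> \<in> test_fun I \<Longrightarrow> times_differentiable n \<phi>"
  using times_differentiable_iff[of \<phi>] by (simp add: test_fun_def)

lemma test_fun_DERIV: "\<phi> \<in> test_fun I \<Longrightarrow> (\<phi> has_real_derivative deriv \<phi> t) (at t)"
  using DERIV_deriv_iff_real_differentiable[of \<phi> t] unfolding test_fun_def
  by (metis (mono_tags, lifting) funpow_0 mem_Collect_eq)

lemma test_fun_continuous: "\<phi> \<in> test_fun I \<Longrightarrow> continuous_on S \<phi>"
  by (meson DERIV_isCont continuous_at_imp_continuous_on test_fun_DERIV)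

lemma test_fun_outside: "\<phi> \<in> test_fun I \<Longrightarrow> t \<notin> interior I \<Longrightarrow> \<phi> t = 0"
  using closure_subset[of "{t. \<phi> t \<noteq> 0}"] by (auto simp: test_fun_def)

lemma deriv_test_fun:
  assumes "\<phi> \<in> test_fun I"
  shows "deriv \<phi> \<in> test_fun I"
proof -
  let ?S = "closure {t. \<phi> t \<noteq> 0}"
  have "deriv \<phi> t = 0" if "t \<notin> ?S" for t
  proof -
    have "((\<lambda>t. 0) has_real_derivative 0) (at t)" by simp
    then have "(\<phi> has_real_derivative 0) (at t)"
      by (rule has_field_derivative_transform_within_open[of _ _ _ "- ?S"])
        (use that closure_subset[of "{t. \<phi> t \<noteq> 0}"] in auto)
    then show ?thesis by (rule DERIV_imp_deriv)
  qed
  then have sub: "closure {t. deriv \<phi> t \<noteq> 0} \<subseteq> ?S" by (intro closure_minimal) auto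
  have "(deriv ^^ k) (deriv \<phi>) differentiable at t" for k t
    using assms unfolding test_fun_def by (metis (mono_tags, lifting) funpow_Suc_right mem_Collect_eq o_apply)
  moreover have "compact (closure {t. deriv \<phi> t \<noteq> 0})"
    using compact_Int_closed[of ?S, OF _ closed_closure, of "{t. deriv \<phi> t \<noteq> 0}"] sub assms
    by (simp add: test_fun_def Int_absorb1)
  ultimately show ?thesis using sub assms by (auto simp: test_fun_def)
qed

lemma test_fun_bounded:
  assumes "\<phi> \<in> test_fun I"
  obtains C where "\<And>t. \<bar>\<phi> t\<bar> \<le> C"
proof -
  let ?S = "closure {t. \<phi> t \<noteq> 0}"
  have "compact (\<phi> ` ?S)"
    using assms by (intro compact_continuous_image test_fun_continuous) (auto simp: test_fun_def)
  then obtain C where C: "\<forall>y\<in>\<phi> ` ?S. norm y \<le> C" using compact_imp_bounded bounded_iff by metis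
  have "\<bar>\<phi> t\<bar> \<le> \<bar>C\<bar>" for t
  proof (cases "\<phi> t = 0")
    case False
    then have "t \<in> ?S" using closure_subset[of "{t. \<phi> t \<noteq> 0}"] by auto
    then show ?thesis using C by force
  qed simp
  then show ?thesis using that by blast
qed

section \<open>Weak derivatives on a bounded interval\<close>

lemma
  fixes f :: "'a::euclidean_space \<Rightarrow> 'b::{banach, second_countable_topology}"
  assumes S: "S \<in> sets lebesgue" and f: "\<And>t. t \<notin> S \<Longrightarrow> f t = 0"
  shows integrable_lebesgue_on_supported: "integrable (lebesgue_on S) f \<longleftrightarrow> integrable lebesgue f"
    and integral_lebesgue_on_supported: "integral\<^sup>L (lebesgue_on S) f = integral\<^sup>L lebesgue f"
proof -
  have "(\<lambda>t. indicator S t *\<^sub>R f t) = f" using f by (auto simp: indicator_def fun_eq_iff)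
  then show "integrable (lebesgue_on S) f \<longleftrightarrow> integrable lebesgue f"
    "integral\<^sup>L (lebesgue_on S) f = integral\<^sup>L lebesgue f"
    using S by (simp_all add: integrable_restrict_space integral_restrict_space)
qed

lemma has_derivative_imp_integral_supported:
  fixes F f :: "real \<Rightarrow> real"
  assumes F: "\<And>t. (F has_real_derivative f t) (at t)" and f: "continuous_on UNIV f" "\<And>t. t \<notin> {a..b} \<Longrightarrow> f t = 0"
    and "a \<le> b"
  shows "integral\<^sup>L lebesgue f = F b - F a"
proof -
  have [measurable]: "f \<in> borel_measurable borel" using f(1) by (rule borel_measurable_continuous_onI)
  have "integral\<^sup>L lebesgue f = integral\<^sup>L lborel f" by (rule integral_completion) simp
  also have "\<dots> = (LINT t|lborel. indicator {a..b} t *\<^sub>R f t)"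
    using f(2) by (intro Bochner_Integration.integral_cong) (auto simp: indicator_def)
  also have "\<dots> = F b - F a"
  proof (rule integral_FTC_atLeastAtMost[OF \<open>a \<le> b\<close>])
    show "(F has_vector_derivative f t) (at t within {a..b})" for t
      using F[of t] by (auto simp: has_real_derivative_iff_has_vector_derivative intro: has_vector_derivative_at_within)
    show "continuous_on {a..b} f" using f(1) continuous_on_subset by blast
  qed
  finally show ?thesis .
qed

text \<open>Open rays are an intersection-stable generator of the Borel sets, so Dynkin induction
  applies; the vanishing total integral handles complements. A Lebesgue set differs from a Borel set
  by a null set.\<close>

lemma integral_zero_on_rays_imp_zero_on_sets:
  fixes f :: "real \<Rightarrow> 'b::{banach, second_countable_topology}"
  assumes f: "integrable lebesgue f" and total: "integral\<^sup>L lebesgue f = 0"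
    and rays: "\<And>a. (LINT t:{a<..}|lebesgue. f t) = 0" and A: "A \<in> sets lebesgue"
  shows "(LINT t:A|lebesgue. f t) = 0"
proof -
  have si: "set_integrable lebesgue B f" if "B \<in> sets lebesgue" for B
    using integrable_mult_indicator[OF that f] by (simp add: set_integrable_def)
  have sb: "set_borel_measurable lebesgue B f" if "B \<in> sets lebesgue" for B
    using si[OF that] by (auto simp: set_integrable_def set_borel_measurable_def)
  have borel_eq: "sets (borel :: real measure) = sigma_sets UNIV (range greaterThan)"
    unfolding borel_Ioi by simp
  have ray_sets: "B \<in> sets lebesgue" if "B \<in> sigma_sets UNIV (range greaterThan)" for B :: "real set"
    by (rule sets_completionI_sets) (use that borel_eq in simp)
  have borel: "(LINT t:B|lebesgue. f t) = 0" if "B \<in> sigma_sets UNIV (range greaterThan)" for B :: "real set"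
  proof (rule sigma_sets_induct_disjoint[OF _ _ that])
    show "Int_stable (range greaterThan :: real set set)"
      unfolding Int_stable_def
    proof safe
      fix a b :: real
      have "{a<..} \<inter> {b<..} = {max a b<..}" by auto
      then show "{a<..} \<inter> {b<..} \<in> range greaterThan" by blast
    qed
    show "range greaterThan \<subseteq> Pow (UNIV :: real set)" by simp
    show "(LINT t:B|lebesgue. f t) = 0" if "B \<in> range greaterThan" for B using that rays by auto
    show "(LINT t:{}|lebesgue. f t) = 0" by (simp add: set_lebesgue_integral_def)
  next
    fix B :: "real set" assume B: "B \<in> sigma_sets UNIV (range greaterThan)" "(LINT t:B|lebesgue. f t) = 0"
    then have "B \<in> sets lebesgue" by (intro ray_sets)
    then have "(LINT t:B \<union> (UNIV - B)|lebesgue. f t) = (LINT t:B|lebesgue. f t) + (LINT t:UNIV - B|lebesgue. f t)"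
      by (intro set_integral_Un si) auto
    then show "(LINT t:UNIV - B|lebesgue. f t) = 0"
      using B(2) total by (simp add: set_lebesgue_integral_def)
  next
    fix B :: "nat \<Rightarrow> real set" assume B: "disjoint_family B" "range B \<subseteq> sigma_sets UNIV (range greaterThan)"
      "\<And>i. (LINT t:B i|lebesgue. f t) = 0"
    then have meas: "B i \<in> sets lebesgue" for i by (intro ray_sets) auto
    have "(LINT t:(\<Union>i. B i)|lebesgue. f t) = (\<Sum>i. (LINT t:B i|lebesgue. f t))"
      using B(1) meas by (intro lebesgue_integral_countable_add si) (auto simp: disjoint_family_on_def)
    then show "(LINT t:(\<Union>i. B i)|lebesgue. f t) = 0" using B(3) by simp
  qed
  obtain S N N' where A_eq: "A = S \<union> N" and N: "N \<subseteq> N'" "N' \<in> null_sets lborel" and S: "S \<in> sets lborel"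
    using A by (rule sets_completionE)
  have "(LINT t:A|lebesgue. f t) = (LINT t:S|lebesgue. f t)"
  proof (rule set_integral_cong_set)
    show "AE t in lebesgue. t \<in> S \<longleftrightarrow> t \<in> A"
      using AE_completion[OF AE_not_in[OF N(2)]] by eventually_elim (use A_eq N(1) in auto)
  qed (use S A in \<open>auto intro!: sb sets_completionI_sets\<close>)
  also have "\<dots> = 0" using S borel_eq by (intro borel) simp
  finally show ?thesis .
qed

section \<open>The fundamental lemma of the calculus of variations\<close>

locale bounded_interval =
  fixes I :: "real set"
  assumes interval: "is_interval I" and bdd: "bounded I"
begin

abbreviation \<mu> :: "real measure" where "\<mu> \<equiv> lebesgue_on I"

lemma I_lmeasurable: "I \<in> lmeasurable"
  using interval bdd by (simp add: is_interval_convex measurable_convex)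

lemma I_lebesgue: "I \<in> sets lebesgue" using I_lmeasurable by (rule fmeasurableD)

sublocale finite_measure \<mu> by (rule finite_measure_lebesgue_on[OF I_lmeasurable])

lemma AE_\<mu>_iff: "(AE t in \<mu>. P t) \<longleftrightarrow> (AE t in lebesgue. t \<in> I \<longrightarrow> P t)"
  using I_lebesgue by (intro AE_restrict_space_iff) simp

text \<open>The frontier of a convex set is negligible. Test functions see only the interior of I,
  and this lemma carries what they determine over to I.\<close>

lemma AE_interior: "AE t in \<mu>. t \<in> interior I"
proof -
  have "negligible (frontier I)" using interval by (simp add: is_interval_convex negligible_convex_frontier)
  then have "frontier I \<in> null_sets lebesgue" by (simp add: negligible_iff_null_sets)
  from AE_not_in[OF this] have "AE t in lebesgue. t \<in> I \<longrightarrow> t \<in> interior I"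
    by eventually_elim (use closure_subset[of I] in \<open>auto simp: frontier_def\<close>)
  then show ?thesis by (simp add: AE_\<mu>_iff)
qed

lemma interior_Icc: "c \<in> interior I \<Longrightarrow> d \<in> interior I \<Longrightarrow> {c..d} \<subseteq> interior I"
  using interval by (metis atLeastatMost_empty_iff2 closed_segment_eq_real_ivl convex_contains_segment convex_interior empty_subsetI is_interval_convex)

lemma locally_integrable_on_compact:
  assumes "locally_integrable I v" "compact K" "K \<subseteq> interior I"
  shows "integrable \<mu> (\<lambda>t. indicat_real K t *\<^sub>R v t)"
proof -
  have "K \<subseteq> I" using assms(3) interior_subset by blast
  then show ?thesis
    using assms I_lebesgue by (subst integrable_lebesgue_on_supported)
      (auto simp: locally_integrable_def set_integrable_def indicator_def)
qed

lemma locally_integrable_add: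
  "locally_integrable I u \<Longrightarrow> locally_integrable I v \<Longrightarrow> locally_integrable I (\<lambda>t. u t + v t)"
  unfolding locally_integrable_def by (auto intro!: set_integral_add)

lemma locally_integrable_scaleR:
  "locally_integrable I u \<Longrightarrow> locally_integrable I (\<lambda>t. c *\<^sub>R u t)"
  unfolding locally_integrable_def set_integrable_def
  by (intro allI impI, subst scaleR_left_commute, rule integrable_scaleR_right, blast)

lemma integrable_imp_locally_integrable:
  assumes "integrable \<mu> u"
  shows "locally_integrable I u"
  unfolding locally_integrable_def set_integrable_def
proof (intro allI impI)
  fix K assume K: "compact K \<and> K \<subseteq> interior I"
  then have "K \<in> sets lebesgue" "K \<subseteq> I" using interior_subset[of I] lmeasurable_compact by auto
  then have "integrable \<mu> (\<lambda>t. indicator K t *\<^sub>R u t)"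
    using assms I_lebesgue by (intro integrable_mult_indicator) (auto simp: sets_restrict_space_iff)
  then show "integrable lebesgue (\<lambda>t. indicator K t *\<^sub>R u t)"
    using I_lebesgue \<open>K \<subseteq> I\<close> by (subst (asm) integrable_lebesgue_on_supported) (auto simp: indicator_def)
qed

lemma borel_measurable_continuous_\<mu>:
  fixes f :: "real \<Rightarrow> 'b::{banach, second_countable_topology}"
  shows "continuous_on UNIV f \<Longrightarrow> f \<in> borel_measurable \<mu>"
  using I_lebesgue by (meson continuous_imp_measurable_on_sets_lebesgue continuous_on_subset subset_UNIV)

lemma integrable_test_mult:
  assumes \<phi>: "\<phi> \<in> test_fun I" and v: "locally_integrable I v"
  shows "integrable \<mu> (\<lambda>t. \<phi> t *\<^sub>R v t)"
proof -
  let ?K = "closure {t. \<phi> t \<noteq> 0}"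
  obtain C where C: "\<And>t. \<bar>\<phi> t\<bar> \<le> C" using test_fun_bounded[OF \<phi>] by blast
  have int: "integrable \<mu> (\<lambda>t. indicat_real ?K t *\<^sub>R v t)"
    using \<phi> v by (intro locally_integrable_on_compact) (auto simp: test_fun_def)
  have eq: "(\<lambda>t. \<phi> t *\<^sub>R v t) = (\<lambda>t. \<phi> t *\<^sub>R (indicat_real ?K t *\<^sub>R v t))"
  proof
    fix t show "\<phi> t *\<^sub>R v t = \<phi> t *\<^sub>R (indicat_real ?K t *\<^sub>R v t)"
      using closure_subset[of "{t. \<phi> t \<noteq> 0}"] by (cases "\<phi> t = 0") auto
  qed
  show ?thesis
    unfolding eq
  proof (rule Bochner_Integration.integrable_bound)
    show "integrable \<mu> (\<lambda>t. C *\<^sub>R (indicat_real ?K t *\<^sub>R v t))" using int by (rule integrable_scaleR_right)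
    show "(\<lambda>t. \<phi> t *\<^sub>R (indicat_real ?K t *\<^sub>R v t)) \<in> borel_measurable \<mu>"
      by (rule borel_measurable_scaleR[OF borel_measurable_continuous_\<mu>[OF test_fun_continuous[OF \<phi>]]
            borel_measurable_integrable[OF int]])
    have "norm (\<phi> t *\<^sub>R x) \<le> norm (C *\<^sub>R x)" for t and x :: 'a
      using C[of t] by (simp add: mult_right_mono)
    then show "AE t in \<mu>. norm (\<phi> t *\<^sub>R (indicat_real ?K t *\<^sub>R v t)) \<le> norm (C *\<^sub>R (indicat_real ?K t *\<^sub>R v t))"
      by (intro AE_I2)
  qed
qed

text \<open>Testing with smooth functions that approximate the indicator of the open interval and
  are dominated by that of the closed one gives the claim by dominated convergence.\<close>

lemma integral_interval_zero:
  assumes w: "locally_integrable I w" and zero: "\<And>\<phi>. \<phi> \<in> test_fun I \<Longrightarrow> (LINT t|\<mu>. \<phi> t *\<^sub>R w t) = 0"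
    and cd: "{c..d} \<subseteq> interior I"
  shows "(LINT t:{c<..<d}|lebesgue. w t) = 0"
proof -
  obtain \<phi> :: "nat \<Rightarrow> real \<Rightarrow> real" where \<phi>: "\<And>k. \<phi> k \<in> test_fun I"
    "\<And>k t. \<bar>\<phi> k t\<bar> \<le> indicator {c..d} t" "\<And>t. (\<lambda>k. \<phi> k t) \<longlonglongrightarrow> indicator {c<..<d} t"
    using indicator_test_fun_approximation[OF cd] by blast
  have int: "integrable \<mu> (\<lambda>t. indicat_real {c..d} t *\<^sub>R w t)"
    using w cd by (intro locally_integrable_on_compact) auto
  have "{c<..<d} \<subseteq> {c..d}" by auto
  have "(\<lambda>k. LINT t|\<mu>. \<phi> k t *\<^sub>R w t) \<longlonglongrightarrow> (LINT t|\<mu>. indicat_real {c<..<d} t *\<^sub>R w t)"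
  proof (rule integral_dominated_convergence[where w = "\<lambda>t. norm (indicat_real {c..d} t *\<^sub>R w t)"])
    have "(\<lambda>t. indicat_real {c<..<d} t *\<^sub>R (indicat_real {c..d} t *\<^sub>R w t)) \<in> borel_measurable \<mu>"
      by (intro borel_measurable_scaleR[OF _ borel_measurable_integrable[OF int]]
          measurable_restrict_space1 borel_measurable_indicator) simp
    also have "(\<lambda>t. indicat_real {c<..<d} t *\<^sub>R (indicat_real {c..d} t *\<^sub>R w t)) =
        (\<lambda>t. indicat_real {c<..<d} t *\<^sub>R w t)" by (auto simp: indicator_def)
    finally show "(\<lambda>t. indicat_real {c<..<d} t *\<^sub>R w t) \<in> borel_measurable \<mu>" .
    show "(\<lambda>t. \<phi> k t *\<^sub>R w t) \<in> borel_measurable \<mu>" for k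
      using integrable_test_mult[OF \<phi>(1) w] by auto
    show "integrable \<mu> (\<lambda>t. norm (indicat_real {c..d} t *\<^sub>R w t))" using int by (rule integrable_norm)
    show "AE t in \<mu>. (\<lambda>k. \<phi> k t *\<^sub>R w t) \<longlonglongrightarrow> indicat_real {c<..<d} t *\<^sub>R w t"
      by (intro AE_I2 tendsto_scaleR \<phi>(3) tendsto_const)
    show "AE t in \<mu>. norm (\<phi> k t *\<^sub>R w t) \<le> norm (indicat_real {c..d} t *\<^sub>R w t)" for k
      using \<phi>(2)[of k] by (intro AE_I2) (simp add: mult_right_mono)
  qed
  then have "(LINT t|\<mu>. indicat_real {c<..<d} t *\<^sub>R w t) = 0"
    using zero[OF \<phi>(1)] by (simp add: LIMSEQ_const_iff)
  moreover have "{c<..<d} \<subseteq> I" using cd interior_subset[of I] by force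
  ultimately show ?thesis
    using I_lebesgue by (subst (asm) integral_lebesgue_on_supported)
      (auto simp: set_lebesgue_integral_def indicator_def)
qed

text \<open>Local integrability gives control only on compact subintervals of the interior. On each
  of them w is integrable with zero integral over all measurable sets, hence zero almost everywhere;
  countably many rational subintervals cover the interior.\<close>

lemma fundamental_lemma_variations:
  assumes w: "locally_integrable I w" and zero: "\<And>\<phi>. \<phi> \<in> test_fun I \<Longrightarrow> (LINT t|\<mu>. \<phi> t *\<^sub>R w t) = 0"
  shows "AE t in \<mu>. w t = 0"
proof -
  have on_Icc: "AE t in lebesgue. t \<in> {c..d} \<longrightarrow> w t = 0" if cd: "{c..d} \<subseteq> interior I" "c \<le> d" for c d
  proof -
    let ?f = "\<lambda>t. indicat_real {c<..<d} t *\<^sub>R w t"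
    have "set_integrable lebesgue {c..d} w" using w cd(1) by (simp add: locally_integrable_def)
    then have "set_integrable lebesgue {c<..<d} w" by (rule set_integrable_subset) auto
    then have f: "integrable lebesgue ?f" by (simp add: set_integrable_def)
    have sets: "(LINT t:A|lebesgue. ?f t) = 0" if "A \<in> sets lebesgue" for A
    proof (rule integral_zero_on_rays_imp_zero_on_sets[OF f _ _ that])
      show "integral\<^sup>L lebesgue ?f = 0"
        using integral_interval_zero[OF w zero cd(1)] by (simp add: set_lebesgue_integral_def)
      fix a :: real
      \<comment> \<open>A ray cuts the interval in another interval, so the previous lemma covers
        the generator of the Borel sets.\<close>
      have "(LINT t:{a<..}|lebesgue. ?f t) = (LINT t:{max a c<..<d}|lebesgue. w t)"
        by (auto simp: set_lebesgue_integral_def indicator_def intro!: Bochner_Integration.integral_cong)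
      also have "\<dots> = 0"
        by (rule integral_interval_zero[OF w zero]) (use cd in auto)
      finally show "(LINT t:{a<..}|lebesgue. ?f t) = 0" .
    qed
    have fin: "finite_measure (lebesgue_on {c<..<d})" by (intro finite_measure_lebesgue_on) simp
    then interpret N: finite_measure "lebesgue_on {c<..<d}" .
    have "AE t in lebesgue_on {c<..<d}. ?f t = 0"
    proof (rule N.density_zero)
      show "integrable (lebesgue_on {c<..<d}) ?f"
        using f by (subst integrable_lebesgue_on_supported) auto
      fix A assume "A \<in> sets (lebesgue_on {c<..<d})"
      then have A: "A \<in> sets lebesgue" by (auto simp: sets_restrict_space_iff)
      have "(LINT t:A|lebesgue_on {c<..<d}. ?f t) = (LINT t:A|lebesgue. ?f t)"
        unfolding set_lebesgue_integral_def by (rule integral_lebesgue_on_supported) auto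
      then show "(LINT t:A|lebesgue_on {c<..<d}. ?f t) = 0" using sets[OF A] by simp
    qed
    then have "AE t in lebesgue. t \<in> {c<..<d} \<longrightarrow> ?f t = 0"
      by (subst (asm) AE_restrict_space_iff) auto
    \<comment> \<open>The result so far concerns the open interval; its two endpoints are added as a
      null set.\<close>
    have "{c, d} \<in> null_sets lebesgue"
      by (intro null_sets_completionI countable_imp_null_set_lborel) simp
    from AE_not_in[OF this] \<open>AE t in lebesgue. t \<in> {c<..<d} \<longrightarrow> ?f t = 0\<close> show ?thesis
      by eventually_elim (auto simp: less_le)
  qed
  have "AE t in lebesgue. \<forall>c\<in>\<rat>. \<forall>d\<in>\<rat>. {c..d} \<subseteq> interior I \<longrightarrow> c \<le> d \<longrightarrow> t \<in> {c..d} \<longrightarrow> w t = 0"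
  proof (intro AE_ball_countable' countable_rat)
    fix c d :: real
    show "AE t in lebesgue. {c..d} \<subseteq> interior I \<longrightarrow> c \<le> d \<longrightarrow> t \<in> {c..d} \<longrightarrow> w t = 0"
      using on_Icc[of c d] by (cases "{c..d} \<subseteq> interior I \<and> c \<le> d") auto
  qed
  then have "AE t in \<mu>. \<forall>c\<in>\<rat>. \<forall>d\<in>\<rat>. {c..d} \<subseteq> interior I \<longrightarrow> c \<le> d \<longrightarrow> t \<in> {c..d} \<longrightarrow> w t = 0"
    unfolding AE_\<mu>_iff by eventually_elim blast
  with AE_interior show ?thesis
  proof eventually_elim
    case (elim t)
    obtain e where e: "0 < e" "ball t e \<subseteq> interior I" using elim(1) open_interior openE by blast
    obtain c d where cd: "c \<in> \<rat>" "t - e < c" "c < t" "d \<in> \<rat>" "t < d" "d < t + e"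
      using Rats_dense_in_real[of "t - e" t] Rats_dense_in_real[of t "t + e"] e(1) by auto
    have "{c..d} \<subseteq> ball t e" using cd by (auto simp: dist_real_def)
    then show ?case using elim(2) cd e(2) by (metis atLeastAtMost_iff less_imp_le order_trans subset_trans)
  qed
qed

lemma weak_deriv_unique:
  assumes "has_weak_deriv I u v" "has_weak_deriv I u v'"
  shows "AE t in \<mu>. v t = v' t"
proof -
  have v: "locally_integrable I v" "locally_integrable I v'" using assms by (auto simp: has_weak_deriv_def)
  have "AE t in \<mu>. v t + (- 1) *\<^sub>R v' t = 0"
  proof (rule fundamental_lemma_variations)
    show "locally_integrable I (\<lambda>t. v t + (- 1) *\<^sub>R v' t)"
      by (intro locally_integrable_add locally_integrable_scaleR v)
    fix \<phi> assume \<phi>: "\<phi> \<in> test_fun I"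
    have "(LINT t|\<mu>. \<phi> t *\<^sub>R (v t + (- 1) *\<^sub>R v' t)) = (LINT t|\<mu>. \<phi> t *\<^sub>R v t) - (LINT t|\<mu>. \<phi> t *\<^sub>R v' t)"
      using integrable_test_mult[OF \<phi> v(1)] integrable_test_mult[OF \<phi> v(2)]
      by (simp add: scaleR_diff_right)
    then show "(LINT t|\<mu>. \<phi> t *\<^sub>R (v t + (- 1) *\<^sub>R v' t)) = 0"
      using assms \<phi> unfolding has_weak_deriv_def by (metis (no_types, lifting) neg_equal_iff_equal right_minus_eq)
  qed
  then show ?thesis by simp
qed

text \<open>Since \<open>weak_deriv\<close> is an arbitrary choice among functions equal almost
  everywhere, this is the bridge from it to a derivative that is actually known.\<close>

lemma AE_weak_deriv: "has_weak_deriv I u v \<Longrightarrow> AE t in \<mu>. weak_deriv I u t = v t"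
  unfolding weak_deriv_def by (rule weak_deriv_unique[OF someI[of "has_weak_deriv I u"]])

end

section \<open>Functions with vanishing weak derivative\<close>

lemma continuous_has_antiderivative:
  fixes f :: "real \<Rightarrow> real"
  assumes "continuous_on UNIV f"
  obtains F where "\<And>t. (F has_real_derivative f t) (at t)"
proof -
  have "\<exists>F. \<forall>t. - \<infinity> < ereal t \<longrightarrow> ereal t < \<infinity> \<longrightarrow> (F has_vector_derivative f t) (at t)"
    using assms by (intro einterval_antiderivative) (auto simp: continuous_on_eq_continuous_at)
  then show ?thesis using that by (auto simp: has_real_derivative_iff_has_vector_derivative)
qed

context bounded_interval
begin

text \<open>The compact support has a smallest and a largest element. The zero function has empty
  support, and then a one-point interval in the interior is taken.\<close>

lemma test_fun_support:
  assumes "\<phi> \<in> test_fun I" "interior I \<noteq> {}"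
  obtains a b where "a \<le> b" "{a..b} \<subseteq> interior I" "\<And>t. t \<notin> {a..b} \<Longrightarrow> \<phi> t = 0"
proof -
  let ?K = "closure {t. \<phi> t \<noteq> 0}"
  have K: "compact ?K" "?K \<subseteq> interior I" using assms(1) by (auto simp: test_fun_def)
  show ?thesis
  proof (cases "?K = {}")
    case True
    obtain t0 where "t0 \<in> interior I" using assms(2) by auto
    then show ?thesis using True that[of t0 t0] by auto
  next
    case False
    obtain a where a: "a \<in> ?K" "\<forall>t\<in>?K. a \<le> t" using compact_attains_inf[OF K(1) False] by auto
    obtain b where b: "b \<in> ?K" "\<forall>t\<in>?K. t \<le> b" using compact_attains_sup[OF K(1) False] by auto
    show ?thesis
    proof (rule that)
      show "a \<le> b" using a b by auto
      show "{a..b} \<subseteq> interior I" using a b K(2) by (intro interior_Icc) auto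
      show "\<phi> t = 0" if "t \<notin> {a..b}" for t
        using that a b closure_subset[of "{t. \<phi> t \<noteq> 0}"] by fastforce
    qed
  qed
qed

lemma test_fun_linear:
  assumes "\<phi> \<in> test_fun I" "\<psi> \<in> test_fun I" "interior I \<noteq> {}"
  shows "(\<lambda>t. \<phi> t + c * \<psi> t) \<in> test_fun I"
proof -
  obtain a b where ab: "a \<le> b" "{a..b} \<subseteq> interior I" "\<And>t. t \<notin> {a..b} \<Longrightarrow> \<phi> t = 0"
    using test_fun_support[OF assms(1,3)] by blast
  obtain a' b' where ab': "a' \<le> b'" "{a'..b'} \<subseteq> interior I" "\<And>t. t \<notin> {a'..b'} \<Longrightarrow> \<psi> t = 0"
    using test_fun_support[OF assms(2,3)] by blast
  show ?thesis
  proof (rule test_funI)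
    show "times_differentiable n (\<lambda>t. \<phi> t + c * \<psi> t)" for n
      using assms by (intro times_differentiable_add times_differentiable_mult times_differentiable_const
          test_fun_times_differentiable)
    show "{min a a'..max b b'} \<subseteq> interior I"
      using ab ab' by (intro interior_Icc) (auto simp: min_def max_def)
    show "\<phi> t + c * \<psi> t = 0" if "t \<notin> {min a a'..max b b'}" for t
    proof -
      have "t \<notin> {a..b}" "t \<notin> {a'..b'}" using that by auto
      then show ?thesis using ab(3) ab'(3) by simp
    qed
  qed
qed

lemma integrable_test_fun: "\<phi> \<in> test_fun I \<Longrightarrow> integrable \<mu> \<phi>"
  using integrable_test_mult[of \<phi> "\<lambda>t. 1 :: real"] integrable_imp_locally_integrable[of "\<lambda>t. 1 :: real"] by simp

text \<open>Any antiderivative is constant to the left and to the right of the support, and the two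
  constants agree because the total integral is zero; subtracting the common value gives compact
  support.\<close>

lemma test_fun_antiderivative:
  assumes f: "f \<in> test_fun I" and zero: "integral\<^sup>L \<mu> f = 0" and ne: "interior I \<noteq> {}"
  obtains \<theta> where "\<theta> \<in> test_fun I" "deriv \<theta> = f"
proof -
  obtain a b where ab: "a \<le> b" "{a..b} \<subseteq> interior I" "\<And>t. t \<notin> {a..b} \<Longrightarrow> f t = 0"
    using test_fun_support[OF f ne] by blast
  have cont: "continuous_on UNIV f" by (rule test_fun_continuous[OF f])
  obtain F where F: "\<And>t. (F has_real_derivative f t) (at t)"
    using continuous_has_antiderivative[OF cont] by blast
  have total: "integral\<^sup>L lebesgue f = 0"
    using zero integral_lebesgue_on_supported[OF I_lebesgue, of f] test_fun_outside[OF f] interior_subset by fastforce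
  have eq: "F s = F r" if "r \<le> a" "b \<le> s" for r s
  proof -
    have "f t = 0" if "t \<notin> {r..s}" for t using that \<open>r \<le> a\<close> \<open>b \<le> s\<close> by (intro ab(3)) auto
    then show ?thesis
      using has_derivative_imp_integral_supported[OF F cont, of r s] that ab(1) total by auto
  qed
  define \<theta> where "\<theta> t = F t - F a" for t
  have \<theta>: "(\<theta> has_real_derivative f t) (at t)" for t
    unfolding \<theta>_def using DERIV_diff[OF F DERIV_const] by simp
  show ?thesis
  proof (rule that)
    show "\<theta> \<in> test_fun I"
    proof (rule test_funI[OF _ _ ab(2)])
      show "times_differentiable n \<theta>" for n
        by (cases n) (use \<theta> test_fun_times_differentiable[OF f] in auto)
      show "\<theta> t = 0" if "t \<notin> {a..b}" for t
        using that eq[of t b] eq[of a b] eq[of a t] ab(1) by (auto simp: \<theta>_def not_le)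
    qed
    show "deriv \<theta> = f" using DERIV_imp_deriv[OF \<theta>] by (rule ext)
  qed
qed

lemma test_fun_integral_one:
  assumes ne: "interior I \<noteq> {}"
  obtains \<eta> where "\<eta> \<in> test_fun I" "integral\<^sup>L \<mu> \<eta> = 1"
proof -
  obtain t0 where "t0 \<in> interior I" using ne by auto
  then obtain e where e: "0 < e" "cball t0 e \<subseteq> interior I" using open_interior open_contains_cball by blast
  define c d where "c = t0 - e" and "d = t0 + e"
  have cd: "c < d" "{c..d} \<subseteq> interior I" using e by (auto simp: c_def d_def cball_eq_atLeastAtMost)
  obtain \<beta> where \<beta>: "\<And>n. times_differentiable n \<beta>" "\<And>t. 0 \<le> \<beta> t" "\<And>t. 0 < \<beta> t \<longleftrightarrow> c < t \<and> t < d"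
    using bump_function by blast
  have \<beta>0: "\<beta> t = 0" if "t \<notin> {c..d}" for t using \<beta>(2)[of t] \<beta>(3)[of t] that by force
  have test: "\<beta> \<in> test_fun I" by (rule test_funI[OF \<beta>(1) \<beta>0 cd(2)])
  have cont: "continuous_on UNIV \<beta>" by (rule test_fun_continuous[OF test])
  obtain F where F: "\<And>t. (F has_real_derivative \<beta> t) (at t)"
    using continuous_has_antiderivative[OF cont] by blast
  have "integral\<^sup>L \<mu> \<beta> = integral\<^sup>L lebesgue \<beta>"
    using integral_lebesgue_on_supported[OF I_lebesgue, of \<beta>] test_fun_outside[OF test] interior_subset by blast
  also have "\<dots> = F d - F c"
    using cd(1) \<beta>0 by (intro has_derivative_imp_integral_supported[OF F cont]) auto
  also have "\<dots> > 0"
  proof -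
    have "F c < F d"
    proof (rule DERIV_pos_imp_increasing_open[OF cd(1)])
      show "continuous_on {c..d} F" using F by (meson DERIV_isCont continuous_at_imp_continuous_on)
    qed (use F \<beta>(3) in blast)
    then show ?thesis by simp
  qed
  finally have pos: "0 < integral\<^sup>L \<mu> \<beta>" .
  show ?thesis
  proof (rule that[of "\<lambda>t. 0 + (1 / integral\<^sup>L \<mu> \<beta>) * \<beta> t"])
    have "(\<lambda>t. 0) \<in> test_fun I"
      by (rule test_funI[OF times_differentiable_const _ cd(2)]) simp
    from test_fun_linear[OF this test ne]
    show "(\<lambda>t. 0 + (1 / integral\<^sup>L \<mu> \<beta>) * \<beta> t) \<in> test_fun I" .
    show "integral\<^sup>L \<mu> (\<lambda>t. 0 + (1 / integral\<^sup>L \<mu> \<beta>) * \<beta> t) = 1" using pos by simp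
  qed
qed

text \<open>This is the du Bois-Reymond argument. Fix \<eta> with integral 1. For a test function
  \<phi> with integral m, the difference \<phi> - m \<eta> has integral zero and is the derivative
  of a test function, so testing u with it gives zero. Hence u and the constant x, the integral of
  \<eta> u, act alike on all \<phi>.\<close>

lemma weak_deriv_zero_imp_constant:
  fixes u :: "real \<Rightarrow> 'e::{banach, second_countable_topology}"
  assumes u: "has_weak_deriv I u (\<lambda>t. 0)"
  shows "\<exists>x. AE t in \<mu>. u t = x"
proof (cases "interior I = {}")
  case True
  have "AE t in \<mu>. u t = 0" using AE_interior by eventually_elim (simp add: True)
  then show ?thesis by blast
next
  case ne: False
  obtain \<eta> where \<eta>: "\<eta> \<in> test_fun I" "integral\<^sup>L \<mu> \<eta> = 1" using test_fun_integral_one[OF ne] by blast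
  define x where "x = (LINT t|\<mu>. \<eta> t *\<^sub>R u t)"
  have loc: "locally_integrable I u" using u by (simp add: has_weak_deriv_def)
  have loc_x: "locally_integrable I (\<lambda>t. x)" by (rule integrable_imp_locally_integrable) simp
  have "AE t in \<mu>. u t + (- 1) *\<^sub>R x = 0"
  proof (rule fundamental_lemma_variations)
    show "locally_integrable I (\<lambda>t. u t + (- 1) *\<^sub>R x)"
      by (intro locally_integrable_add locally_integrable_scaleR loc loc_x)
    fix \<phi> assume \<phi>: "\<phi> \<in> test_fun I"
    define m where "m = integral\<^sup>L \<mu> \<phi>"
    have f: "(\<lambda>t. \<phi> t + (- m) * \<eta> t) \<in> test_fun I" by (rule test_fun_linear[OF \<phi> \<eta>(1) ne])
    have "integral\<^sup>L \<mu> (\<lambda>t. \<phi> t + (- m) * \<eta> t) = 0"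
      using integrable_test_fun[OF \<phi>] integrable_test_fun[OF \<eta>(1)] \<eta>(2) by (simp add: m_def)
    then obtain \<theta> where \<theta>: "\<theta> \<in> test_fun I" "deriv \<theta> = (\<lambda>t. \<phi> t + (- m) * \<eta> t)"
      using test_fun_antiderivative[OF f _ ne] by blast
    have int: "integrable \<mu> (\<lambda>t. \<phi> t *\<^sub>R u t)" "integrable \<mu> (\<lambda>t. \<eta> t *\<^sub>R u t)"
      "integrable \<mu> (\<lambda>t. \<phi> t *\<^sub>R x)"
      by (intro integrable_test_mult \<phi> \<eta> loc loc_x)+
    have "(LINT t|\<mu>. deriv \<theta> t *\<^sub>R u t) = 0"
      using u \<theta>(1) by (auto simp: has_weak_deriv_def)
    then have "(LINT t|\<mu>. \<phi> t *\<^sub>R u t - m *\<^sub>R (\<eta> t *\<^sub>R u t)) = 0"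
      unfolding \<theta>(2) by (simp add: scaleR_diff_left)
    then have "(LINT t|\<mu>. \<phi> t *\<^sub>R u t) = m *\<^sub>R x"
      using int by (simp add: x_def del: scaleR_scaleR)
    moreover have "(LINT t|\<mu>. \<phi> t *\<^sub>R x) = m *\<^sub>R x"
      unfolding m_def using integrable_test_fun[OF \<phi>] by (intro integral_scaleR_left) auto
    moreover have "(LINT t|\<mu>. \<phi> t *\<^sub>R (u t + (- 1) *\<^sub>R x)) = (LINT t|\<mu>. \<phi> t *\<^sub>R u t) - (LINT t|\<mu>. \<phi> t *\<^sub>R x)"
      using int by (simp add: scaleR_diff_right)
    ultimately show "(LINT t|\<mu>. \<phi> t *\<^sub>R (u t + (- 1) *\<^sub>R x)) = 0" by simp
  qed
  then show ?thesis by (intro exI[of _ x]) simp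
qed

lemma has_weak_deriv_linear:
  assumes "has_weak_deriv I u v" "has_weak_deriv I u' v'"
  shows "has_weak_deriv I (\<lambda>t. u t + c *\<^sub>R u' t) (\<lambda>t. v t + c *\<^sub>R v' t)"
proof -
  have loc: "locally_integrable I u" "locally_integrable I v" "locally_integrable I u'" "locally_integrable I v'"
    using assms by (auto simp: has_weak_deriv_def)
  have split: "(LINT t|\<mu>. \<psi> t *\<^sub>R (f t + c *\<^sub>R g t)) = (LINT t|\<mu>. \<psi> t *\<^sub>R f t) + c *\<^sub>R (LINT t|\<mu>. \<psi> t *\<^sub>R g t)"
    if "\<psi> \<in> test_fun I" "locally_integrable I f" "locally_integrable I g"
    for \<psi> and f g :: "real \<Rightarrow> 'a"
    using integrable_test_mult[OF that(1,2)] integrable_test_mult[OF that(1,3)]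
    by (simp add: scaleR_add_right scaleR_left_commute[of _ c] del: scaleR_scaleR)
  show ?thesis
    unfolding has_weak_deriv_def
  proof (intro conjI ballI)
    show "locally_integrable I (\<lambda>t. u t + c *\<^sub>R u' t)" "locally_integrable I (\<lambda>t. v t + c *\<^sub>R v' t)"
      by (intro locally_integrable_add locally_integrable_scaleR loc)+
    fix \<phi> assume \<phi>: "\<phi> \<in> test_fun I"
    then have "(LINT t|\<mu>. deriv \<phi> t *\<^sub>R u t) = - (LINT t|\<mu>. \<phi> t *\<^sub>R v t)"
      "(LINT t|\<mu>. deriv \<phi> t *\<^sub>R u' t) = - (LINT t|\<mu>. \<phi> t *\<^sub>R v' t)"
      using assms by (auto simp: has_weak_deriv_def)
    then show "(LINT t|\<mu>. deriv \<phi> t *\<^sub>R (u t + c *\<^sub>R u' t)) = - (LINT t|\<mu>. \<phi> t *\<^sub>R (v t + c *\<^sub>R v' t))"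
      using split[OF deriv_test_fun[OF \<phi>] loc(1,3)] split[OF \<phi> loc(2,4)] by simp
  qed
qed

lemma has_weak_deriv_cong_AE:
  assumes uv: "has_weak_deriv I u v" and eq: "AE t in \<mu>. u t = u' t" "AE t in \<mu>. v t = v' t"
    and loc: "locally_integrable I u'" "locally_integrable I v'"
  shows "has_weak_deriv I u' v'"
  unfolding has_weak_deriv_def
proof (intro conjI ballI loc)
  fix \<phi> assume \<phi>: "\<phi> \<in> test_fun I"
  have cong: "(LINT t|\<mu>. \<psi> t *\<^sub>R f t) = (LINT t|\<mu>. \<psi> t *\<^sub>R g t)"
    if "\<psi> \<in> test_fun I" "locally_integrable I f" "locally_integrable I g" "AE t in \<mu>. f t = g t"
    for \<psi> and f g :: "real \<Rightarrow> 'a"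
    using that(4) integrable_test_mult[OF that(1,2)] integrable_test_mult[OF that(1,3)]
    by (intro integral_cong_AE) auto
  have loc': "locally_integrable I u" "locally_integrable I v" using uv by (auto simp: has_weak_deriv_def)
  show "(LINT t|\<mu>. deriv \<phi> t *\<^sub>R u' t) = - (LINT t|\<mu>. \<phi> t *\<^sub>R v' t)"
    using uv \<phi> cong[OF deriv_test_fun[OF \<phi>] loc'(1) loc(1) eq(1)] cong[OF \<phi> loc'(2) loc(2) eq(2)]
    by (simp add: has_weak_deriv_def)
qed

section \<open>Primitives and their weak derivatives\<close>

text \<open>The integral from the left end of I up to t, with t ranging over the whole line:
  continuity and bounds then need no distinction whether t belongs to I.\<close>

definition primitive :: "(real \<Rightarrow> 'e::{banach, second_countable_topology}) \<Rightarrow> real \<Rightarrow> 'e" where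
  "primitive w t = (LINT s|\<mu>. indicat_real {..t} s *\<^sub>R w s)"

lemma integrable_bounded_measurable:
  fixes w :: "real \<Rightarrow> 'e::{banach, second_countable_topology}"
  assumes "w \<in> bounded_measurable \<mu>"
  shows "integrable \<mu> w"
proof -
  obtain C where "\<And>t. t \<in> I \<Longrightarrow> norm (w t) \<le> C" "w \<in> borel_measurable \<mu>"
    using assms by (auto simp: bounded_measurable_def)
  then show ?thesis by (intro integrable_const_bound[where B = C] AE_I2) auto
qed

lemma indicator_measurable_\<mu>: "A \<in> sets lebesgue \<Longrightarrow> indicat_real A \<in> borel_measurable \<mu>"
  by (intro measurable_restrict_space1 borel_measurable_indicator)

lemma integrable_indicator_scaleR:
  fixes w :: "real \<Rightarrow> 'e::{banach, second_countable_topology}"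
  assumes w: "integrable \<mu> w" and A: "A \<in> sets lebesgue"
  shows "integrable \<mu> (\<lambda>s. indicat_real A s *\<^sub>R w s)"
proof (rule Bochner_Integration.integrable_bound[OF w])
  show "(\<lambda>s. indicat_real A s *\<^sub>R w s) \<in> borel_measurable \<mu>"
    by (rule borel_measurable_scaleR[OF indicator_measurable_\<mu>[OF A] borel_measurable_integrable[OF w]])
qed (auto simp: indicator_def)

lemma norm_primitive_le:
  assumes w: "integrable \<mu> w"
  shows "norm (primitive w t) \<le> (LINT s|\<mu>. norm (w s))"
  unfolding primitive_def
proof (rule order_trans[OF integral_norm_bound integral_mono])
  show "integrable \<mu> (\<lambda>s. norm (indicat_real {..t} s *\<^sub>R w s))"
    by (intro integrable_norm integrable_indicator_scaleR w) simp
qed (use w in \<open>auto simp: indicator_def\<close>)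

lemma primitive_linear:
  assumes "integrable \<mu> w" "integrable \<mu> v"
  shows "primitive (\<lambda>s. w s + c *\<^sub>R v s) t = primitive w t + c *\<^sub>R primitive v t"
  using integrable_indicator_scaleR[OF assms(1), of "{..t}"] integrable_indicator_scaleR[OF assms(2), of "{..t}"]
  by (simp add: primitive_def scaleR_add_right scaleR_left_commute[of _ c] del: scaleR_scaleR)

lemma primitive_apply:
  assumes "integrable \<mu> w"
  shows "blinfun_apply \<xi> (primitive w t) = (LINT s|\<mu>. indicat_real {..t} s * blinfun_apply \<xi> (w s))"
  using integral_bounded_linear[OF blinfun.bounded_linear_right integrable_indicator_scaleR[OF assms, of "{..t}"], of \<xi>]
  by (simp add: primitive_def blinfun.scaleR_right)

lemma primitive_lipschitz:
  assumes w: "w \<in> borel_measurable \<mu>" "\<And>s. s \<in> I \<Longrightarrow> norm (w s) \<le> C" and "0 \<le> C" and "r \<le> t"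
  shows "norm (primitive w t - primitive w r) \<le> C * (t - r)"
proof -
  have int: "integrable \<mu> w" using w by (intro integrable_const_bound[where B = C] AE_I2) auto
  have "primitive w t - primitive w r = (LINT s|\<mu>. indicat_real {..t} s *\<^sub>R w s - indicat_real {..r} s *\<^sub>R w s)"
    using integrable_indicator_scaleR[OF int, of "{..t}"] integrable_indicator_scaleR[OF int, of "{..r}"]
    by (simp add: primitive_def)
  also have "\<dots> = (LINT s|\<mu>. indicat_real {r<..t} s *\<^sub>R w s)"
    using \<open>r \<le> t\<close> by (intro Bochner_Integration.integral_cong) (auto simp: indicator_def)
  also have "norm \<dots> \<le> (LINT s|\<mu>. indicat_real {r<..t} s * C)"
  proof (rule order_trans[OF integral_norm_bound integral_mono])
    show "integrable \<mu> (\<lambda>s. norm (indicat_real {r<..t} s *\<^sub>R w s))"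
      by (intro integrable_norm integrable_indicator_scaleR int) simp
    show "integrable \<mu> (\<lambda>s. indicat_real {r<..t} s * C)"
      using integrable_indicator_scaleR[of "\<lambda>s. C" "{r<..t}"] by simp
    show "norm (indicat_real {r<..t} s *\<^sub>R w s) \<le> indicat_real {r<..t} s * C" if "s \<in> space \<mu>" for s
      using w(2)[of s] that by (auto simp: indicator_def)
  qed
  also have "\<dots> = (LINT s|lebesgue. indicat_real I s *\<^sub>R (indicat_real {r<..t} s * C))"
    by (rule integral_restrict_space) (use I_lebesgue in simp)
  also have "\<dots> \<le> (LINT s|lebesgue. indicat_real {r<..t} s * C)"
  proof (rule integral_mono)
    have *: "integrable lebesgue (indicat_real {r<..t})" by (intro integrable_real_indicator) (use \<open>r \<le> t\<close> in \<open>auto simp: emeasure_completion\<close>)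
    then show **: "integrable lebesgue (\<lambda>s. indicat_real {r<..t} s * C)" by simp
    show "integrable lebesgue (\<lambda>s. indicat_real I s *\<^sub>R (indicat_real {r<..t} s * C))"
      by (rule integrable_mult_indicator[OF I_lebesgue **])
  qed (use \<open>0 \<le> C\<close> in \<open>auto simp: indicator_def\<close>)
  also have "\<dots> = C * (t - r)" using \<open>r \<le> t\<close> by (simp add: measure_completion)
  finally show ?thesis .
qed

lemma continuous_primitive:
  assumes "w \<in> bounded_measurable \<mu>"
  shows "continuous_on UNIV (primitive w)"
proof -
  obtain C where "\<And>s. s \<in> I \<Longrightarrow> norm (w s) \<le> C" and w: "w \<in> borel_measurable \<mu>"
    using assms by (auto simp: bounded_measurable_def)
  then have C: "\<And>s. s \<in> I \<Longrightarrow> norm (w s) \<le> \<bar>C\<bar>" by (meson abs_ge_self order_trans)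
  have "dist (primitive w t) (primitive w r) \<le> \<bar>C\<bar> * dist t r" for t r
    using primitive_lipschitz[OF w C, of r t] primitive_lipschitz[OF w C, of t r]
    by (cases "r \<le> t") (auto simp: dist_norm norm_minus_commute)
  then have "\<bar>C\<bar>-lipschitz_on UNIV (primitive w)" by (intro lipschitz_onI) auto
  then show ?thesis by (rule lipschitz_on_continuous_on)
qed

lemma primitive_bounded_measurable:
  assumes "w \<in> bounded_measurable \<mu>"
  shows "primitive w \<in> bounded_measurable \<mu>"
  by (rule bounded_measurableI[OF borel_measurable_continuous_\<mu>[OF continuous_primitive[OF assms]]
        norm_primitive_le[OF integrable_bounded_measurable[OF assms]]])

text \<open>The inner integral in the Fubini argument below: as a function of t, the indicator
  selects t \<ge> s, and the integral of the derivative from s to beyond the support is 0 -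
  \<phi>(s).\<close>

lemma test_fun_FTC:
  assumes \<phi>: "\<phi> \<in> test_fun I" and "s \<in> I"
  shows "(LINT t|\<mu>. indicat_real {..t} s * deriv \<phi> t) = - \<phi> s"
proof -
  obtain B where B: "\<And>t. t \<in> I \<Longrightarrow> t \<le> B"
    using bounded_imp_bdd_above[OF bdd] unfolding bdd_above_def by blast
  \<comment> \<open>A point to the right of I, where \<phi> is already zero.\<close>
  define T where "T = B + 1"
  have "s \<le> T" using B[OF \<open>s \<in> I\<close>] by (simp add: T_def)
  have outside: "deriv \<phi> t = 0" if "t \<notin> I" for t
    using test_fun_outside[OF deriv_test_fun[OF \<phi>]] that interior_subset by blast
  have "T \<notin> I" using B[of T] by (auto simp: T_def)
  then have "\<phi> T = 0" using test_fun_outside[OF \<phi>] interior_subset by blast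
  have "(LINT t|\<mu>. indicat_real {..t} s * deriv \<phi> t) = (LINT t|lebesgue. indicat_real {..t} s * deriv \<phi> t)"
    using outside by (intro integral_lebesgue_on_supported I_lebesgue) simp
  also have "\<dots> = (LINT t|lebesgue. indicat_real {s..T} t *\<^sub>R deriv \<phi> t)"
  proof (rule Bochner_Integration.integral_cong[OF refl])
    fix t show "indicat_real {..t} s * deriv \<phi> t = indicat_real {s..T} t *\<^sub>R deriv \<phi> t"
      using outside[of t] B[of t] by (cases "t \<in> I") (auto simp: indicator_def T_def)
  qed
  also have "\<dots> = (LINT t|lborel. indicat_real {s..T} t *\<^sub>R deriv \<phi> t)"
  proof (rule integral_completion)
    have "deriv \<phi> \<in> borel_measurable borel"
      by (rule borel_measurable_continuous_onI[OF test_fun_continuous[OF deriv_test_fun[OF \<phi>]]])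
    then show "(\<lambda>t. indicat_real {s..T} t *\<^sub>R deriv \<phi> t) \<in> borel_measurable lborel" by simp
  qed
  also have "\<dots> = \<phi> T - \<phi> s"
  proof (rule integral_FTC_atLeastAtMost[OF \<open>s \<le> T\<close>])
    show "(\<phi> has_vector_derivative deriv \<phi> t) (at t within {s..T})" for t
      using test_fun_DERIV[OF \<phi>, of t]
      by (auto simp: has_real_derivative_iff_has_vector_derivative intro: has_vector_derivative_at_within)
    show "continuous_on {s..T} (deriv \<phi>)" by (rule test_fun_continuous[OF deriv_test_fun[OF \<phi>]])
  qed
  finally show ?thesis using \<open>\<phi> T = 0\<close> by simp
qed

text \<open>Insert the definition of the primitive, exchange the integrals over s and t, and
  evaluate the inner one with \<open>test_fun_FTC\<close>. Fubini applies because the integrand is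
  bounded on a product of finite measures.\<close>

lemma has_weak_deriv_primitive:
  fixes w :: "real \<Rightarrow> 'e::{banach, second_countable_topology}"
  assumes w: "w \<in> bounded_measurable \<mu>"
  shows "has_weak_deriv I (primitive w) w"
  unfolding has_weak_deriv_def
proof (intro conjI ballI)
  show "locally_integrable I (primitive w)"
    by (intro integrable_imp_locally_integrable integrable_bounded_measurable primitive_bounded_measurable w)
  show "locally_integrable I w"
    by (intro integrable_imp_locally_integrable integrable_bounded_measurable w)
  fix \<phi> assume \<phi>: "\<phi> \<in> test_fun I"
  interpret P: pair_sigma_finite \<mu> \<mu> ..
  interpret PP: finite_measure "\<mu> \<Otimes>\<^sub>M \<mu>" by (rule finite_measure_pair_measure) unfold_locales
  obtain C where C: "\<And>s. s \<in> I \<Longrightarrow> norm (w s) \<le> C" and [measurable]: "w \<in> borel_measurable \<mu>"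
    using w by (auto simp: bounded_measurable_def)
  obtain D where D: "\<And>t. \<bar>deriv \<phi> t\<bar> \<le> D" using test_fun_bounded[OF deriv_test_fun[OF \<phi>]] by blast
  have [measurable]: "deriv \<phi> \<in> borel_measurable \<mu>"
    by (rule borel_measurable_continuous_\<mu>[OF test_fun_continuous[OF deriv_test_fun[OF \<phi>]]])
  have [measurable]: "(\<lambda>t. t) \<in> borel_measurable \<mu>"
    by (rule borel_measurable_continuous_\<mu>) (rule continuous_on_id)
  \<comment> \<open>Here the set varies with the second variable, so measurability is reduced to
    comparing the two coordinates.\<close>
  have [measurable]: "(\<lambda>p. indicat_real {..snd p} (fst p)) \<in> borel_measurable (\<mu> \<Otimes>\<^sub>M \<mu>)"
  proof -
    have "(\<lambda>p. indicat_real {..snd p} (fst p)) = (\<lambda>p. if (fst p :: real) \<le> snd p then 1 else 0)"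
      by (auto simp: indicator_def)
    moreover have "(\<lambda>p. fst p) \<in> borel_measurable (\<mu> \<Otimes>\<^sub>M \<mu>)" "(\<lambda>p. snd p) \<in> borel_measurable (\<mu> \<Otimes>\<^sub>M \<mu>)"
      by measurable
    ultimately show ?thesis by (auto intro!: measurable_If borel_measurable_le)
  qed
  let ?f = "\<lambda>s t. (indicat_real {..t} s * deriv \<phi> t) *\<^sub>R w s"
  have "integrable (\<mu> \<Otimes>\<^sub>M \<mu>) (case_prod ?f)"
  proof (rule PP.integrable_const_bound[where B = "D * C"])
    show "case_prod ?f \<in> borel_measurable (\<mu> \<Otimes>\<^sub>M \<mu>)"
      unfolding case_prod_beta by measurable
    show "AE p in \<mu> \<Otimes>\<^sub>M \<mu>. norm (case_prod ?f p) \<le> D * C"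
    proof (rule AE_I2)
      fix p assume "p \<in> space (\<mu> \<Otimes>\<^sub>M \<mu>)"
      then have "fst p \<in> I" by (auto simp: space_pair_measure)
      have "norm (case_prod ?f p) \<le> \<bar>deriv \<phi> (snd p)\<bar> * norm (w (fst p))"
        by (auto simp: case_prod_beta indicator_def)
      also have "\<dots> \<le> D * C" using C[OF \<open>fst p \<in> I\<close>] D[of "snd p"] by (intro mult_mono) auto
      finally show "norm (case_prod ?f p) \<le> D * C" .
    qed
  qed
  from P.Fubini_integral[OF this]
  have "(LINT t|\<mu>. LINT s|\<mu>. ?f s t) = (LINT s|\<mu>. LINT t|\<mu>. ?f s t)" .
  also have "\<dots> = (LINT s|\<mu>. - (\<phi> s *\<^sub>R w s))"
  proof (rule Bochner_Integration.integral_cong[OF refl])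
    fix s assume "s \<in> space \<mu>"
    then have s: "s \<in> I" by simp
    have "(\<lambda>t. indicat_real {..t} s * deriv \<phi> t) = (\<lambda>t. indicat_real {s..} t *\<^sub>R deriv \<phi> t)"
      by (auto simp: indicator_def)
    moreover have "integrable \<mu> \<dots>"
      by (rule integrable_indicator_scaleR[OF integrable_test_fun[OF deriv_test_fun[OF \<phi>]]]) simp
    ultimately have "integrable \<mu> (\<lambda>t. indicat_real {..t} s * deriv \<phi> t)" by simp
    then have "(LINT t|\<mu>. ?f s t) = (LINT t|\<mu>. indicat_real {..t} s * deriv \<phi> t) *\<^sub>R w s"
      by (intro integral_scaleR_left) simp
    then show "(LINT t|\<mu>. ?f s t) = - (\<phi> s *\<^sub>R w s)" using test_fun_FTC[OF \<phi> s] by simp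
  qed
  finally have "(LINT t|\<mu>. LINT s|\<mu>. ?f s t) = - (LINT s|\<mu>. \<phi> s *\<^sub>R w s)" by simp
  moreover have "(LINT s|\<mu>. ?f s t) = deriv \<phi> t *\<^sub>R primitive w t" for t
    unfolding primitive_def using integrable_indicator_scaleR[OF integrable_bounded_measurable[OF w], of "{..t}"]
    by (subst integral_scaleR_right[symmetric]) (auto simp: mult.commute)
  ultimately show "(LINT t|\<mu>. deriv \<phi> t *\<^sub>R primitive w t) = - (LINT t|\<mu>. \<phi> t *\<^sub>R w t)" by simp
qed

text \<open>Subtracting the primitive leaves a function with zero weak derivative. The function w is
  a bounded version of v, since v itself may be unbounded on a null set.\<close>

lemma has_weak_deriv_imp_primitive:
  assumes u: "has_weak_deriv I u v" and w: "w \<in> bounded_measurable \<mu>" and eq: "AE t in \<mu>. v t = w t"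
  obtains x where "AE t in \<mu>. u t = x + primitive w t"
proof -
  have loc: "locally_integrable I u" "locally_integrable I v" using u by (auto simp: has_weak_deriv_def)
  have "has_weak_deriv I (\<lambda>t. u t + (- 1) *\<^sub>R primitive w t) (\<lambda>t. v t + (- 1) *\<^sub>R w t)"
    by (rule has_weak_deriv_linear[OF u has_weak_deriv_primitive[OF w]])
  then have "has_weak_deriv I (\<lambda>t. u t + (- 1) *\<^sub>R primitive w t) (\<lambda>t. 0)"
  proof (rule has_weak_deriv_cong_AE)
    show "locally_integrable I (\<lambda>t. u t + (- 1) *\<^sub>R primitive w t)"
      using has_weak_deriv_primitive[OF w] loc
      by (intro locally_integrable_add locally_integrable_scaleR) (auto simp: has_weak_deriv_def)
    show "locally_integrable I (\<lambda>t. 0 :: 'a)" by (rule integrable_imp_locally_integrable) simp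
  qed (use eq in auto)
  from weak_deriv_zero_imp_constant[OF this] obtain x where "AE t in \<mu>. u t + (- 1) *\<^sub>R primitive w t = x" by blast
  then have "AE t in \<mu>. u t = x + primitive w t" by eventually_elim auto
  then show ?thesis by (rule that)
qed

end

section \<open>Functionals on Sobolev spaces\<close>

lemma Lp_fun_of_nat:
  "1 \<le> n \<Longrightarrow> u \<in> Lp_fun M (of_nat n) \<longleftrightarrow>
    u \<in> borel_measurable M \<and> integrable M (\<lambda>t. norm (u t) powr real n)"
  by (simp add: Lp_fun_def)

lemma Lp_norm_of_nat:
  "1 \<le> n \<Longrightarrow> Lp_norm M (of_nat n) u = (LINT t|M. norm (u t) powr real n) powr (1 / real n)"
  by (simp add: Lp_norm_def)

lemma Lp_fun_infinity_iff:
  "u \<in> Lp_fun M \<infinity> \<longleftrightarrow> u \<in> borel_measurable M \<and> (\<exists>C. AE t in M. norm (u t) \<le> C)"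
proof (intro iffI conjI)
  assume u: "u \<in> Lp_fun M \<infinity>"
  then show "u \<in> borel_measurable M" by (simp add: Lp_fun_def)
  let ?s = "esssup M (\<lambda>t. ennreal (norm (u t)))"
  have "?s < \<infinity>" using u by (simp add: Lp_fun_def)
  then have "?s = ennreal (enn2real ?s)" by (simp add: less_top)
  then have "AE t in M. ennreal (norm (u t)) \<le> ennreal (enn2real ?s)"
    using esssup_AE[of "\<lambda>t. ennreal (norm (u t))" M] by simp
  then have "AE t in M. norm (u t) \<le> enn2real ?s" by eventually_elim simp
  then show "\<exists>C. AE t in M. norm (u t) \<le> C" by blast
next
  assume u: "u \<in> borel_measurable M \<and> (\<exists>C. AE t in M. norm (u t) \<le> C)"
  then obtain C where C: "AE t in M. norm (u t) \<le> C" and [measurable]: "u \<in> borel_measurable M" by blast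
  have "esssup M (\<lambda>t. ennreal (norm (u t))) \<le> ennreal C"
    using C by (intro esssup_I) (auto elim!: eventually_mono intro: ennreal_leI)
  also have "\<dots> < \<infinity>" by simp
  finally show "u \<in> Lp_fun M \<infinity>" by (simp add: Lp_fun_def)
qed

lemma Lp_norm_infinity_le:
  assumes [measurable]: "u \<in> borel_measurable M" and C: "AE t in M. norm (u t) \<le> C" and "0 \<le> C"
  shows "Lp_norm M \<infinity> u \<le> C"
proof -
  have "esssup M (\<lambda>t. ennreal (norm (u t))) \<le> ennreal C"
    using C by (intro esssup_I) (auto elim!: eventually_mono intro: ennreal_leI)
  then show ?thesis using \<open>0 \<le> C\<close> by (simp add: Lp_norm_def enn2real_leI)
qed

lemma AE_le_Lp_norm_infinity:
  assumes u: "u \<in> Lp_fun M \<infinity>"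
  shows "AE t in M. norm (u t) \<le> Lp_norm M \<infinity> u"
proof -
  let ?s = "esssup M (\<lambda>t. ennreal (norm (u t)))"
  have "?s < \<infinity>" using u by (simp add: Lp_fun_def)
  then have "?s = ennreal (enn2real ?s)" by (simp add: less_top)
  then have "AE t in M. ennreal (norm (u t)) \<le> ennreal (enn2real ?s)"
    using esssup_AE[of "\<lambda>t. ennreal (norm (u t))" M] by simp
  then show ?thesis unfolding Lp_norm_def by eventually_elim simp
qed

lemma Lp_norm_nonneg: "0 \<le> Lp_norm M p u"
  by (simp add: Lp_norm_def)

lemma Lp_norm_cong_AE:
  assumes "u \<in> borel_measurable M" "v \<in> borel_measurable M" "AE t in M. u t = v t"
  shows "Lp_norm M p u = Lp_norm M p v"
proof (cases "p = \<infinity>")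
  case True
  have "esssup M (\<lambda>t. ennreal (norm (u t))) = esssup M (\<lambda>t. ennreal (norm (v t)))"
    by (rule esssup_AE_cong) (use assms in \<open>auto elim: eventually_mono\<close>)
  then show ?thesis using True by (simp add: Lp_norm_def)
next
  case False
  have "(LINT t|M. norm (u t) powr enn2real p) = (LINT t|M. norm (v t) powr enn2real p)"
    by (rule integral_cong_AE) (use assms in \<open>auto elim: eventually_mono\<close>)
  then show ?thesis using False by (simp add: Lp_norm_def)
qed

lemma ae_class_cong: "AE t in M. u t = v t \<Longrightarrow> ae_class M u = ae_class M v"
  unfolding ae_class_def by (auto elim: AE_mp)

lemma (in finite_measure) bounded_measurable_Lp_fun:
  fixes u :: "'a \<Rightarrow> 'e::{banach, second_countable_topology}"
  assumes u: "u \<in> bounded_measurable M" and p: "p = \<infinity> \<or> (\<exists>n\<ge>1. p = of_nat n)"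
  shows "u \<in> Lp_fun M p"
proof -
  obtain C where C: "\<And>t. t \<in> space M \<Longrightarrow> norm (u t) \<le> C" and [measurable]: "u \<in> borel_measurable M"
    using u by (auto simp: bounded_measurable_def)
  show ?thesis
  proof (cases "p = \<infinity>")
    case True
    then show ?thesis using C unfolding True Lp_fun_infinity_iff by (auto intro!: exI[of _ C] AE_I2)
  next
    case False
    then obtain n :: nat where n: "1 \<le> n" "p = of_nat n" using p by blast
    have "integrable M (\<lambda>t. norm (u t) powr real n)"
      by (rule integrable_const_bound[where B = "C powr real n"])
        (auto intro!: AE_I2 powr_mono2 C)
    then show ?thesis using n by (simp add: Lp_fun_of_nat)
  qed
qed

lemma (in finite_measure) Lp_norm_tendsto_zero:
  fixes v :: "nat \<Rightarrow> 'a \<Rightarrow> 'e::{banach, second_countable_topology}"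
  assumes v[measurable]: "\<And>k. v k \<in> borel_measurable M" and K: "\<And>k t. t \<in> space M \<Longrightarrow> norm (v k t) \<le> K"
    and lim: "AE t in M. (\<lambda>k. v k t) \<longlonglongrightarrow> 0" and n: "1 \<le> n"
  shows "(\<lambda>k. Lp_norm M (of_nat n) (v k)) \<longlonglongrightarrow> 0"
proof -
  have "(\<lambda>k. LINT t|M. norm (v k t) powr real n) \<longlonglongrightarrow> (LINT t|M. 0)"
  proof (rule integral_dominated_convergence[where w = "\<lambda>t. K powr real n"])
    show "AE t in M. (\<lambda>k. norm (v k t) powr real n) \<longlonglongrightarrow> 0"
      using lim
    proof eventually_elim
      case (elim t)
      then show ?case using n by (intro tendsto_zero_powrI[of _ _ _ "real n"]) (auto simp: tendsto_norm_zero)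
    qed
    show "AE t in M. norm (norm (v k t) powr real n) \<le> K powr real n" for k
      using K by (auto intro!: AE_I2 powr_mono2)
  qed auto
  then have "(\<lambda>k. (LINT t|M. norm (v k t) powr real n) powr (1 / real n)) \<longlonglongrightarrow> 0"
    using n by (intro tendsto_zero_powrI[of _ _ _ "1 / real n"]) auto
  then show ?thesis using n by (simp add: Lp_norm_of_nat)
qed

section \<open>Sobolev norms and functionals on an interval\<close>

context bounded_interval
begin

text \<open>Completeness of Lebesgue measure: every subset of a null set is measurable. It makes the
  arbitrarily chosen \<open>weak_deriv\<close> measurable on I.\<close>

lemma measurable_\<mu>_cong_AE:
  fixes u v :: "real \<Rightarrow> 'e::topological_space"
  assumes v: "v \<in> borel_measurable \<mu>" and eq: "AE t in \<mu>. u t = v t"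
  shows "u \<in> borel_measurable \<mu>"
proof (rule borel_measurableI)
  fix U :: "'e set" assume "open U"
  then have V: "v -` U \<inter> I \<in> sets \<mu>" using measurable_sets[OF v, of U] by simp
  obtain N where N0: "{t \<in> space \<mu>. u t \<noteq> v t} \<subseteq> N" "emeasure \<mu> N = 0" "N \<in> sets \<mu>"
    by (rule AE_E[OF eq])
  then have N: "\<And>t. t \<in> I - N \<Longrightarrow> u t = v t" "N \<in> null_sets \<mu>"
    by (auto simp: null_sets_def)
  have "negligible N"
    using N(2) I_lebesgue by (simp add: negligible_iff_null_sets null_sets_restrict_space)
  then have "negligible (u -` U \<inter> I \<inter> N)" by (rule negligible_subset) auto
  then have "u -` U \<inter> I \<inter> N \<in> sets lebesgue" by (rule negligible_imp_sets)
  then have UN: "u -` U \<inter> I \<inter> N \<in> sets \<mu>" using I_lebesgue by (simp add: sets_restrict_space_iff inf.coboundedI1)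
  have eq_Un: "u -` U \<inter> I = (v -` U \<inter> I - N) \<union> (u -` U \<inter> I \<inter> N)"
  proof (intro set_eqI)
    fix t show "t \<in> u -` U \<inter> I \<longleftrightarrow> t \<in> (v -` U \<inter> I - N) \<union> (u -` U \<inter> I \<inter> N)"
      by (cases "t \<in> I - N") (auto simp: N(1))
  qed
  show "u -` U \<inter> space \<mu> \<in> sets \<mu>"
    unfolding space_lebesgue_on by (subst eq_Un) (rule sets.Un[OF sets.Diff[OF V null_setsD2[OF N(2)]] UN])
qed

lemma weak_deriv_measurable:
  assumes "has_weak_deriv I u v" "v \<in> borel_measurable \<mu>"
  shows "weak_deriv I u \<in> borel_measurable \<mu>"
  by (rule measurable_\<mu>_cong_AE[OF assms(2) AE_weak_deriv[OF assms(1)]])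

lemma Lp_norm_weak_deriv:
  assumes "has_weak_deriv I u v" "v \<in> borel_measurable \<mu>"
  shows "Lp_norm \<mu> p (weak_deriv I u) = Lp_norm \<mu> p v"
  by (rule Lp_norm_cong_AE[OF weak_deriv_measurable[OF assms] assms(2) AE_weak_deriv[OF assms(1)]])

text \<open>The integral is the difference of the values of \<phi> at two points outside its
  support. It is what makes constants have weak derivative zero.\<close>

lemma integral_deriv_test_fun:
  assumes \<phi>: "\<phi> \<in> test_fun I"
  shows "(LINT t|\<mu>. deriv \<phi> t) = 0"
proof (cases "interior I = {}")
  case True
  have "AE t in \<mu>. deriv \<phi> t = 0" using AE_interior by eventually_elim (simp add: True)
  then show ?thesis by (rule integral_eq_zero_AE)
next
  case ne: False
  note d\<phi> = deriv_test_fun[OF \<phi>]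
  obtain a b where ab: "a \<le> b" "\<And>t. t \<notin> {a..b} \<Longrightarrow> \<phi> t = 0"
    by (rule test_fun_support[OF \<phi> ne]) (rule that)
  obtain c d where cd: "c \<le> d" "\<And>t. t \<notin> {c..d} \<Longrightarrow> deriv \<phi> t = 0"
    by (rule test_fun_support[OF d\<phi> ne]) (rule that)
  \<comment> \<open>The margin 1 puts both points strictly outside the supports of \<phi> and of its
    derivative.\<close>
  define l r where "l = min a c - 1" and "r = max b d + 1"
  have "(LINT t|\<mu>. deriv \<phi> t) = (LINT t|lebesgue. deriv \<phi> t)"
    by (rule integral_lebesgue_on_supported[OF I_lebesgue test_fun_outside[OF d\<phi>]])
      (use interior_subset[of I] in auto)
  also have "\<dots> = \<phi> r - \<phi> l"
  proof (rule has_derivative_imp_integral_supported[where F = \<phi> and a = l and b = r])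
    show "(\<phi> has_real_derivative deriv \<phi> t) (at t)" for t by (rule test_fun_DERIV[OF \<phi>])
    show "continuous_on UNIV (deriv \<phi>)" by (rule test_fun_continuous[OF d\<phi>])
    show "l \<le> r" using ab(1) by (simp add: l_def r_def)
    show "deriv \<phi> t = 0" if "t \<notin> {l..r}" for t
      by (rule cd(2)) (use that in \<open>auto simp: l_def r_def\<close>)
  qed
  also have "\<phi> r = 0" by (rule ab(2)) (auto simp: r_def max_def)
  also have "\<phi> l = 0" by (rule ab(2)) (auto simp: l_def min_def)
  finally show ?thesis by simp
qed

lemma has_weak_deriv_const: "has_weak_deriv I (\<lambda>t. x) (\<lambda>t. 0)"
  unfolding has_weak_deriv_def
proof (intro conjI ballI)
  show "locally_integrable I (\<lambda>t. x)" "locally_integrable I (\<lambda>t. 0 :: 'a)"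
    by (rule integrable_imp_locally_integrable, simp)+
  fix \<phi> assume \<phi>: "\<phi> \<in> test_fun I"
  have "(LINT t|\<mu>. deriv \<phi> t *\<^sub>R x) = (LINT t|\<mu>. deriv \<phi> t) *\<^sub>R x"
    using integrable_test_fun[OF deriv_test_fun[OF \<phi>]] by (intro integral_scaleR_left)
  then show "(LINT t|\<mu>. deriv \<phi> t *\<^sub>R x) = - (LINT t|\<mu>. \<phi> t *\<^sub>R 0)"
    by (simp add: integral_deriv_test_fun[OF \<phi>])
qed

lemma has_weak_deriv_const_primitive:
  assumes w: "w \<in> bounded_measurable \<mu>"
  shows "has_weak_deriv I (\<lambda>t. x + primitive w t) w"
  using has_weak_deriv_linear[OF has_weak_deriv_const has_weak_deriv_primitive[OF w], of x 1] by simp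

lemma const_primitive_bounded_measurable:
  "w \<in> bounded_measurable \<mu> \<Longrightarrow> (\<lambda>t. x + primitive w t) \<in> bounded_measurable \<mu>"
  by (intro bounded_measurable_add bounded_measurable_const primitive_bounded_measurable)

lemma bounded_measurable_W1_fun:
  fixes u :: "real \<Rightarrow> 'e::{banach, second_countable_topology}"
  assumes "u \<in> bounded_measurable \<mu>" "w \<in> bounded_measurable \<mu>" "has_weak_deriv I u w"
    and "p = \<infinity> \<or> (\<exists>n\<ge>1. p = of_nat n)"
  shows "u \<in> W1_fun I p"
  using bounded_measurable_Lp_fun[OF assms(1,4)] bounded_measurable_Lp_fun[OF assms(2,4)] assms(3)
  by (auto simp: W1_fun_def)

lemma const_primitive_W1_fun:
  assumes "w \<in> bounded_measurable \<mu>" "p = \<infinity> \<or> (\<exists>n\<ge>1. p = of_nat n)"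
  shows "(\<lambda>t. x + primitive w t) \<in> W1_fun I p"
  by (rule bounded_measurable_W1_fun[OF const_primitive_bounded_measurable[OF assms(1)] assms(1)
        has_weak_deriv_const_primitive[OF assms(1)] assms(2)])

lemma primitive_W1_fun:
  assumes "w \<in> bounded_measurable \<mu>" "p = \<infinity> \<or> (\<exists>n\<ge>1. p = of_nat n)"
  shows "primitive w \<in> W1_fun I p"
  by (rule bounded_measurable_W1_fun[OF primitive_bounded_measurable[OF assms(1)] assms(1)
        has_weak_deriv_primitive[OF assms(1)] assms(2)])

lemma const_W1_fun:
  assumes "p = \<infinity> \<or> (\<exists>n\<ge>1. p = of_nat n)"
  shows "(\<lambda>t. x) \<in> W1_fun I p"
  by (rule bounded_measurable_W1_fun[OF bounded_measurable_const bounded_measurable_const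
        has_weak_deriv_const assms])

lemma W1_norm_has_weak_deriv:
  "has_weak_deriv I u w \<Longrightarrow> w \<in> borel_measurable \<mu> \<Longrightarrow> W1_norm I p u = Lp_norm \<mu> p u + Lp_norm \<mu> p w"
  unfolding W1_norm_def by (simp add: Lp_norm_weak_deriv)

lemma W1_norm_const:
  assumes "1 \<le> n"
  shows "W1_norm I (of_nat n) (\<lambda>t. x) = norm x * measure \<mu> I powr (1 / real n)"
proof -
  have "W1_norm I (of_nat n) (\<lambda>t. x) = Lp_norm \<mu> (of_nat n) (\<lambda>t. x) + Lp_norm \<mu> (of_nat n) (\<lambda>t. 0 :: 'a)"
    by (rule W1_norm_has_weak_deriv[OF has_weak_deriv_const borel_measurable_const])
  also have "\<dots> = (norm x powr real n * measure \<mu> I) powr (1 / real n)"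
    using assms by (simp add: Lp_norm_of_nat mult.commute)
  also have "\<dots> = norm x * measure \<mu> I powr (1 / real n)"
    using assms by (simp add: powr_mult powr_powr)
  finally show ?thesis .
qed

context
  fixes f :: "(real \<Rightarrow> 'e::{banach, second_countable_topology}) set \<Rightarrow> real" and n :: nat
  assumes f: "f \<in> W1_dual I (of_nat n)" and n: "1 \<le> n"
begin

lemma W1_dual_add:
  "u \<in> W1_fun I (of_nat n) \<Longrightarrow> v \<in> W1_fun I (of_nat n) \<Longrightarrow>
    f (ae_class \<mu> (\<lambda>t. u t + v t)) = f (ae_class \<mu> u) + f (ae_class \<mu> v)"
  using f by (simp add: W1_dual_def)

lemma W1_dual_scale:
  "u \<in> W1_fun I (of_nat n) \<Longrightarrow> f (ae_class \<mu> (\<lambda>t. c *\<^sub>R u t)) = c * f (ae_class \<mu> u)"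
  using f by (simp add: W1_dual_def)

lemma W1_dual_bound:
  obtains C where "\<And>u. u \<in> W1_fun I (of_nat n) \<Longrightarrow> \<bar>f (ae_class \<mu> u)\<bar> \<le> C * W1_norm I (of_nat n) u"
proof -
  have "\<exists>C. \<forall>u\<in>W1_fun I (of_nat n). \<bar>f (ae_class \<mu> u)\<bar> \<le> C * W1_norm I (of_nat n) u"
    using f by (simp add: W1_dual_def)
  then show ?thesis using that by blast
qed

text \<open>If w k tends to zero boundedly almost everywhere, so do the primitives, and both norms
  with the finite exponent n tend to zero by dominated convergence. Boundedness of f in that norm
  then gives the continuity required by the locale.\<close>

lemma W1_dual_primitive_continuous: "boundedly_continuous_functional \<mu> (\<lambda>w. f (ae_class \<mu> (primitive w)))"
proof
  have p: "of_nat n = (\<infinity> :: ennreal) \<or> (\<exists>m\<ge>1. of_nat n = (of_nat m :: ennreal))" using n by blast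
  show "f (ae_class \<mu> (primitive (\<lambda>t. w t + v t))) = f (ae_class \<mu> (primitive w)) + f (ae_class \<mu> (primitive v))"
    if w: "w \<in> bounded_measurable \<mu>" and v: "v \<in> bounded_measurable \<mu>" for w v
  proof -
    have "primitive (\<lambda>t. w t + v t) = (\<lambda>t. primitive w t + primitive v t)"
      using primitive_linear[OF integrable_bounded_measurable[OF w] integrable_bounded_measurable[OF v], of 1]
      by (auto simp: fun_eq_iff)
    then show ?thesis using W1_dual_add[OF primitive_W1_fun[OF w p] primitive_W1_fun[OF v p]] by simp
  qed
  show "f (ae_class \<mu> (primitive (\<lambda>t. c *\<^sub>R w t))) = c * f (ae_class \<mu> (primitive w))"
    if w: "w \<in> bounded_measurable \<mu>" for c w
  proof -
    have "primitive (\<lambda>t. c *\<^sub>R w t) = (\<lambda>t. c *\<^sub>R primitive w t)"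
      using primitive_linear[of "\<lambda>t. 0", OF _ integrable_bounded_measurable[OF w], of c]
      by (auto simp: fun_eq_iff primitive_def)
    then show ?thesis using W1_dual_scale[OF primitive_W1_fun[OF w p]] by simp
  qed
  fix w :: "nat \<Rightarrow> real \<Rightarrow> 'e" and K
  assume w: "\<And>k. w k \<in> borel_measurable \<mu>" "\<And>k t. t \<in> space \<mu> \<Longrightarrow> norm (w k t) \<le> K"
    "AE t in \<mu>. (\<lambda>k. w k t) \<longlonglongrightarrow> 0"
  have wb: "w k \<in> bounded_measurable \<mu>" for k by (rule bounded_measurableI[OF w(1,2)])
  obtain C where C: "\<And>u. u \<in> W1_fun I (of_nat n) \<Longrightarrow> \<bar>f (ae_class \<mu> u)\<bar> \<le> C * W1_norm I (of_nat n) u"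
    using W1_dual_bound by blast
  \<comment> \<open>The integral of the norm bounds \<open>primitive (w k) t\<close> for every t at
    once; this yields both the pointwise limit and a common bound for the primitives.\<close>
  have L1: "(\<lambda>k. LINT t|\<mu>. norm (w k t)) \<longlonglongrightarrow> (LINT t|\<mu>. 0)"
  proof (rule integral_dominated_convergence[where w = "\<lambda>t. K"])
    show "AE t in \<mu>. (\<lambda>k. norm (w k t)) \<longlonglongrightarrow> 0" using w(3) by eventually_elim (rule tendsto_norm_zero)
    show "AE t in \<mu>. norm (norm (w k t)) \<le> K" for k using w(2) by (intro AE_I2) simp
  qed (use w(1) in auto)
  have L1_le: "(LINT t|\<mu>. norm (w k t)) \<le> (LINT t|\<mu>. K)" for k
    using w(2) integrable_bounded_measurable[OF wb[of k]] by (intro integral_mono) auto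
  have "(\<lambda>k. Lp_norm \<mu> (of_nat n) (primitive (w k))) \<longlonglongrightarrow> 0"
  proof (rule Lp_norm_tendsto_zero[OF _ _ _ n])
    show "primitive (w k) \<in> borel_measurable \<mu>" for k
      by (rule bounded_measurable_borel[OF primitive_bounded_measurable[OF wb]])
    show "norm (primitive (w k) t) \<le> (LINT t|\<mu>. K)" for k t
      by (rule order_trans[OF norm_primitive_le[OF integrable_bounded_measurable[OF wb]] L1_le])
    have "(\<lambda>k. primitive (w k) t) \<longlonglongrightarrow> 0" for t
      by (rule Lim_null_comparison[OF always_eventually L1[unfolded integral_zero]])
        (blast intro: norm_primitive_le[OF integrable_bounded_measurable[OF wb]])
    then show "AE t in \<mu>. (\<lambda>k. primitive (w k) t) \<longlonglongrightarrow> 0" by simp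
  qed
  moreover have "(\<lambda>k. Lp_norm \<mu> (of_nat n) (w k)) \<longlonglongrightarrow> 0"
    by (rule Lp_norm_tendsto_zero[OF w n])
  ultimately have "(\<lambda>k. C * (Lp_norm \<mu> (of_nat n) (primitive (w k)) + Lp_norm \<mu> (of_nat n) (w k))) \<longlonglongrightarrow> C * (0 + 0)"
    by (intro tendsto_mult tendsto_const tendsto_add)
  then have lim: "(\<lambda>k. C * (Lp_norm \<mu> (of_nat n) (primitive (w k)) + Lp_norm \<mu> (of_nat n) (w k))) \<longlonglongrightarrow> 0" by simp
  have "norm (f (ae_class \<mu> (primitive (w k)))) \<le>
      C * (Lp_norm \<mu> (of_nat n) (primitive (w k)) + Lp_norm \<mu> (of_nat n) (w k))" for k
    using C[OF primitive_W1_fun[OF wb p, of k]] W1_norm_has_weak_deriv[OF has_weak_deriv_primitive[OF wb] w(1), of "of_nat n" k]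
    by simp
  then show "(\<lambda>k. f (ae_class \<mu> (primitive (w k)))) \<longlonglongrightarrow> 0"
    by (intro Lim_null_comparison[OF _ lim] always_eventually allI)
qed

lemma W1_dual_const_functional:
  obtains \<xi> :: "'e \<Rightarrow>\<^sub>L real" where "\<And>x. f (ae_class \<mu> (\<lambda>t. x)) = blinfun_apply \<xi> x"
proof -
  have p: "of_nat n = (\<infinity> :: ennreal) \<or> (\<exists>m\<ge>1. of_nat n = (of_nat m :: ennreal))" using n by blast
  obtain C where C: "\<And>u. u \<in> W1_fun I (of_nat n) \<Longrightarrow> \<bar>f (ae_class \<mu> u)\<bar> \<le> C * W1_norm I (of_nat n) u"
    using W1_dual_bound by blast
  have "bounded_linear (\<lambda>x. f (ae_class \<mu> (\<lambda>t. x)))"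
  proof (rule bounded_linear_intro[where K = "C * measure \<mu> I powr (1 / real n)"])
    show "f (ae_class \<mu> (\<lambda>t. x + y)) = f (ae_class \<mu> (\<lambda>t. x)) + f (ae_class \<mu> (\<lambda>t. y))" for x y
      by (rule W1_dual_add[OF const_W1_fun[OF p] const_W1_fun[OF p]])
    show "f (ae_class \<mu> (\<lambda>t. c *\<^sub>R x)) = c *\<^sub>R f (ae_class \<mu> (\<lambda>t. x))" for c x
      using W1_dual_scale[OF const_W1_fun[OF p]] by simp
    show "norm (f (ae_class \<mu> (\<lambda>t. x))) \<le> norm x * (C * measure \<mu> I powr (1 / real n))" for x
      using C[OF const_W1_fun[OF p, of x]] W1_norm_const[OF n, of x] by (simp add: mult_ac)
  qed
  then show ?thesis using that[of "Blinfun (\<lambda>x. f (ae_class \<mu> (\<lambda>t. x)))"] by (simp add: bounded_linear_Blinfun_apply)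
qed

theorem W1_dual_representation:
  obtains \<xi> :: "'e \<Rightarrow>\<^sub>L real" and h :: "real \<Rightarrow> 'e \<Rightarrow>\<^sub>L real" and G
  where "integrable \<mu> G" "\<And>t. 0 \<le> G t" "\<And>t. norm (h t) \<le> G t"
    "\<And>x. (\<lambda>t. blinfun_apply (h t) x) \<in> borel_measurable \<mu>"
    "\<And>w. w \<in> bounded_measurable \<mu> \<Longrightarrow> integrable \<mu> (\<lambda>t. blinfun_apply (h t) (w t))"
    "\<And>x w. w \<in> bounded_measurable \<mu> \<Longrightarrow>
      f (ae_class \<mu> (\<lambda>t. x + primitive w t)) = blinfun_apply \<xi> x + (LINT t|\<mu>. blinfun_apply (h t) (w t))"
proof -
  have p: "of_nat n = (\<infinity> :: ennreal) \<or> (\<exists>m\<ge>1. of_nat n = (of_nat m :: ennreal))" using n by blast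
  interpret F: boundedly_continuous_functional \<mu> "\<lambda>w. f (ae_class \<mu> (primitive w))"
    by (rule W1_dual_primitive_continuous)
  obtain \<xi> :: "'e \<Rightarrow>\<^sub>L real" where \<xi>: "\<And>x. f (ae_class \<mu> (\<lambda>t. x)) = blinfun_apply \<xi> x"
    using W1_dual_const_functional by blast
  obtain h :: "real \<Rightarrow> 'e \<Rightarrow>\<^sub>L real" and G where h: "integrable \<mu> G" "\<And>t. 0 \<le> G t" "\<And>t. norm (h t) \<le> G t"
    "\<And>x. (\<lambda>t. blinfun_apply (h t) x) \<in> borel_measurable \<mu>"
    "\<And>w. w \<in> bounded_measurable \<mu> \<Longrightarrow> integrable \<mu> (\<lambda>t. blinfun_apply (h t) (w t))"
    "\<And>w. w \<in> bounded_measurable \<mu> \<Longrightarrow> f (ae_class \<mu> (primitive w)) = (LINT t|\<mu>. blinfun_apply (h t) (w t))"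
    by (rule F.dual_representation) blast
  show ?thesis
    by (rule that[OF h(1-5), of \<xi>])
      (use W1_dual_add[OF const_W1_fun[OF p] primitive_W1_fun[OF _ p]] \<xi> h(6) in auto)
qed

end

end

section \<open>Compactness of balls\<close>

text \<open>Expresses a norm bound by countably many evaluations. Sets such as {t. norm (h t - d i)
  \<le> \<delta>} become measurable although h is only measurable after evaluation at
  vectors.\<close>

lemma norm_blinfun_le_iff_dense:
  fixes \<xi> :: "'e::real_normed_vector \<Rightarrow>\<^sub>L real" and e :: "nat \<Rightarrow> 'e"
  assumes dense: "\<And>x \<epsilon>. 0 < \<epsilon> \<Longrightarrow> \<exists>n. dist (e n) x < \<epsilon>" and "0 \<le> r"
  shows "norm \<xi> \<le> r \<longleftrightarrow> (\<forall>j. \<bar>blinfun_apply \<xi> (e j)\<bar> \<le> r * norm (e j))"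
proof
  assume "norm \<xi> \<le> r"
  then show "\<forall>j. \<bar>blinfun_apply \<xi> (e j)\<bar> \<le> r * norm (e j)"
    by (metis mult_right_mono norm_blinfun norm_ge_zero order_trans real_norm_def)
next
  assume *: "\<forall>j. \<bar>blinfun_apply \<xi> (e j)\<bar> \<le> r * norm (e j)"
  have closed: "closed {x. \<bar>blinfun_apply \<xi> x\<bar> \<le> r * norm x}"
    by (intro closed_Collect_le continuous_intros)
  have "closure (range e) = UNIV" using dense by (auto simp: closure_approachable)
  then have "{x. \<bar>blinfun_apply \<xi> x\<bar> \<le> r * norm x} = UNIV"
    using closure_minimal[OF _ closed, of "range e"] * by auto
  then show "norm \<xi> \<le> r" using \<open>0 \<le> r\<close> by (intro norm_blinfun_bound) auto
qed

lemma continuous_on_uniform_approximation: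
  fixes f :: "'a::topological_space \<Rightarrow> real"
  assumes "\<And>e. 0 < e \<Longrightarrow> \<exists>g. continuous_on S g \<and> (\<forall>x\<in>S. \<bar>f x - g x\<bar> \<le> e)"
  shows "continuous_on S f"
proof -
  have "\<exists>g. continuous_on S g \<and> (\<forall>x\<in>S. \<bar>f x - g x\<bar> \<le> 1 / Suc n)" for n by (rule assms) simp
  then obtain g where g: "\<And>n. continuous_on S (g n)" "\<And>n x. x \<in> S \<Longrightarrow> \<bar>f x - g n x\<bar> \<le> 1 / Suc n"
    by metis
  have "uniform_limit S g f sequentially"
  proof (rule uniform_limitI)
    fix e :: real assume "0 < e"
    then obtain N where N: "1 / Suc N < e" using nat_approx_posE by blast
    show "\<forall>\<^sub>F n in sequentially. \<forall>x\<in>S. dist (g n x) (f x) < e"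
    proof (rule eventually_sequentiallyI[of N], intro ballI)
      fix n x assume n: "N \<le> n" and x: "x \<in> S"
      have "1 / Suc n \<le> 1 / Suc N" using n by (simp add: frac_le)
      then show "dist (g n x) (f x) < e" using g(2)[OF x, of n] N by (simp add: dist_real_def abs_minus_commute)
    qed
  qed
  moreover have "\<forall>\<^sub>F n in sequentially. continuous_on S (g n)" using g(1) by simp
  ultimately show ?thesis using uniform_limit_theorem trivial_limit_sequentially by blast
qed

context bounded_interval
begin

lemma sets_Int_atMost: "I \<inter> {..t} \<in> sets \<mu>"
  using I_lebesgue by (auto simp: sets_restrict_space_iff)

lemma primitive_apply_Int:
  assumes "w \<in> bounded_measurable \<mu>"
  shows "blinfun_apply \<xi> (primitive w t) = (LINT s|\<mu>. indicat_real (I \<inter> {..t}) s * blinfun_apply \<xi> (w s))"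
  unfolding primitive_apply[OF integrable_bounded_measurable[OF assms]]
  by (intro Bochner_Integration.integral_cong) (auto simp: indicator_def)

text \<open>Separability of the dual lets countably many \<delta>-balls cover the values of h, so h
  is within \<delta> of a countably valued function; cutting off after N values costs an integral of
  G over a small set. The error is an integral norm of h minus a simple function, hence uniform over
  all w with the same bound R.\<close>

lemma dual_valued_simple_approximation:
  fixes h :: "real \<Rightarrow> 'e::{banach, second_countable_topology} \<Rightarrow>\<^sub>L real"
  assumes reflexive: "reflexive_space TYPE('e)"
    and G: "integrable \<mu> G" "\<And>t. 0 \<le> G t" and h_le: "\<And>t. norm (h t) \<le> G t"
    and meas: "\<And>x. (\<lambda>t. blinfun_apply (h t) x) \<in> borel_measurable \<mu>"
    and int_h: "\<And>w. w \<in> bounded_measurable \<mu> \<Longrightarrow> integrable \<mu> (\<lambda>t. blinfun_apply (h t) (w t))"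
    and \<epsilon>: "0 < \<epsilon>"
  obtains N and d :: "nat \<Rightarrow> 'e \<Rightarrow>\<^sub>L real" and A where "\<And>i. A i \<in> sets \<mu>"
    "\<And>w R. w \<in> bounded_measurable \<mu> \<Longrightarrow> 0 \<le> R \<Longrightarrow> (\<And>t. t \<in> I \<Longrightarrow> norm (w t) \<le> R) \<Longrightarrow>
      \<bar>(LINT t|\<mu>. blinfun_apply (h t) (w t)) - (\<Sum>i<N. LINT t|\<mu>. indicat_real (A i) t * blinfun_apply (d i) (w t))\<bar> \<le> R * \<epsilon>"
proof -
  obtain D :: "('e \<Rightarrow>\<^sub>L real) set" where D: "countable D" "closure D = UNIV"
    using reflexive_separable_dual[OF reflexive] by blast
  have "D \<noteq> {}" using D(2) by auto
  define d where "d = from_nat_into D"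
  have d: "\<exists>i. dist (d i) \<xi> < r" if "0 < r" for \<xi> r
  proof -
    obtain y where "y \<in> D" "dist y \<xi> < r" using D(2) \<open>0 < r\<close> closure_approachable[of \<xi> D] by auto
    then show ?thesis using from_nat_into_surj[OF D(1)] unfolding d_def by metis
  qed
  obtain e :: "nat \<Rightarrow> 'e" where e: "\<And>x r. 0 < r \<Longrightarrow> \<exists>n. dist (e n) x < r"
    using countable_dense_seq by blast
  \<comment> \<open>Half of \<epsilon> is for the distance to the centres integrated over I, half
    for the cut-off; the summand 1 guards against an interval of measure zero.\<close>
  define \<delta> where "\<delta> = \<epsilon> / (2 * (measure \<mu> I + 1))"
  have pos: "0 < measure \<mu> I + 1" using measure_nonneg[of \<mu> I] by linarith
  then have \<delta>: "0 < \<delta>" using \<epsilon> by (simp add: \<delta>_def)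
  have \<delta>_le: "\<delta> * measure \<mu> I \<le> \<epsilon> / 2" using \<epsilon> pos by (simp add: \<delta>_def field_simps)
  define S where "S i = {t \<in> space \<mu>. norm (h t - d i) \<le> \<delta>}" for i
  have S: "S i \<in> sets \<mu>" for i
  proof -
    have "S i = {t \<in> space \<mu>. \<forall>j. \<bar>blinfun_apply (h t) (e j) - blinfun_apply (d i) (e j)\<bar> \<le> \<delta> * norm (e j)}"
      using norm_blinfun_le_iff_dense[OF e less_imp_le[OF \<delta>], of "h t - d i" for t]
      by (simp add: S_def blinfun.diff_left)
    also have "\<dots> \<in> sets \<mu>" using meas by measurable
    finally show ?thesis .
  qed
  have S_UN: "\<exists>i. t \<in> S i" if "t \<in> I" for t
    using d[OF \<delta>, of "h t"] that by (auto simp: S_def dist_norm norm_minus_commute intro: less_imp_le)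
  define A where "A = disjointed S"
  have A: "A i \<in> sets \<mu>" for i
    unfolding A_def using S by (intro sets.range_disjointed_sets'[THEN range_subsetD]) auto
  have A_S: "A i \<subseteq> S i" for i unfolding A_def by (rule disjointed_subset)
  have A_disj: "disjoint_family A" unfolding A_def by (rule disjoint_family_disjointed)
  have A_UN: "(\<Union>i<N. A i) = (\<Union>i<N. S i)" for N
    using finite_UN_disjointed_eq[of S N] by (simp add: A_def atLeast0LessThan)
  \<comment> \<open>What the first N balls miss. These sets eventually leave each point, so the
    integral of G over them vanishes in the limit.\<close>
  define B where "B N = I - (\<Union>i<N. S i)" for N
  have B: "B N \<in> sets \<mu>" for N unfolding B_def using S by (intro sets.Diff sets.finite_UN) auto
  have int_BG: "integrable \<mu> (\<lambda>t. indicat_real (B N) t * G t)" for N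
    using integrable_mult_indicator[OF B G(1)] by simp
  have "(\<lambda>N. LINT t|\<mu>. indicat_real (B N) t * G t) \<longlonglongrightarrow> (LINT t|\<mu>. 0)"
  proof (rule integral_dominated_convergence[OF _ _ G(1)])
    show "(\<lambda>t. indicat_real (B N) t * G t) \<in> borel_measurable \<mu>" for N using int_BG by auto
    show "AE t in \<mu>. norm (indicat_real (B N) t * G t) \<le> G t" for N
      using G(2) by (intro AE_I2) (simp add: indicator_def)
    show "AE t in \<mu>. (\<lambda>N. indicat_real (B N) t * G t) \<longlonglongrightarrow> 0"
    proof (rule AE_I2)
      fix t assume "t \<in> space \<mu>"
      then obtain i where "t \<in> S i" using S_UN by auto
      then have "t \<notin> B N" if "Suc i \<le> N" for N using that by (auto simp: B_def)
      then have "\<forall>\<^sub>F N in sequentially. indicat_real (B N) t * G t = 0"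
        by (intro eventually_sequentiallyI[of "Suc i"]) auto
      then show "(\<lambda>N. indicat_real (B N) t * G t) \<longlonglongrightarrow> 0" by (rule tendsto_eventually)
    qed
  qed simp
  then have "(\<lambda>N. LINT t|\<mu>. indicat_real (B N) t * G t) \<longlonglongrightarrow> 0" by simp
  then have "\<forall>\<^sub>F N in sequentially. (LINT t|\<mu>. indicat_real (B N) t * G t) < \<epsilon> / 2"
    using \<epsilon> by (intro order_tendstoD) auto
  then obtain N where N: "(LINT t|\<mu>. indicat_real (B N) t * G t) < \<epsilon> / 2"
    unfolding eventually_sequentially by blast
  show ?thesis
  proof (rule that[of A d N, OF A])
    fix w :: "real \<Rightarrow> 'e" and R assume w: "w \<in> bounded_measurable \<mu>" "0 \<le> R" "\<And>t. t \<in> I \<Longrightarrow> norm (w t) \<le> R"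
    have int_d: "integrable \<mu> (\<lambda>t. indicat_real (A i) t * blinfun_apply (d i) (w t))" for i
      using integrable_mult_indicator[OF A[of i] integrable_bounded_linear[OF
            blinfun.bounded_linear_right[of "d i"] integrable_bounded_measurable[OF w(1)]]]
      by (simp only: real_scaleR_def)
    \<comment> \<open>On the pieces exactly one term of the sum survives and \<delta> bounds the
      error; on the remainder the sum is zero and G bounds h itself.\<close>
    have ptwise: "\<bar>blinfun_apply (h t) (w t) - (\<Sum>i<N. indicat_real (A i) t * blinfun_apply (d i) (w t))\<bar>
        \<le> R * (\<delta> + indicat_real (B N) t * G t)" if t: "t \<in> I" for t
    proof (cases "t \<in> (\<Union>i<N. A i)")
      case True
      then obtain i where i: "i < N" "t \<in> A i" by auto
      have "indicat_real (A j) t = (if j = i then 1 else 0)" for j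
        using A_disj i(2) by (auto simp: disjoint_family_on_def indicator_def)
      then have "(\<Sum>j<N. indicat_real (A j) t * blinfun_apply (d j) (w t)) = (\<Sum>j<N. if j = i then blinfun_apply (d j) (w t) else 0)"
        by (intro sum.cong) auto
      also have "\<dots> = blinfun_apply (d i) (w t)" using i(1) by simp
      finally have "\<bar>blinfun_apply (h t) (w t) - (\<Sum>j<N. indicat_real (A j) t * blinfun_apply (d j) (w t))\<bar>
          = \<bar>blinfun_apply (h t - d i) (w t)\<bar>" by (simp add: blinfun.diff_left)
      also have "\<dots> \<le> norm (h t - d i) * norm (w t)" using norm_blinfun[of "h t - d i" "w t"] by simp
      also have "\<dots> \<le> \<delta> * R" using A_S[of i] i(2) w(3)[OF t] \<delta> by (intro mult_mono) (auto simp: S_def)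
      also have "\<dots> \<le> R * (\<delta> + indicat_real (B N) t * G t)"
        using G(2)[of t] w(2) by (simp add: algebra_simps indicator_def)
      finally show ?thesis .
    next
      case False
      then have "(\<Sum>i<N. indicat_real (A i) t * blinfun_apply (d i) (w t)) = 0"
        by (intro sum.neutral) auto
      moreover have "t \<in> B N" using False t unfolding B_def A_UN by simp
      moreover have "\<bar>blinfun_apply (h t) (w t)\<bar> \<le> norm (h t) * norm (w t)" using norm_blinfun[of "h t" "w t"] by simp
      moreover have "norm (h t) * norm (w t) \<le> G t * R" using h_le w(3)[OF t] G(2)[of t] by (intro mult_mono) auto
      moreover have "0 \<le> R * \<delta>" using \<delta> w(2) by simp
      ultimately show ?thesis by (simp add: algebra_simps)
    qed
    have "(LINT t|\<mu>. blinfun_apply (h t) (w t)) - (\<Sum>i<N. LINT t|\<mu>. indicat_real (A i) t * blinfun_apply (d i) (w t))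
        = (LINT t|\<mu>. blinfun_apply (h t) (w t) - (\<Sum>i<N. indicat_real (A i) t * blinfun_apply (d i) (w t)))"
      using Bochner_Integration.integral_diff[OF int_h[OF w(1)]
          Bochner_Integration.integrable_sum[of "{..<N}", OF int_d]]
        Bochner_Integration.integral_sum[of "{..<N}", OF int_d] by (simp only:)
    also have "\<bar>\<dots>\<bar> \<le> (LINT t|\<mu>. R * (\<delta> + indicat_real (B N) t * G t))"
      unfolding real_norm_def[symmetric]
    proof (rule order_trans[OF integral_norm_bound integral_mono])
      show "integrable \<mu> (\<lambda>t. norm (blinfun_apply (h t) (w t) - (\<Sum>i<N. indicat_real (A i) t * blinfun_apply (d i) (w t))))"
        using int_d int_h[OF w(1)] by (intro integrable_norm Bochner_Integration.integrable_diff Bochner_Integration.integrable_sum)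
      show "integrable \<mu> (\<lambda>t. R * (\<delta> + indicat_real (B N) t * G t))"
        using int_BG by (intro integrable_mult_right Bochner_Integration.integrable_add) auto
    qed (use ptwise in auto)
    also have "\<dots> = R * (\<delta> * measure \<mu> I + (LINT t|\<mu>. indicat_real (B N) t * G t))"
      using int_BG[of N] by (simp add: mult.commute)
    also have "\<dots> \<le> R * \<epsilon>" using \<delta>_le N w(2) by (intro mult_left_mono) auto
    finally show "\<bar>(LINT t|\<mu>. blinfun_apply (h t) (w t)) - (\<Sum>i<N. LINT t|\<mu>. indicat_real (A i) t * blinfun_apply (d i) (w t))\<bar> \<le> R * \<epsilon>" .
  qed
qed

text \<open>A function \<open>x + primitive w\<close> with essential sup norm at most \<open>\<rho>\<close> and \<open>\<parallel>w\<parallel> \<le> \<sigma>\<close> is recorded by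
  the numbers \<open>\<xi> x\<close> and \<open>\<integral>\<^sub>A \<xi> w\<close>. The constraints on these data are closed conditions on finitely
  many coordinates each, so that they define a compact set.\<close>

definition ball_data :: "real \<Rightarrow>
    ((('e::{banach, second_countable_topology} \<Rightarrow>\<^sub>L real) \<Rightarrow> real) \<times>
     (('e \<Rightarrow>\<^sub>L real) \<times> real set \<Rightarrow> real) \<times> real \<times> real) set" where
  "ball_data R = {k. case k of (X, W, \<rho>, \<sigma>) \<Rightarrow>
     (\<forall>\<xi> \<eta> c. X (\<xi> + c *\<^sub>R \<eta>) = X \<xi> + c * X \<eta>) \<and>
     (\<forall>\<xi> \<eta> c A. A \<in> sets \<mu> \<longrightarrow> W (\<xi> + c *\<^sub>R \<eta>, A) = W (\<xi>, A) + c * W (\<eta>, A)) \<and>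
     (\<forall>\<xi> A B. A \<in> sets \<mu> \<and> B \<in> sets \<mu> \<and> A \<inter> B = {} \<longrightarrow> W (\<xi>, A \<union> B) = W (\<xi>, A) + W (\<xi>, B)) \<and>
     (\<forall>\<xi> A. \<bar>W (\<xi>, A)\<bar> \<le> \<sigma> * norm \<xi> * measure \<mu> A) \<and>
     (\<forall>\<xi> t. t \<in> interior I \<longrightarrow> \<bar>X \<xi> + W (\<xi>, I \<inter> {..t})\<bar> \<le> \<rho> * norm \<xi>) \<and>
     0 \<le> \<rho> \<and> 0 \<le> \<sigma> \<and> \<rho> + \<sigma> \<le> R}"

text \<open>Coordinates are continuous in the product topology, and the premises of the constraints
  concern only indices. The set is thus an intersection of closed conditions, each in finitely many
  coordinates.\<close>

lemma closed_ball_data: "closed (ball_data R)"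
proof -
  have [continuous_intros]: "continuous_on UNIV (\<lambda>k. fst k i)" for i
    by (rule continuous_on_product_then_coordinatewise) (intro continuous_intros)
  have [continuous_intros]: "continuous_on UNIV (\<lambda>k. fst (snd k) i)" for i
    by (rule continuous_on_product_then_coordinatewise) (intro continuous_intros)
  show ?thesis
    unfolding ball_data_def case_prod_beta
    by (intro closed_Collect_conj closed_Collect_all closed_Collect_imp open_Collect_const
        closed_Collect_le closed_Collect_eq continuous_intros)
qed

text \<open>A closed subset of a product of compact intervals. The bound on W is a constraint, but x
  is bounded only indirectly: at some interior t, x plus the primitive is at most \<rho> and the
  primitive at most \<sigma> times the measure of I. Hence the interior has to contain a
  point.\<close>

lemma compact_ball_data:
  assumes ne: "interior I \<noteq> {}"
  shows "compact (ball_data R :: ((('e::{banach, second_countable_topology} \<Rightarrow>\<^sub>L real) \<Rightarrow> real) \<times>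
     (('e \<Rightarrow>\<^sub>L real) \<times> real set \<Rightarrow> real) \<times> real \<times> real) set)"
proof -
  \<comment> \<open>Tychonoff's theorem in the function topology, stated once for both index
    types.\<close>
  have box: "compact (PiE UNIV (\<lambda>i. {- a i..a i}))" for a :: "'i \<Rightarrow> real"
  proof -
    have "compactin (product_topology (\<lambda>i. euclidean) UNIV) (PiE UNIV (\<lambda>i. {- a i..a i}))"
      unfolding compactin_PiE by (simp add: compactin_euclidean_iff)
    then show ?thesis by (simp add: euclidean_product_topology[symmetric] compactin_euclidean_iff[symmetric])
  qed
  let ?m = "measure \<mu> I"
  let ?box = "PiE UNIV (\<lambda>\<xi> :: 'e \<Rightarrow>\<^sub>L real. {- (R * norm \<xi> + R * norm \<xi> * ?m)..R * norm \<xi> + R * norm \<xi> * ?m}) \<times>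
    PiE UNIV (\<lambda>(\<xi> :: 'e \<Rightarrow>\<^sub>L real, A). {- (R * norm \<xi> * measure \<mu> A)..R * norm \<xi> * measure \<mu> A}) \<times> {0..R} \<times> {0..R}"
  have box_compact: "compact ?box"
    unfolding case_prod_beta by (intro compact_Times box compact_Icc)
  have sub: "ball_data R \<subseteq> ?box"
  proof
    fix k :: "(('e \<Rightarrow>\<^sub>L real) \<Rightarrow> real) \<times> (('e \<Rightarrow>\<^sub>L real) \<times> real set \<Rightarrow> real) \<times> real \<times> real"
    assume "k \<in> ball_data R"
    then obtain X W \<rho> \<sigma> where k: "k = (X, W, \<rho>, \<sigma>)"
      and W: "\<And>\<xi> A. \<bar>W (\<xi>, A)\<bar> \<le> \<sigma> * norm \<xi> * measure \<mu> A"
      and XW: "\<And>\<xi> t. t \<in> interior I \<Longrightarrow> \<bar>X \<xi> + W (\<xi>, I \<inter> {..t})\<bar> \<le> \<rho> * norm \<xi>"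
      and \<rho>\<sigma>: "0 \<le> \<rho>" "0 \<le> \<sigma>" "\<rho> + \<sigma> \<le> R"
      by (auto simp: ball_data_def)
    have W_le: "\<bar>W (\<xi>, A)\<bar> \<le> R * norm \<xi> * measure \<mu> A" for \<xi> A
    proof -
      have "\<sigma> * norm \<xi> * measure \<mu> A \<le> R * norm \<xi> * measure \<mu> A"
        using \<rho>\<sigma> by (intro mult_right_mono) auto
      then show ?thesis using W[of \<xi> A] by linarith
    qed
    obtain t where t: "t \<in> interior I" using ne by auto
    have X_box: "X \<xi> \<in> {- (R * norm \<xi> + R * norm \<xi> * ?m)..R * norm \<xi> + R * norm \<xi> * ?m}" for \<xi>
    proof -
      have "R * norm \<xi> * measure \<mu> (I \<inter> {..t}) \<le> R * norm \<xi> * ?m"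
        using \<rho>\<sigma> finite_measure_mono[of "I \<inter> {..t}" I] by (intro mult_left_mono) auto
      moreover have "\<rho> * norm \<xi> \<le> R * norm \<xi>" using \<rho>\<sigma> by (intro mult_right_mono) auto
      ultimately show ?thesis using XW[OF t, of \<xi>] W_le[of \<xi> "I \<inter> {..t}"]
        unfolding atLeastAtMost_iff abs_le_iff by linarith
    qed
    have W_box: "W (\<xi>, A) \<in> {- (R * norm \<xi> * measure \<mu> A)..R * norm \<xi> * measure \<mu> A}" for \<xi> A
      using W_le[of \<xi> A] unfolding atLeastAtMost_iff abs_le_iff by linarith
    show "k \<in> ?box"
      unfolding k
    proof (intro SigmaI PiE_I)
      show "X \<xi> \<in> {- (R * norm \<xi> + R * norm \<xi> * ?m)..R * norm \<xi> + R * norm \<xi> * ?m}" for \<xi>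
        by (rule X_box)
      show "W p \<in> (case p of (\<xi>, A) \<Rightarrow> {- (R * norm \<xi> * measure \<mu> A)..R * norm \<xi> * measure \<mu> A})" for p
        using W_box[of "fst p" "snd p"] unfolding case_prod_beta by (simp only: prod.collapse)
      show "\<rho> \<in> {0..R}" "\<sigma> \<in> {0..R}" using \<rho>\<sigma> by auto
    qed (simp_all only: UNIV_I not_True_eq_False)
  qed
  show ?thesis
    using compact_Int_closed[OF box_compact closed_ball_data[of R]] unfolding Int_absorb1[OF sub] .
qed

section \<open>Functions recovered from their data\<close>

text \<open>For fixed \<xi>, the set function A \<mapsto> W(\<xi>, A) is dominated by a multiple of
  the measure and has a density g(\<xi>) bounded by \<sigma> times the norm of \<xi>. These
  densities are linear in \<xi> almost everywhere, so they assemble to a function H with values in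
  the bidual, which reflexivity identifies with E. The vector x arises likewise from the bounded
  functional X.\<close>

lemma ball_data_representation:
  assumes reflexive: "reflexive_space TYPE('e::{banach, second_countable_topology})"
    and k: "(X :: ('e::{banach, second_countable_topology} \<Rightarrow>\<^sub>L real) \<Rightarrow> real, W, \<rho>, \<sigma>) \<in> ball_data R" and ne: "interior I \<noteq> {}"
  obtains x :: "'e::{banach, second_countable_topology}" and w where "w \<in> bounded_measurable \<mu>" "\<And>\<xi>. X \<xi> = blinfun_apply \<xi> x"
    "\<And>\<xi> A. A \<in> sets \<mu> \<Longrightarrow> W (\<xi>, A) = (LINT t|\<mu>. indicat_real A t * blinfun_apply \<xi> (w t))"
    "\<And>t. norm (w t) \<le> \<sigma>" "\<And>t. t \<in> interior I \<Longrightarrow> norm (x + primitive w t) \<le> \<rho>"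
proof -
  have X_lin: "X (\<xi> + c *\<^sub>R \<eta>) = X \<xi> + c * X \<eta>"
    and W_lin: "A \<in> sets \<mu> \<Longrightarrow> W (\<xi> + c *\<^sub>R \<eta>, A) = W (\<xi>, A) + c * W (\<eta>, A)"
    and W_add: "A \<in> sets \<mu> \<Longrightarrow> B \<in> sets \<mu> \<Longrightarrow> A \<inter> B = {} \<Longrightarrow> W (\<xi>, A \<union> B) = W (\<xi>, A) + W (\<xi>, B)"
    and W_le: "\<bar>W (\<xi>, A)\<bar> \<le> \<sigma> * norm \<xi> * measure \<mu> A"
    and XW: "t \<in> interior I \<Longrightarrow> \<bar>X \<xi> + W (\<xi>, I \<inter> {..t})\<bar> \<le> \<rho> * norm \<xi>"
    and \<rho>\<sigma>: "0 \<le> \<rho>" "0 \<le> \<sigma>" for \<xi> \<eta> c A B t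
    using k by (auto simp: ball_data_def)
  have "\<exists>g. integrable \<mu> g \<and> (\<forall>A\<in>sets \<mu>. (LINT t:A|\<mu>. g t) = W (\<xi>, A))" for \<xi>
  proof -
    have null: "W (\<xi>, A) = 0" if "A \<in> null_sets \<mu>" for A
      using W_le[of \<xi> A] that by (simp add: measure_eq_0_null_sets)
    have cont: "(\<lambda>n. W (\<xi>, A n)) \<longlonglongrightarrow> 0"
      if A: "range A \<subseteq> sets \<mu>" "\<And>t. eventually (\<lambda>n. t \<notin> A n) sequentially" for A :: "nat \<Rightarrow> real set"
    proof -
      have "(\<lambda>n. LINT t|\<mu>. indicat_real (A n) t) \<longlonglongrightarrow> (LINT t|\<mu>. 0)"
      proof (rule integral_dominated_convergence[where w = "\<lambda>t. 1"])
        show "indicat_real (A n) \<in> borel_measurable \<mu>" for n using A(1) by (intro borel_measurable_indicator) auto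
        have "(\<lambda>n. indicat_real (A n) t) \<longlonglongrightarrow> 0" for t
          by (rule tendsto_eventually) (use A(2)[of t] in eventually_elim, simp)
        then show "AE t in \<mu>. (\<lambda>n. indicat_real (A n) t) \<longlonglongrightarrow> 0" by simp
      qed (auto simp: indicator_def)
      moreover have "(LINT t|\<mu>. indicat_real (A n) t) = measure \<mu> (A n)" for n
        using A(1) sets.sets_into_space[of "A n" \<mu>] by (auto simp: Int_absorb2)
      ultimately have "(\<lambda>n. measure \<mu> (A n)) \<longlonglongrightarrow> 0" by simp
      then have "(\<lambda>n. \<sigma> * norm \<xi> * measure \<mu> (A n)) \<longlonglongrightarrow> \<sigma> * norm \<xi> * 0" by (intro tendsto_mult tendsto_const)
      then have lim: "(\<lambda>n. \<sigma> * norm \<xi> * measure \<mu> (A n)) \<longlonglongrightarrow> 0" by simp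
      show ?thesis by (rule Lim_null_comparison[OF always_eventually lim]) (use W_le in simp)
    qed
    have bound: "\<bar>W (\<xi>, A)\<bar> \<le> \<sigma> * norm \<xi> * measure \<mu> I" if "A \<in> sets \<mu>" for A
    proof -
      have "A \<subseteq> I" using sets.sets_into_space[OF that] by simp
      then have "\<sigma> * norm \<xi> * measure \<mu> A \<le> \<sigma> * norm \<xi> * measure \<mu> I"
        using \<rho>\<sigma> by (intro mult_left_mono finite_measure_mono) auto
      then show ?thesis using W_le[of \<xi> A] by linarith
    qed
    obtain g where "integrable \<mu> g" "\<And>A. A \<in> sets \<mu> \<Longrightarrow> (LINT t:A|\<mu>. g t) = W (\<xi>, A)"
      by (rule Radon_Nikodym_signed_set_function[of "\<lambda>A. W (\<xi>, A)", OF W_add null cont bound]) (assumption | blast)+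
    then show ?thesis by blast
  qed
  then obtain g where g: "\<And>\<xi>. integrable \<mu> (g \<xi>)" "\<And>\<xi> A. A \<in> sets \<mu> \<Longrightarrow> (LINT t:A|\<mu>. g \<xi> t) = W (\<xi>, A)"
    by metis
  have si: "set_integrable \<mu> A (g \<xi>)" if "A \<in> sets \<mu>" for A \<xi>
    using integrable_mult_indicator[OF that g(1)] by (simp add: set_integrable_def)
  have g_lin: "AE t in \<mu>. g (\<xi> + c *\<^sub>R \<eta>) t = g \<xi> t + c * g \<eta> t" for \<xi> \<eta> c
  proof (rule density_unique_real)
    show "integrable \<mu> (g (\<xi> + c *\<^sub>R \<eta>))" "integrable \<mu> (\<lambda>t. g \<xi> t + c * g \<eta> t)" using g(1) by auto
    fix A assume A: "A \<in> sets \<mu>"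
    have "(LINT t:A|\<mu>. g \<xi> t + c * g \<eta> t) = (LINT t:A|\<mu>. g \<xi> t) + c * (LINT t:A|\<mu>. g \<eta> t)"
      using si[OF A] by (subst set_integral_add(2)) auto
    then show "(LINT t:A|\<mu>. g (\<xi> + c *\<^sub>R \<eta>) t) = (LINT t:A|\<mu>. g \<xi> t + c * g \<eta> t)"
      using g(2)[OF A] W_lin[OF A] by simp
  qed
  \<comment> \<open>The sign s = 1 or s = -1 gives the two halves of the absolute bound.\<close>
  have g_le: "AE t in \<mu>. s * g \<xi> t \<le> norm \<xi> * \<sigma>" if s: "\<bar>s\<bar> = 1" for \<xi> s
  proof -
    have "AE t in \<mu>. 0 \<le> norm \<xi> * \<sigma> - s * g \<xi> t"
    proof (rule density_nonneg)
      show "integrable \<mu> (\<lambda>t. norm \<xi> * \<sigma> - s * g \<xi> t)" using g(1) by auto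
      fix A assume A: "A \<in> sets \<mu>"
      have "set_integrable \<mu> A (\<lambda>t. norm \<xi> * \<sigma>)"
        using integrable_mult_indicator[OF A, of "\<lambda>t. norm \<xi> * \<sigma>"] by (simp add: set_integrable_def)
      then have "(LINT t:A|\<mu>. norm \<xi> * \<sigma> - s * g \<xi> t) = (LINT t:A|\<mu>. norm \<xi> * \<sigma>) - s * (LINT t:A|\<mu>. g \<xi> t)"
        using si[OF A] by (subst set_integral_diff(2)) auto
      also have "(LINT t:A|\<mu>. norm \<xi> * \<sigma>) = measure \<mu> A * (norm \<xi> * \<sigma>)"
        using A by (subst set_integral_const) (auto simp: emeasure_eq_measure)
      finally show "0 \<le> (LINT t:A|\<mu>. norm \<xi> * \<sigma> - s * g \<xi> t)"
        using W_le[of \<xi> A] s g(2)[OF A, of \<xi>] by (auto simp: abs_if algebra_simps split: if_splits)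
    qed
    then show ?thesis by eventually_elim simp
  qed
  have g_abs: "AE t in \<mu>. \<bar>g \<xi> t\<bar> \<le> norm \<xi> * \<sigma>" for \<xi>
    using g_le[of 1 \<xi>] g_le[of "- 1" \<xi>] by (simp add: abs_le_iff)
  obtain D :: "('e \<Rightarrow>\<^sub>L real) set" where D: "countable D" "closure D = UNIV"
    using reflexive_separable_dual[OF reflexive] by blast
  obtain H :: "real \<Rightarrow> ('e \<Rightarrow>\<^sub>L real) \<Rightarrow>\<^sub>L real" where H: "\<And>t. norm (H t) \<le> \<sigma>"
    "\<And>\<xi>. (\<lambda>t. blinfun_apply (H t) \<xi>) \<in> borel_measurable \<mu>"
    "\<And>\<xi>. AE t in \<mu>. g \<xi> t = blinfun_apply (H t) \<xi>"
    \<comment> \<open>Here the underlying space is the dual of E, whose separability was derived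
      from reflexivity, and the dominating function is the constant \<sigma>. The bound on H
      therefore holds at every t.\<close>
    by (rule dual_valued_density[OF D borel_measurable_integrable[OF g(1)] g_lin g_abs \<rho>\<sigma>(2)]) blast
  have "\<exists>y. \<forall>\<xi>. blinfun_apply (H t) \<xi> = blinfun_apply \<xi> y" for t
    using reflexive_spaceD[OF reflexive, of "H t"] by blast
  then obtain w where w: "\<And>t \<xi>. blinfun_apply (H t) \<xi> = blinfun_apply \<xi> (w t)" by metis
  have w_le: "norm (w t) \<le> \<sigma>" for t
  proof (rule norm_le_by_functionals[OF _ \<rho>\<sigma>(2)])
    fix \<xi> :: "'e \<Rightarrow>\<^sub>L real"
    have "blinfun_apply (H t) \<xi> \<le> norm (H t) * norm \<xi>" using norm_blinfun[of "H t" \<xi>] by simp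
    also have "\<dots> \<le> \<sigma> * norm \<xi>" using H(1)[of t] by (simp add: mult_right_mono)
    finally show "blinfun_apply \<xi> (w t) \<le> \<sigma> * norm \<xi>" by (simp add: w)
  qed
  have w_meas: "w \<in> borel_measurable \<mu>"
    by (rule weakly_measurable_imp_measurable) (use H(2) in \<open>simp add: w\<close>)
  have wb: "w \<in> bounded_measurable \<mu>" by (rule bounded_measurableI[OF w_meas w_le])
  have W_eq: "W (\<xi>, A) = (LINT t|\<mu>. indicat_real A t * blinfun_apply \<xi> (w t))" if A: "A \<in> sets \<mu>" for \<xi> A
  proof -
    have "W (\<xi>, A) = (LINT t|\<mu>. indicat_real A t * g \<xi> t)" using g(2)[OF A] by (simp add: set_lebesgue_integral_def)
    also have "\<dots> = (LINT t|\<mu>. indicat_real A t * blinfun_apply \<xi> (w t))"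
    proof (rule integral_cong_AE)
      show "(\<lambda>t. indicat_real A t * g \<xi> t) \<in> borel_measurable \<mu>"
        using A borel_measurable_integrable[OF g(1)] by measurable
      show "(\<lambda>t. indicat_real A t * blinfun_apply \<xi> (w t)) \<in> borel_measurable \<mu>"
        using A H(2)[of \<xi>] unfolding w by measurable
      show "AE t in \<mu>. indicat_real A t * g \<xi> t = indicat_real A t * blinfun_apply \<xi> (w t)"
        using H(3)[of \<xi>] by eventually_elim (simp add: w)
    qed
    finally show ?thesis .
  qed
  have X0: "X 0 = 0" using X_lin[of 0 1 0] by simp
  obtain t0 where t0: "t0 \<in> interior I" using ne by auto
  have X_bl: "bounded_linear X"
  proof (rule bounded_linear_intro)
    show "X (\<xi> + \<eta>) = X \<xi> + X \<eta>" for \<xi> \<eta> using X_lin[of \<xi> 1 \<eta>] by simp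
    show "X (c *\<^sub>R \<xi>) = c *\<^sub>R X \<xi>" for c \<xi> using X_lin[of 0 c \<xi>] X0 by simp
    \<comment> \<open>The only bound on X available is at an interior point, after removing the
      contribution of W up to that point.\<close>
    show "norm (X \<xi>) \<le> norm \<xi> * (\<rho> + \<sigma> * measure \<mu> (I \<inter> {..t0}))" for \<xi>
      using XW[OF t0, of \<xi>] W_le[of \<xi> "I \<inter> {..t0}"] by (simp add: algebra_simps)
  qed
  obtain x where x: "\<And>\<xi>. X \<xi> = blinfun_apply \<xi> x"
    using reflexive_spaceD[OF reflexive, of "Blinfun X"] X_bl by (auto simp: bounded_linear_Blinfun_apply)
  have "norm (x + primitive w t) \<le> \<rho>" if t: "t \<in> interior I" for t
  proof (rule norm_le_by_functionals[OF _ \<rho>\<sigma>(1)])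
    fix \<xi> :: "'e \<Rightarrow>\<^sub>L real"
    have "blinfun_apply \<xi> (x + primitive w t) = X \<xi> + W (\<xi>, I \<inter> {..t})"
      by (simp add: blinfun.add_right x primitive_apply_Int[OF wb] W_eq sets_Int_atMost)
    then show "blinfun_apply \<xi> (x + primitive w t) \<le> \<rho> * norm \<xi>" using XW[OF t, of \<xi>] by simp
  qed
  then show ?thesis using that[OF wb x W_eq w_le] by blast
qed

end

section \<open>Data of Sobolev functions and the ball as a continuous image\<close>

lemma Lp_fun_infinity_linear:
  fixes u v :: "'a \<Rightarrow> 'e::{banach, second_countable_topology}"
  assumes "u \<in> Lp_fun M \<infinity>" "v \<in> Lp_fun M \<infinity>"
  shows "(\<lambda>t. u t + c *\<^sub>R v t) \<in> Lp_fun M \<infinity>"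
proof -
  obtain C D where C: "AE t in M. norm (u t) \<le> C" and D: "AE t in M. norm (v t) \<le> D"
    and meas: "u \<in> borel_measurable M" "v \<in> borel_measurable M"
    using assms unfolding Lp_fun_infinity_iff by blast
  have "AE t in M. norm (u t + c *\<^sub>R v t) \<le> C + \<bar>c\<bar> * D"
    using C D
  proof eventually_elim
    case (elim t)
    have "norm (u t + c *\<^sub>R v t) \<le> norm (u t) + \<bar>c\<bar> * norm (v t)" using norm_triangle_ineq[of "u t" "c *\<^sub>R v t"] by simp
    also have "\<dots> \<le> C + \<bar>c\<bar> * D" using elim by (intro add_mono mult_left_mono) auto
    finally show ?case .
  qed
  moreover have "(\<lambda>t. u t + c *\<^sub>R v t) \<in> borel_measurable M" using meas by simp
  ultimately show ?thesis unfolding Lp_fun_infinity_iff by blast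
qed

lemma (in finite_measure) Lp_fun_infinity_subset:
  fixes u :: "'a \<Rightarrow> 'e::{banach, second_countable_topology}"
  assumes u: "u \<in> Lp_fun M \<infinity>" and n: "1 \<le> n"
  shows "u \<in> Lp_fun M (of_nat n)"
proof -
  obtain C where C: "AE t in M. norm (u t) \<le> C" and [measurable]: "u \<in> borel_measurable M"
    using u unfolding Lp_fun_infinity_iff by blast
  have "AE t in M. norm (norm (u t) powr real n) \<le> C powr real n"
    using C by eventually_elim (simp add: powr_mono2)
  then have "integrable M (\<lambda>t. norm (u t) powr real n)"
    by (intro integrable_const_bound) auto
  then show ?thesis using n by (simp add: Lp_fun_of_nat)
qed

text \<open>The underlying set of a generated topology is the union of the generators. The balls of
  the zero seminorm are all of \<open>W1 I \<infinity>\<close>, so every class is a point of the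
  T-topology.\<close>

lemma zero_T_seminorm: "(\<lambda>U \<in> W1 I \<infinity>. \<bar>0\<bar>) \<in> T_seminorms I n"
proof -
  have "(\<lambda>U. 0) \<in> W1_dual I (of_nat n)" unfolding W1_dual_def by (auto intro!: exI[of _ 0])
  then show ?thesis unfolding T_seminorms_def mem_Collect_eq by (rule bexI[rotated]) (rule refl)
qed

context bounded_interval
begin

lemma W1_fun_diff:
  fixes u v :: "real \<Rightarrow> 'e::{banach, second_countable_topology}"
  assumes "u \<in> W1_fun I \<infinity>" "v \<in> W1_fun I \<infinity>"
  shows "(\<lambda>t. u t - v t) \<in> W1_fun I \<infinity>"
proof -
  obtain u' v' where "u' \<in> Lp_fun \<mu> \<infinity>" "has_weak_deriv I u u'" "v' \<in> Lp_fun \<mu> \<infinity>" "has_weak_deriv I v v'"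
    and "u \<in> Lp_fun \<mu> \<infinity>" "v \<in> Lp_fun \<mu> \<infinity>"
    using assms by (auto simp: W1_fun_def)
  then have "(\<lambda>t. u t + (- 1) *\<^sub>R v t) \<in> W1_fun I \<infinity>"
    using has_weak_deriv_linear[of u u' v v' "- 1"] Lp_fun_infinity_linear[of u \<mu> v "- 1"]
      Lp_fun_infinity_linear[of u' \<mu> v' "- 1"]
    unfolding W1_fun_def by blast
  then show ?thesis by simp
qed

lemma W1_fun_infinity_subset: "u \<in> W1_fun I \<infinity> \<Longrightarrow> 1 \<le> n \<Longrightarrow> u \<in> W1_fun I (of_nat n)"
  using Lp_fun_infinity_subset unfolding W1_fun_def by blast

lemma W1_dual_diff:
  assumes f: "f \<in> W1_dual I (of_nat n)" "1 \<le> n" and u: "u \<in> W1_fun I \<infinity>" and v: "v \<in> W1_fun I \<infinity>"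
  shows "f (ae_class \<mu> (\<lambda>t. u t - v t)) = f (ae_class \<mu> u) - f (ae_class \<mu> v)"
  using W1_dual_add[OF f W1_fun_infinity_subset[OF W1_fun_diff[OF u v] f(2)] W1_fun_infinity_subset[OF v f(2)]]
  by simp

text \<open>A nonempty open set is not negligible. This turns an essential bound on x plus a
  primitive into the bound at every interior point that \<open>ball_data\<close> demands.\<close>

lemma continuous_AE_le_imp_le_interior:
  fixes g :: "real \<Rightarrow> real"
  assumes cont: "continuous_on UNIV g" and le: "AE t in \<mu>. g t \<le> c" and s: "s \<in> interior I"
  shows "g s \<le> c"
proof (rule ccontr)
  assume "\<not> g s \<le> c"
  let ?U = "interior I \<inter> {t. c < g t}"
  have "open ?U" using open_Collect_less[OF continuous_on_const cont] by (intro open_Int) auto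
  moreover have "s \<in> ?U" using s \<open>\<not> g s \<le> c\<close> by simp
  moreover have "negligible ?U"
  proof -
    have "AE t in lebesgue. t \<in> I \<longrightarrow> g t \<le> c" using le unfolding AE_\<mu>_iff .
    then have "AE t in lebesgue. t \<notin> ?U" by eventually_elim (use interior_subset[of I] in auto)
    moreover have "?U \<in> sets lebesgue" using \<open>open ?U\<close> by (simp add: borel_open sets_completionI_sets)
    ultimately show ?thesis by (simp add: negligible_iff_null_sets AE_iff_null_sets)
  qed
  ultimately show False using open_not_negligible[of ?U] by blast
qed

text \<open>The value 0 on sets that are not measurable is forced: there the measure is 0, and the
  bound on W in \<open>ball_data\<close> is imposed for all sets.\<close>

definition data_of :: "'e::{banach, second_countable_topology} \<Rightarrow> (real \<Rightarrow> 'e) \<Rightarrow> real \<Rightarrow> real \<Rightarrow>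
    (('e \<Rightarrow>\<^sub>L real) \<Rightarrow> real) \<times> (('e \<Rightarrow>\<^sub>L real) \<times> real set \<Rightarrow> real) \<times> real \<times> real" where
  "data_of x w \<rho> \<sigma> = ((\<lambda>\<xi>. blinfun_apply \<xi> x),
     (\<lambda>(\<xi>, A). if A \<in> sets \<mu> then LINT t|\<mu>. indicat_real A t * blinfun_apply \<xi> (w t) else 0), \<rho>, \<sigma>)"

lemma data_of_in_ball_data:
  fixes x :: "'e::{banach, second_countable_topology}"
  assumes w: "w \<in> bounded_measurable \<mu>" and w_le: "\<And>t. t \<in> I \<Longrightarrow> norm (w t) \<le> \<sigma>"
    and u_le: "\<And>t. t \<in> interior I \<Longrightarrow> norm (x + primitive w t) \<le> \<rho>"
    and \<rho>\<sigma>: "0 \<le> \<rho>" "0 \<le> \<sigma>" "\<rho> + \<sigma> \<le> R"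
  shows "data_of x w \<rho> \<sigma> \<in> ball_data R"
proof -
  have int: "integrable \<mu> (\<lambda>t. indicat_real A t * blinfun_apply \<xi> (w t))" if "A \<in> sets \<mu>" for A and \<xi> :: "'e \<Rightarrow>\<^sub>L real"
    using integrable_mult_indicator[OF that integrable_bounded_linear[OF blinfun.bounded_linear_right[of \<xi>]
          integrable_bounded_measurable[OF w]]] by (simp only: real_scaleR_def)
  have blin: "\<bar>blinfun_apply \<xi> y\<bar> \<le> norm y * norm \<xi>" for \<xi> :: "'e \<Rightarrow>\<^sub>L real" and y
    using norm_blinfun[of \<xi> y] by (simp add: mult.commute)
  have lin: "(LINT t|\<mu>. indicat_real A t * blinfun_apply (\<xi> + c *\<^sub>R \<eta>) (w t)) =
      (LINT t|\<mu>. indicat_real A t * blinfun_apply \<xi> (w t)) + c * (LINT t|\<mu>. indicat_real A t * blinfun_apply \<eta> (w t))"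
    if A: "A \<in> sets \<mu>" for A c and \<xi> \<eta> :: "'e \<Rightarrow>\<^sub>L real"
  proof -
    have "(LINT t|\<mu>. indicat_real A t * blinfun_apply (\<xi> + c *\<^sub>R \<eta>) (w t)) =
      (LINT t|\<mu>. indicat_real A t * blinfun_apply \<xi> (w t) + c * (indicat_real A t * blinfun_apply \<eta> (w t)))"
      by (simp add: blinfun.add_left blinfun.scaleR_left algebra_simps)
    then show ?thesis using int[OF A] by simp
  qed
  have add: "(LINT t|\<mu>. indicat_real (A \<union> B) t * blinfun_apply \<xi> (w t)) =
      (LINT t|\<mu>. indicat_real A t * blinfun_apply \<xi> (w t)) + (LINT t|\<mu>. indicat_real B t * blinfun_apply \<xi> (w t))"
    if "A \<in> sets \<mu>" "B \<in> sets \<mu>" "A \<inter> B = {}" for A B and \<xi> :: "'e \<Rightarrow>\<^sub>L real"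
  proof -
    have "(LINT t|\<mu>. indicat_real (A \<union> B) t * blinfun_apply \<xi> (w t)) =
      (LINT t|\<mu>. indicat_real A t * blinfun_apply \<xi> (w t) + indicat_real B t * blinfun_apply \<xi> (w t))"
      by (rule Bochner_Integration.integral_cong[OF refl]) (use that(3) in \<open>auto simp: indicator_def\<close>)
    then show ?thesis using int that by simp
  qed
  have bound: "\<bar>LINT t|\<mu>. indicat_real A t * blinfun_apply \<xi> (w t)\<bar> \<le> \<sigma> * norm \<xi> * measure \<mu> A"
    if A: "A \<in> sets \<mu>" for A and \<xi> :: "'e \<Rightarrow>\<^sub>L real"
  proof -
    have "\<bar>LINT t|\<mu>. indicat_real A t * blinfun_apply \<xi> (w t)\<bar> \<le> (LINT t|\<mu>. indicat_real A t * (\<sigma> * norm \<xi>))"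
      unfolding real_norm_def[symmetric]
    proof (rule order_trans[OF integral_norm_bound integral_mono])
      show "integrable \<mu> (\<lambda>t. norm (indicat_real A t * blinfun_apply \<xi> (w t)))" using int[OF A] by (rule integrable_norm)
      show "integrable \<mu> (\<lambda>t. indicat_real A t * (\<sigma> * norm \<xi>))"
        using A by (intro integrable_mult_left integrable_real_indicator) (auto simp: emeasure_eq_measure)
      fix t assume "t \<in> space \<mu>"
      then have "\<bar>blinfun_apply \<xi> (w t)\<bar> \<le> \<sigma> * norm \<xi>"
        using blin[of \<xi> "w t"] mult_right_mono[OF w_le[of t] norm_ge_zero[of \<xi>]] by simp
      then show "norm (indicat_real A t * blinfun_apply \<xi> (w t)) \<le> indicat_real A t * (\<sigma> * norm \<xi>)"
        by (simp add: indicator_def)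
    qed
    also have "\<dots> = \<sigma> * norm \<xi> * measure \<mu> A"
      using sets.sets_into_space[OF A] by (simp add: Int_absorb2)
    finally show ?thesis .
  qed
  have "\<bar>blinfun_apply \<xi> x + (LINT s|\<mu>. indicat_real (I \<inter> {..t}) s * blinfun_apply \<xi> (w s))\<bar> \<le> \<rho> * norm \<xi>"
    if t: "t \<in> interior I" for t and \<xi> :: "'e \<Rightarrow>\<^sub>L real"
    using blin[of \<xi> "x + primitive w t"] mult_right_mono[OF u_le[OF t] norm_ge_zero[of \<xi>]]
    by (simp add: blinfun.add_right primitive_apply_Int[OF w])
  then show ?thesis
    using lin add bound \<rho>\<sigma>
    by (simp add: ball_data_def data_of_def sets_Int_atMost blinfun.add_left blinfun.scaleR_left measure_notin_sets)
      (blast intro: sets.Un)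
qed

text \<open>The essential bounds become bounds everywhere: for the derivative by redefining it on a
  null set, for the function by continuity of its primitive representation.\<close>

lemma W1_fun_infinity_representation:
  fixes u :: "real \<Rightarrow> 'e::{banach, second_countable_topology}"
  assumes u: "u \<in> W1_fun I \<infinity>"
  obtains x w where "w \<in> bounded_measurable \<mu>" "AE t in \<mu>. u t = x + primitive w t"
    "\<And>t. norm (w t) \<le> Lp_norm \<mu> \<infinity> (weak_deriv I u)"
    "\<And>t. t \<in> interior I \<Longrightarrow> norm (x + primitive w t) \<le> Lp_norm \<mu> \<infinity> u"
proof -
  obtain v where v: "v \<in> Lp_fun \<mu> \<infinity>" "has_weak_deriv I u v" and uL: "u \<in> Lp_fun \<mu> \<infinity>"
    using u by (auto simp: W1_fun_def)
  have v_meas: "v \<in> borel_measurable \<mu>" using v(1) by (simp add: Lp_fun_def)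
  let ?\<sigma> = "Lp_norm \<mu> \<infinity> (weak_deriv I u)"
  have \<sigma>: "?\<sigma> = Lp_norm \<mu> \<infinity> v" by (rule Lp_norm_weak_deriv[OF v(2) v_meas])
  \<comment> \<open>Replaces v by 0 on the null set where it exceeds its essential supremum.\<close>
  define w where "w t = (if norm (v t) \<le> ?\<sigma> then v t else 0)" for t
  have w_le: "norm (w t) \<le> ?\<sigma>" for t using Lp_norm_nonneg[of \<mu> \<infinity> "weak_deriv I u"] by (simp add: w_def)
  have "w \<in> borel_measurable \<mu>" unfolding w_def using v_meas by measurable
  then have wb: "w \<in> bounded_measurable \<mu>" using w_le by (rule bounded_measurableI)
  have "AE t in \<mu>. v t = w t"
    using AE_le_Lp_norm_infinity[OF v(1)] by eventually_elim (simp only: w_def \<sigma> if_True)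
  then obtain x where x: "AE t in \<mu>. u t = x + primitive w t"
    using has_weak_deriv_imp_primitive[OF v(2) wb] by blast
  have "norm (x + primitive w t) \<le> Lp_norm \<mu> \<infinity> u" if t: "t \<in> interior I" for t
  proof (rule continuous_AE_le_imp_le_interior[OF _ _ t])
    show "continuous_on UNIV (\<lambda>t. norm (x + primitive w t))"
      by (intro continuous_intros continuous_primitive[OF wb])
    show "AE t in \<mu>. norm (x + primitive w t) \<le> Lp_norm \<mu> \<infinity> u"
      using x AE_le_Lp_norm_infinity[OF uL] by eventually_elim simp
  qed
  then show ?thesis using that[OF wb x w_le] by blast
qed

text \<open>The data determine w only almost everywhere, but x plus the primitive at every point:
  evaluating it by \<xi> involves just the set of points of I up to t.\<close>

lemma const_primitive_eqI:
  fixes x x' :: "'e::{banach, second_countable_topology}"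
  assumes w: "w \<in> bounded_measurable \<mu>" "w' \<in> bounded_measurable \<mu>"
    and x: "\<And>\<xi> :: 'e \<Rightarrow>\<^sub>L real. blinfun_apply \<xi> x = blinfun_apply \<xi> x'"
    and eq: "\<And>(\<xi> :: 'e \<Rightarrow>\<^sub>L real) A. A \<in> sets \<mu> \<Longrightarrow>
      (LINT t|\<mu>. indicat_real A t * blinfun_apply \<xi> (w t)) = (LINT t|\<mu>. indicat_real A t * blinfun_apply \<xi> (w' t))"
  shows "x + primitive w t = x' + primitive w' t"
  by (rule functionals_separate_points)
    (simp add: blinfun.add_right primitive_apply_Int[OF w(1)] primitive_apply_Int[OF w(2)] x eq[OF sets_Int_atMost])

theorem compact_W1_cball:
  assumes reflexive: "reflexive_space TYPE('e::{banach, second_countable_topology})" and ne: "interior I \<noteq> {}"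
    and R: "0 \<le> R"
  shows "compactin (T_topology I) (W1_cball I \<infinity> R :: (real \<Rightarrow> 'e::{banach, second_countable_topology}) set set)"
proof -
  let ?K = "ball_data R :: ((('e \<Rightarrow>\<^sub>L real) \<Rightarrow> real) \<times> (('e \<Rightarrow>\<^sub>L real) \<times> real set \<Rightarrow> real) \<times> real \<times> real) set"
  define represents where "represents k p \<longleftrightarrow> snd p \<in> bounded_measurable \<mu> \<and>
      (\<forall>\<xi> :: 'e \<Rightarrow>\<^sub>L real. fst k \<xi> = blinfun_apply \<xi> (fst p)) \<and>
      (\<forall>(\<xi> :: 'e \<Rightarrow>\<^sub>L real) A. A \<in> sets \<mu> \<longrightarrow> fst (snd k) (\<xi>, A) = (LINT t|\<mu>. indicat_real A t * blinfun_apply \<xi> (snd p t))) \<and>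
      (\<forall>t. norm (snd p t) \<le> snd (snd (snd k))) \<and>
      (\<forall>t. t \<in> interior I \<longrightarrow> norm (fst p + primitive (snd p) t) \<le> fst (snd (snd k)))"
    for k and p :: "'e \<times> (real \<Rightarrow> 'e)"
  have ex: "\<exists>p. represents k p" if K: "k \<in> ?K" for k
  proof -
    obtain X W \<rho> \<sigma> where k: "k = (X, W, \<rho>, \<sigma>)" by (cases k)
    show ?thesis
    proof (rule ball_data_representation[OF reflexive K[unfolded k] ne])
      fix x :: 'e and w assume r: "w \<in> bounded_measurable \<mu>" "\<And>\<xi>. X \<xi> = blinfun_apply \<xi> x"
        "\<And>\<xi> A. A \<in> sets \<mu> \<Longrightarrow> W (\<xi>, A) = (LINT t|\<mu>. indicat_real A t * blinfun_apply \<xi> (w t))"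
        "\<And>t. norm (w t) \<le> \<sigma>" "\<And>t. t \<in> interior I \<Longrightarrow> norm (x + primitive w t) \<le> \<rho>"
      have "represents k (x, w)"
        unfolding represents_def k fst_conv snd_conv by (intro conjI allI impI r)
      then show ?thesis by (rule exI)
    qed
  qed
  \<comment> \<open>One representing pair is chosen for each k. Continuity of the resulting map is
    not affected by the choice, since functionals are expressed through the coordinates of
    k.\<close>
  define r where "r k = (SOME p. represents k p)" for k
  have rep: "represents k (r k)" if "k \<in> ?K" for k
    unfolding r_def by (rule someI_ex[OF ex[OF that]])
  define x where "x k = fst (r k)" for k
  define w where "w k = snd (r k)" for k
  have w: "w k \<in> bounded_measurable \<mu>"
    and X_eq: "fst k \<xi> = blinfun_apply \<xi> (x k)"
    and W_eq: "A \<in> sets \<mu> \<Longrightarrow> fst (snd k) (\<xi>, A) = (LINT t|\<mu>. indicat_real A t * blinfun_apply \<xi> (w k t))"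
    and w_le: "norm (w k t) \<le> snd (snd (snd k))"
    and u_le: "t \<in> interior I \<Longrightarrow> norm (x k + primitive (w k) t) \<le> fst (snd (snd k))"
    if "k \<in> ?K" for k \<xi> A t
    using rep[OF that] unfolding represents_def x_def w_def by simp_all
  have \<rho>\<sigma>: "0 \<le> fst (snd (snd k))" "0 \<le> snd (snd (snd k))" "fst (snd (snd k)) + snd (snd (snd k)) \<le> R"
    if "k \<in> ?K" for k
    using that unfolding ball_data_def case_prod_beta mem_Collect_eq by simp_all
  define u where "u k t = x k + primitive (w k) t" for k t
  define \<Phi> where "\<Phi> k = ae_class \<mu> (u k)" for k
  have u_W1: "u k \<in> W1_fun I \<infinity>" if "k \<in> ?K" for k
    unfolding u_def by (rule const_primitive_W1_fun[OF w[OF that]]) simp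
  have u_meas: "u k \<in> borel_measurable \<mu>" if "k \<in> ?K" for k
    unfolding u_def by (rule bounded_measurable_borel[OF const_primitive_bounded_measurable[OF w[OF that]]])
  have cont_f: "continuous_on ?K (\<lambda>k. f (\<Phi> k))" if f: "f \<in> W1_dual I (of_nat n)" "1 \<le> n" for f n
  proof -
    show ?thesis
    proof (rule W1_dual_representation[OF f])
      fix \<xi> :: "'e \<Rightarrow>\<^sub>L real" and h :: "real \<Rightarrow> 'e \<Rightarrow>\<^sub>L real" and G
      assume G: "integrable \<mu> G" "\<And>t. 0 \<le> G t" and h_le: "\<And>t. norm (h t) \<le> G t"
        and h_meas: "\<And>x. (\<lambda>t. blinfun_apply (h t) x) \<in> borel_measurable \<mu>"
        and h_int: "\<And>w. w \<in> bounded_measurable \<mu> \<Longrightarrow> integrable \<mu> (\<lambda>t. blinfun_apply (h t) (w t))"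
        and f_eq: "\<And>x w. w \<in> bounded_measurable \<mu> \<Longrightarrow>
          f (ae_class \<mu> (\<lambda>t. x + primitive w t)) = blinfun_apply \<xi> x + (LINT t|\<mu>. blinfun_apply (h t) (w t))"
      show ?thesis
      proof (rule continuous_on_uniform_approximation)
        fix e :: real assume e: "0 < e"
        \<comment> \<open>The approximation error is R times this quantity, since \<sigma> \<le> R
          bounds w for all k at once; the summand 1 covers R = 0.\<close>
        have e': "0 < e / (R + 1)" using e R by simp
        show "\<exists>g. continuous_on ?K g \<and> (\<forall>k\<in>?K. \<bar>f (\<Phi> k) - g k\<bar> \<le> e)"
        proof (rule dual_valued_simple_approximation[OF reflexive G h_le h_meas h_int e'])
          fix N and d :: "nat \<Rightarrow> 'e \<Rightarrow>\<^sub>L real" and A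
          assume A: "\<And>i. A i \<in> sets \<mu>"
            and approx: "\<And>w R'. w \<in> bounded_measurable \<mu> \<Longrightarrow> 0 \<le> R' \<Longrightarrow> (\<And>t. t \<in> I \<Longrightarrow> norm (w t) \<le> R') \<Longrightarrow>
              \<bar>(LINT t|\<mu>. blinfun_apply (h t) (w t)) -
                (\<Sum>i<N. LINT t|\<mu>. indicat_real (A i) t * blinfun_apply (d i) (w t))\<bar> \<le> R' * (e / (R + 1))"
          \<comment> \<open>The approximant uses finitely many coordinates of k and is therefore
            continuous in the product topology.\<close>
          let ?g = "\<lambda>k. fst k \<xi> + (\<Sum>i<N. fst (snd k) (d i, A i))"
          have "continuous_on ?K ?g"
            by (intro continuous_on_add continuous_on_sum
                continuous_on_product_then_coordinatewise[OF continuous_on_fst[OF continuous_on_id]]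
                continuous_on_product_then_coordinatewise[OF continuous_on_fst[OF continuous_on_snd[OF continuous_on_id]]])
          moreover have "\<bar>f (\<Phi> k) - ?g k\<bar> \<le> e" if k: "k \<in> ?K" for k
          proof -
            have "norm (w k t) \<le> R" for t using w_le[OF k, of t] \<rho>\<sigma>[OF k] by linarith
            then have "\<bar>(LINT t|\<mu>. blinfun_apply (h t) (w k t)) - (\<Sum>i<N. fst (snd k) (d i, A i))\<bar> \<le> R * (e / (R + 1))"
              unfolding W_eq[OF k A] by (intro approx w k R)
            also have "\<dots> \<le> e" using e R by (simp add: field_simps)
            finally show ?thesis
              by (simp add: \<Phi>_def u_def[abs_def] f_eq[OF w[OF k]] X_eq[OF k])
          qed
          ultimately show ?thesis by (intro exI[of _ ?g] conjI ballI)
        qed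
      qed
    qed
  qed
  have cont: "continuous_map (top_of_set ?K) (T_topology I) \<Phi>"
    unfolding T_topology_def W1_seminorm_topology_def
  proof (rule continuous_on_generated_topo)
    let ?balls = "{ae_class \<mu> ` {v \<in> W1_fun I \<infinity>. \<rho> (ae_class \<mu> (\<lambda>t. v t - u t)) < \<epsilon>}
      | \<rho> (u :: real \<Rightarrow> 'e) \<epsilon>. \<rho> \<in> (\<Union>n\<in>{2..}. T_seminorms I n) \<and> u \<in> W1_fun I \<infinity> \<and> 0 < \<epsilon>}"
    fix U assume "U \<in> ?balls"
    then obtain p v0 \<epsilon> where U: "U = ae_class \<mu> ` {v \<in> W1_fun I \<infinity>. p (ae_class \<mu> (\<lambda>t. v t - v0 t)) < \<epsilon>}"
      and p_in: "p \<in> (\<Union>n\<in>{2..}. T_seminorms I n)" and v0: "v0 \<in> W1_fun I \<infinity>"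
      by (elim CollectE exE conjE) (rule that)
    from p_in obtain n where n: "2 \<le> n" and "p \<in> T_seminorms I n" by (elim UN_E) simp
    then obtain f where f: "f \<in> W1_dual I (of_nat n)" and p: "p = (\<lambda>U \<in> W1 I \<infinity>. \<bar>f U\<bar>)"
      unfolding T_seminorms_def by (elim CollectE bexE)
    have n1: "1 \<le> n" using n by simp
    have p_diff: "p (ae_class \<mu> (\<lambda>t. v t - v0 t)) = \<bar>f (ae_class \<mu> v) - f (ae_class \<mu> v0)\<bar>"
      if v: "v \<in> W1_fun I \<infinity>" for v
    proof -
      have "ae_class \<mu> (\<lambda>t. v t - v0 t) \<in> W1 I \<infinity>"
        unfolding W1_def by (rule imageI[OF W1_fun_diff[OF v v0]])
      then show ?thesis unfolding p by (simp only: restrict_apply' W1_dual_diff[OF f n1 v v0])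
    qed
    \<comment> \<open>A subbasic set is an image of functions under \<open>ae_class\<close>. The
      functional sees only the class, so the representative v that witnesses membership may differ
      from \<open>u k\<close>.\<close>
    have iff: "\<Phi> k \<in> U \<longleftrightarrow> f (\<Phi> k) \<in> ball (f (ae_class \<mu> v0)) \<epsilon>" if k: "k \<in> ?K" for k
    proof
      assume "\<Phi> k \<in> U"
      then obtain v where v: "v \<in> W1_fun I \<infinity>" "p (ae_class \<mu> (\<lambda>t. v t - v0 t)) < \<epsilon>" "\<Phi> k = ae_class \<mu> v"
        unfolding U by (elim imageE CollectE conjE) (rule that)
      then show "f (\<Phi> k) \<in> ball (f (ae_class \<mu> v0)) \<epsilon>"
        using p_diff[OF v(1)] by (simp add: dist_real_def abs_minus_commute)
    next
      assume "f (\<Phi> k) \<in> ball (f (ae_class \<mu> v0)) \<epsilon>"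
      then have "p (ae_class \<mu> (\<lambda>t. u k t - v0 t)) < \<epsilon>"
        using p_diff[OF u_W1[OF k]] by (simp add: dist_real_def abs_minus_commute \<Phi>_def)
      then show "\<Phi> k \<in> U" unfolding U \<Phi>_def by (intro imageI CollectI conjI u_W1[OF k])
    qed
    have "\<Phi> -` U \<inter> topspace (top_of_set ?K) = ?K \<inter> (\<lambda>k. f (\<Phi> k)) -` ball (f (ae_class \<mu> v0)) \<epsilon>"
      unfolding topspace_euclidean_subtopology using iff by (intro set_eqI) (simp only: Int_iff vimage_eq, blast)
    then show "openin (top_of_set ?K) (\<Phi> -` U \<inter> topspace (top_of_set ?K))"
      by (simp only: continuous_openin_preimage_gen[OF cont_f[OF f n1] open_ball])
  next
    let ?balls = "{ae_class \<mu> ` {v \<in> W1_fun I \<infinity>. \<rho> (ae_class \<mu> (\<lambda>t. v t - u t)) < \<epsilon>}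
      | \<rho> (u :: real \<Rightarrow> 'e) \<epsilon>. \<rho> \<in> (\<Union>n\<in>{2..}. T_seminorms I n) \<and> u \<in> W1_fun I \<infinity> \<and> 0 < \<epsilon>}"
    let ?p = "\<lambda>U \<in> (W1 I \<infinity> :: (real \<Rightarrow> 'e) set set). \<bar>0 :: real\<bar>"
    have p: "?p \<in> (\<Union>n\<in>{2..}. T_seminorms I n)"
      using zero_T_seminorm[of I 2] by (intro UN_I[where a = 2]) auto
    show "\<Phi> ` topspace (top_of_set ?K) \<subseteq> \<Union> ?balls"
    proof
      fix V assume "V \<in> \<Phi> ` topspace (top_of_set ?K)"
      then obtain k where k: "k \<in> ?K" "V = ae_class \<mu> (u k)" by (auto simp: \<Phi>_def)
      have "ae_class \<mu> (\<lambda>t. u k t - u k t) \<in> W1 I \<infinity>"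
        unfolding W1_def by (rule imageI[OF W1_fun_diff[OF u_W1[OF k(1)] u_W1[OF k(1)]]])
      then have "?p (ae_class \<mu> (\<lambda>t. u k t - u k t)) < 1"
        by (simp only: restrict_apply' abs_zero zero_less_one)
      then have V: "V \<in> ae_class \<mu> ` {v \<in> W1_fun I \<infinity>. ?p (ae_class \<mu> (\<lambda>t. v t - u k t)) < 1}"
        unfolding k(2) by (intro imageI CollectI conjI u_W1[OF k(1)])
      show "V \<in> \<Union> ?balls"
        by (rule UnionI[OF _ V], rule CollectI)
          (intro exI[of _ ?p] exI[of _ "u k"] exI[of _ 1] conjI refl p u_W1[OF k(1)] zero_less_one)
    qed
  qed
  have "W1_cball I \<infinity> R = \<Phi> ` ?K"
  proof (intro equalityI subsetI)
    fix V :: "(real \<Rightarrow> 'e) set" assume "V \<in> W1_cball I \<infinity> R"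
    then obtain v where v: "v \<in> W1_fun I \<infinity>" "W1_norm I \<infinity> v \<le> R" and V: "V = ae_class \<mu> v"
      by (auto simp: W1_cball_def)
    obtain x' w' where w': "w' \<in> bounded_measurable \<mu>" and eq: "AE t in \<mu>. v t = x' + primitive w' t"
      and w'_le: "\<And>t. norm (w' t) \<le> Lp_norm \<mu> \<infinity> (weak_deriv I v)"
      and v_le: "\<And>t. t \<in> interior I \<Longrightarrow> norm (x' + primitive w' t) \<le> Lp_norm \<mu> \<infinity> v"
      by (rule W1_fun_infinity_representation[OF v(1)]) blast
    \<comment> \<open>The exact norms of v and of its weak derivative serve as the last two
      coordinates; their sum is at most R by assumption.\<close>
    define k where "k = data_of x' w' (Lp_norm \<mu> \<infinity> v) (Lp_norm \<mu> \<infinity> (weak_deriv I v))"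
    have k: "k \<in> ?K"
      unfolding k_def using v(2) w'_le v_le
      by (intro data_of_in_ball_data[OF w'] Lp_norm_nonneg) (auto simp: W1_norm_def)
    \<comment> \<open>The pair chosen for k need not be the one k was built from, but equal
      coordinates give equal functions.\<close>
    have "u k t = x' + primitive w' t" for t
      unfolding u_def
    proof (rule const_primitive_eqI[OF w[OF k] w'])
      show "blinfun_apply \<xi> (x k) = blinfun_apply \<xi> x'" for \<xi> :: "'e \<Rightarrow>\<^sub>L real"
        using X_eq[OF k, of \<xi>] by (simp add: k_def data_of_def)
      show "(LINT t|\<mu>. indicat_real A t * blinfun_apply \<xi> (w k t)) = (LINT t|\<mu>. indicat_real A t * blinfun_apply \<xi> (w' t))"
        if "A \<in> sets \<mu>" for A and \<xi> :: "'e \<Rightarrow>\<^sub>L real"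
        using W_eq[OF k that, of \<xi>] that unfolding k_def data_of_def fst_conv snd_conv prod.case by simp
    qed
    then have "AE t in \<mu>. v t = u k t" using eq by simp
    then have "V = \<Phi> k" unfolding V \<Phi>_def by (rule ae_class_cong)
    then show "V \<in> \<Phi> ` ?K" using k by blast
  next
    fix V assume "V \<in> \<Phi> ` ?K"
    then obtain k where k: "k \<in> ?K" and V: "V = ae_class \<mu> (u k)" by (auto simp: \<Phi>_def)
    have wd: "has_weak_deriv I (u k) (w k)" unfolding u_def by (rule has_weak_deriv_const_primitive[OF w[OF k]])
    have "W1_norm I \<infinity> (u k) = Lp_norm \<mu> \<infinity> (u k) + Lp_norm \<mu> \<infinity> (w k)"
      by (rule W1_norm_has_weak_deriv[OF wd bounded_measurable_borel[OF w[OF k]]])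
    \<comment> \<open>In general data the last two coordinates only bound the norms from above,
      which is enough here.\<close>
    also have "\<dots> \<le> fst (snd (snd k)) + snd (snd (snd k))"
    proof (rule add_mono)
      have "AE t in \<mu>. norm (u k t) \<le> fst (snd (snd k))"
        using AE_interior by eventually_elim (simp add: u_def u_le[OF k])
      then show "Lp_norm \<mu> \<infinity> (u k) \<le> fst (snd (snd k))"
        using u_meas[OF k] \<rho>\<sigma>[OF k] by (intro Lp_norm_infinity_le)
      show "Lp_norm \<mu> \<infinity> (w k) \<le> snd (snd (snd k))"
        using bounded_measurable_borel[OF w[OF k]] w_le[OF k] \<rho>\<sigma>[OF k] by (intro Lp_norm_infinity_le AE_I2)
    qed
    also have "\<dots> \<le> R" using \<rho>\<sigma>[OF k] by simp
    finally show "V \<in> W1_cball I \<infinity> R" unfolding W1_cball_def V using u_W1[OF k] by blast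
  qed
  moreover have "compactin (T_topology I) (\<Phi> ` ?K)"
  proof (rule image_compactin[OF _ cont])
    show "compactin (top_of_set ?K) ?K"
      using compact_ball_data[OF ne] by (simp add: compactin_subtopology)
  qed
  ultimately show ?thesis by simp
qed

end

theorem proposition6p5:
  fixes I :: "real set" and R :: real
  assumes "reflexive_space TYPE('e::{banach, second_countable_topology})"
    and "is_interval I" and "bounded I"
    and "R > 0"
  shows "compact_space
    (subtopology (T_topology I) (W1_cball I \<infinity> R :: (real \<Rightarrow> 'e) set set))"
proof -
  interpret bounded_interval I by unfold_locales (fact assms)+
  show ?thesis
  proof (cases "interior I = {}")
    case False
    have "compactin (T_topology I) (W1_cball I \<infinity> R :: (real \<Rightarrow> 'e) set set)"
      by (rule compact_W1_cball[OF assms(1) False]) (use assms(4) in simp)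
    then show ?thesis by (rule compactin_subspace[THEN iffD1, THEN conjunct2])
  next
    case True
    \<comment> \<open>A bounded interval without interior points is a null set, so all measurable
      functions on it form one class and the ball has at most one point.\<close>
    have "ae_class \<mu> u = borel_measurable \<mu>" for u :: "real \<Rightarrow> 'e"
    proof -
      have "AE t in \<mu>. v t = u t" for v :: "real \<Rightarrow> 'e"
        using AE_interior by eventually_elim (simp add: True)
      then show ?thesis by (simp add: ae_class_def)
    qed
    then have "(W1_cball I \<infinity> R :: (real \<Rightarrow> 'e) set set) \<subseteq> {borel_measurable \<mu>}"
      by (auto simp: W1_cball_def)
    then have "finite (topspace (subtopology (T_topology I) (W1_cball I \<infinity> R :: (real \<Rightarrow> 'e) set set)))"
      by (simp add: finite_subset)
    then show ?thesis by (simp add: compact_space_def finite_imp_compactin_eq)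
  qed
qed

end
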